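(* Let $\Gamma$ be a circle of curvature $c$ (with $c>1$) included in the plane $P=\{(0,y,z): y,z\in\mathbb{R}\}$ of $\mathrm{Sol}$. If $M$ is a compact surface spanning $\Gamma$ and with constant mean curvature $H$, then $$|H|\leq \frac{c+1}{c-1}\cdot\frac{c+\sqrt{c^2-1}}{2}.$$
   Context: $\mathrm{Sol}$ is $\mathbb{R}^3$ with canonical coordinates $(x,y,z)$ and the Riemannian metric $\langle\cdot,\cdot\rangle=e^{2z}dx^2+e^{-2z}dy^2+dz^2$. The plane $P$ with the induced metric $e^{-2z}dy^2+dz^2$ is isometric to the hyperbolic plane of curvature $-1$ (setting $t=e^z$ gives the upper half-plane metric $(dy^2+dt^2)/t^2$). A circle of curvature $c$ in $P$ is a closed curve of constant intrinsic geodesic curvature $c$ in $P$, i.e. a geodesic circle of this hyperbolic plane; necessarily $c>1$. A compact surface $M$ with non-empty boundary spans $\Gamma$ (has boundary $\Gamma$) if there is an isometric immersion of $M$ into $\mathrm{Sol}$ whose restriction to $\partial M$ is a diffeomorphism onto $\Gamma$. The mean curvature $H$ is half the trace of the second fundamental form with respect to a unit normal field. *)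

theory Defs
  imports "HOL-Analysis.Analysis"
begin

section \<open>Smooth maps\<close>

fun C_k_on :: "nat \<Rightarrow> 'a::euclidean_space set \<Rightarrow> ('a \<Rightarrow> 'b::real_normed_vector) \<Rightarrow> bool" where
  "C_k_on 0 W F \<longleftrightarrow> continuous_on W F"
| "C_k_on (Suc k) W F \<longleftrightarrow>
     (\<forall>x\<in>W. F differentiable (at x)) \<and>
     (\<forall>v. C_k_on k W (\<lambda>x. frechet_derivative F (at x) v))"

text \<open>On a set that need not be open (a piece of a half-plane, a piece of a curve in space),
  smooth means: locally the restriction of a smooth map defined on an open set.\<close>

definition smooth_on :: "'a::euclidean_space set \<Rightarrow> ('a \<Rightarrow> 'b::real_normed_vector) \<Rightarrow> bool" where
  "smooth_on S F \<longleftrightarrow>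
     (\<forall>x\<in>S. \<exists>W G. open W \<and> x \<in> W \<and> (\<forall>k. C_k_on k W G) \<and> (\<forall>y\<in>S \<inter> W. G y = F y))"

text \<open>Derivative along \<open>S\<close>. It is only used for \<open>S\<close> relatively open in a half-plane, or for
  \<open>S = UNIV\<close>, where the derivative within \<open>S\<close> is unique, also at boundary points.\<close>

definition deriv_along :: "'a::euclidean_space set \<Rightarrow> ('a \<Rightarrow> 'b::real_normed_vector) \<Rightarrow> 'a \<Rightarrow> 'a \<Rightarrow> 'b" where
  "deriv_along S F e u = frechet_derivative F (at u within S) e"


section \<open>Riemannian metrics on coordinate space\<close>

type_synonym 'n riem_metric = "real^'n \<Rightarrow> real^'n \<Rightarrow> real^'n \<Rightarrow> real"

definition metric_matrix :: "('n::finite) riem_metric \<Rightarrow> real^'n \<Rightarrow> real^'n^'n" where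
  "metric_matrix g p = (\<chi> i j. g p (axis i 1) (axis j 1))"

definition metric_partial :: "('n::finite) riem_metric \<Rightarrow> 'n \<Rightarrow> 'n \<Rightarrow> 'n \<Rightarrow> real^'n \<Rightarrow> real" where
  "metric_partial g i j l p = deriv_along UNIV (\<lambda>q. metric_matrix g q $ j $ l) (axis i 1) p"

definition christoffel :: "('n::finite) riem_metric \<Rightarrow> real^'n \<Rightarrow> 'n \<Rightarrow> 'n \<Rightarrow> 'n \<Rightarrow> real" where
  "christoffel g p k i j =
     (\<Sum>l\<in>UNIV. matrix_inv (metric_matrix g p) $ k $ l *
        (metric_partial g i j l p + metric_partial g j i l p - metric_partial g l i j p)) / 2"

text \<open>Levi-Civita derivative, in the parameter direction \<open>e\<close>, of a vector field \<open>V\<close>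
  along a map \<open>F\<close> defined on \<open>S\<close>.\<close>

definition covariant_deriv ::
  "('n::finite) riem_metric \<Rightarrow> 'a::euclidean_space set \<Rightarrow> ('a \<Rightarrow> real^'n) \<Rightarrow> ('a \<Rightarrow> real^'n) \<Rightarrow> 'a \<Rightarrow> 'a \<Rightarrow> real^'n"
  where
  "covariant_deriv g S F V e u =
     deriv_along S V e u +
     (\<chi> k. \<Sum>i\<in>UNIV. \<Sum>j\<in>UNIV. christoffel g (F u) k i j * deriv_along S F e u $ i * V u $ j)"


section \<open>The space Sol and the plane \<open>x = 0\<close>\<close>

definition sol_metric :: "3 riem_metric" where
  "sol_metric p v w =
     exp (2 * p$3) * v$1 * w$1 + exp (- 2 * p$3) * v$2 * w$2 + v$3 * w$3"

definition P_incl :: "real^2 \<Rightarrow> real^3" where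
  "P_incl q = vector [0, q$1, q$2]"

text \<open>The inclusion is linear, hence its own differential.\<close>

definition P_metric :: "2 riem_metric" where
  "P_metric q v w = sol_metric (P_incl q) (P_incl v) (P_incl w)"

text \<open>A closed curve parametrised by arc length whose intrinsic acceleration in the plane has
  constant length \<open>c\<close>, i.e. whose geodesic curvature (up to the choice of its sign) is \<open>c\<close>.\<close>

definition circle_of_curvature :: "real \<Rightarrow> (real^3) set \<Rightarrow> bool" where
  "circle_of_curvature c \<Gamma> \<longleftrightarrow>
     (\<exists>\<gamma> :: real \<Rightarrow> real^2. \<exists>T>0.
        smooth_on UNIV \<gamma> \<and> (\<forall>t. \<gamma> (t + T) = \<gamma> t) \<and>
        (let v = deriv_along UNIV \<gamma> 1; a = covariant_deriv P_metric UNIV \<gamma> v 1 in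
           \<forall>t. P_metric (\<gamma> t) (v t) (v t) = 1 \<and> sqrt (P_metric (\<gamma> t) (a t) (a t)) = c) \<and>
        \<Gamma> = P_incl ` range \<gamma>)"


section \<open>Surfaces with boundary\<close>

definition half_plane :: "(real^2) set" where
  "half_plane = {u. u$2 \<ge> 0}"

text \<open>A chart is a pair \<open>(U, \<phi>)\<close>; the values of \<open>\<phi>\<close> outside \<open>U\<close> are irrelevant.\<close>

type_synonym 'a chart = "'a set \<times> ('a \<Rightarrow> real^2)"

definition is_chart :: "'a topology \<Rightarrow> 'a chart \<Rightarrow> bool" where
  "is_chart X = (\<lambda>(U, \<phi>).
     openin X U \<and> openin (top_of_set half_plane) (\<phi> ` U) \<and>
     homeomorphic_map (subtopology X U) (top_of_set (\<phi> ` U)) \<phi>)"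

definition smooth_surface :: "'a topology \<Rightarrow> 'a chart set \<Rightarrow> bool" where
  "smooth_surface X A \<longleftrightarrow>
     Hausdorff_space X \<and> second_countable X \<and>
     (\<forall>ch\<in>A. is_chart X ch) \<and> (\<Union>(U, \<phi>)\<in>A. U) = topspace X \<and>
     (\<forall>(U, \<phi>)\<in>A. \<forall>(V, \<psi>)\<in>A. smooth_on (\<phi> ` (U \<inter> V)) (\<psi> \<circ> inv_into U \<phi>))"

definition compact_surface :: "'a topology \<Rightarrow> 'a chart set \<Rightarrow> bool" where
  "compact_surface X A \<longleftrightarrow> smooth_surface X A \<and> compact_space X"

definition surface_boundary :: "'a chart set \<Rightarrow> 'a set" where
  "surface_boundary A = {p. \<exists>(U, \<phi>)\<in>A. p \<in> U \<and> \<phi> p $ 2 = 0}"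

definition immersion :: "'a chart set \<Rightarrow> ('a \<Rightarrow> real^3) \<Rightarrow> bool" where
  "immersion A f \<longleftrightarrow>
     (\<forall>(U, \<phi>)\<in>A. let S = \<phi> ` U; F = f \<circ> inv_into U \<phi> in
        smooth_on S F \<and> (\<forall>u\<in>S. inj (\<lambda>e. deriv_along S F e u)))"

text \<open>The restriction of \<open>f\<close> to the boundary is a diffeomorphism onto the curve \<open>\<Gamma>\<close> in space,
  smoothness being read in the boundary charts.\<close>

definition boundary_diffeo :: "'a chart set \<Rightarrow> ('a \<Rightarrow> real^3) \<Rightarrow> (real^3) set \<Rightarrow> bool" where
  "boundary_diffeo A f \<Gamma> \<longleftrightarrow>
     (let B = surface_boundary A in
        bij_betw f B \<Gamma> \<and>
        (\<forall>(U, \<phi>)\<in>A. smooth_on (\<phi> ` (U \<inter> B)) (f \<circ> inv_into U \<phi>) \<and>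
                    smooth_on (f ` (U \<inter> B)) (\<phi> \<circ> inv_into B f)))"

text \<open>The surface carries the metric induced by \<open>f\<close>, so that an immersion is
  automatically isometric.\<close>

definition spans_by :: "'a chart set \<Rightarrow> ('a \<Rightarrow> real^3) \<Rightarrow> (real^3) set \<Rightarrow> bool" where
  "spans_by A f \<Gamma> \<longleftrightarrow>
     surface_boundary A \<noteq> {} \<and> immersion A f \<and> boundary_diffeo A f \<Gamma>"


section \<open>Mean curvature\<close>

text \<open>Here \<open>F\<close> is an immersion of \<open>S\<close>, a relatively open subset of the half-plane, into Sol,
  and \<open>N\<close> is a vector field along \<open>F\<close>.\<close>

definition unit_normal_field :: "(real^2) set \<Rightarrow> (real^2 \<Rightarrow> real^3) \<Rightarrow> (real^2 \<Rightarrow> real^3) \<Rightarrow> bool" where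
  "unit_normal_field S F N \<longleftrightarrow>
     smooth_on S N \<and>
     (\<forall>u\<in>S. sol_metric (F u) (N u) (N u) = 1 \<and>
            (\<forall>e. sol_metric (F u) (deriv_along S F e u) (N u) = 0))"

definition first_form :: "(real^2) set \<Rightarrow> (real^2 \<Rightarrow> real^3) \<Rightarrow> real^2 \<Rightarrow> real^2^2" where
  "first_form S F u =
     (\<chi> i j. sol_metric (F u) (deriv_along S F (axis i 1) u) (deriv_along S F (axis j 1) u))"

definition second_form ::
  "(real^2) set \<Rightarrow> (real^2 \<Rightarrow> real^3) \<Rightarrow> (real^2 \<Rightarrow> real^3) \<Rightarrow> real^2 \<Rightarrow> real^2^2" where
  "second_form S F N u =
     (\<chi> i j. sol_metric (F u)
        (covariant_deriv sol_metric S F (deriv_along S F (axis j 1)) (axis i 1) u) (N u))"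

definition mean_curvature ::
  "(real^2) set \<Rightarrow> (real^2 \<Rightarrow> real^3) \<Rightarrow> (real^2 \<Rightarrow> real^3) \<Rightarrow> real^2 \<Rightarrow> real" where
  "mean_curvature S F N u = trace (matrix_inv (first_form S F u) ** second_form S F N u) / 2"

text \<open>The unit normal field is only required over each chart domain. If \<open>H \<noteq> 0\<close>, the unit normal
  with mean curvature \<open>H\<close> at a point is unique, so that the local fields agree on overlaps and
  form a global unit normal field; for \<open>H = 0\<close> non-orientable minimal surfaces are included.\<close>

definition constant_mean_curvature :: "'a chart set \<Rightarrow> ('a \<Rightarrow> real^3) \<Rightarrow> real \<Rightarrow> bool" where
  "constant_mean_curvature A f H \<longleftrightarrow>
     (\<forall>(U, \<phi>)\<in>A. let S = \<phi> ` U; F = f \<circ> inv_into U \<phi> in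
        \<exists>N. unit_normal_field S F N \<and> (\<forall>u\<in>S. mean_curvature S F N u = H))"

end

theory Submission
  imports Defs
begin

text \<open>The bound follows from a flux formula. Translation in the \<open>x\<close>-direction is an isometry of
  Sol, with Killing field \<open>\<partial>\<^sub>x\<close>. Along a surface with unit normal \<open>N\<close>, let \<open>\<eta>\<close> be the
  1-form \<open>w \<mapsto> vol (\<partial>\<^sub>x, N, w)\<close>; on a unit boundary tangent it is, up to sign, the component of \<open>\<partial>\<^sub>x\<close>
  along the conormal. As \<open>\<partial>\<^sub>x\<close> is Killing, only the derivative of \<open>N\<close> contributes to \<open>d\<eta>\<close>, and constant
  mean curvature \<open>H\<close> gives \<open>d\<eta> = - 2 H (dy \<and> dz)\<close>: the contraction of the volume form with
  \<open>\<partial>\<^sub>x\<close> is \<open>dy \<and> dz\<close> (\<open>wein_cross_E\<close>, \<open>flux_closed\<close>). So \<open>\<eta> + 2 H \<lambda>\<close> is closed for every primitive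
  \<open>\<lambda>\<close> of \<open>dy \<and> dz\<close>, and by Stokes its integral over the boundary is zero.

  In the coordinates \<open>y\<close> and \<open>exp z\<close> the boundary circle is a Euclidean circle, of radius \<open>R\<close>
  and with centre at height \<open>R c\<close> (\<open>circle_of_curvature_param\<close>). Per unit of its angle \<open>\<eta>\<close> is at
  most \<open>R\<close>, while a suitable \<open>\<lambda>\<close> is at least \<open>R / (2 (c + 1))\<close> at every point of the circle
  (\<open>sgn_flux\<close>). If \<open>\<bar>H\<bar>\<close> were greater than \<open>c + 1\<close>, then \<open>2 H \<lambda>\<close> would
  dominate, and the closed form would have a constant sign along the boundary, which contradicts
  Stokes. Hence \<open>\<bar>H\<bar> \<le> c + 1\<close> (\<open>mean_curvature_le\<close>), and \<open>c + 1\<close> is at most the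
  claimed bound.

  Stokes is used in the form that a closed 1-form which is nonnegative along the boundary vanishes
  there (\<open>nonneg_on_boundary_imp_zero\<close>). With a partition of unity \<open>\<rho>\<^sub>i\<close> this reduces to Green's
  formula on the half-plane (\<open>half_plane_Green\<close>) and to \<open>\<Sum> d\<rho>\<^sub>i = 0\<close>, where the change of
  variables between charts compares the integrals. The surface carries no given orientation; instead
  the form changes sign with the orientation of the chart, so that \<open>d\<rho>\<^sub>i \<and> \<omega>\<close> is a density. For
  the flux form this is achieved with the sign of the chart relative to \<open>N\<close>, which makes sense
  because the normals in different charts agree when \<open>H \<noteq> 0\<close> (\<open>nrm_trans\<close>). It remains to
  see that the boundary runs through the whole circle in one sense (\<open>sense_constant\<close>), which holds
  because the circle is connected.\<close>

section \<open>Calculus on relatively open pieces of the half-plane\<close>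

abbreviation E1 :: "real^2" where "E1 \<equiv> axis 1 1"
abbreviation E2 :: "real^2" where "E2 \<equiv> axis 2 1"

abbreviation relopen :: "(real^2) set \<Rightarrow> bool" where
  "relopen S \<equiv> openin (top_of_set half_plane) S"

definition C1_on :: "(real^2) set \<Rightarrow> (real^2 \<Rightarrow> 'b::real_normed_vector) \<Rightarrow> bool" where
  "C1_on S g \<longleftrightarrow>
     (\<forall>u\<in>S. g differentiable (at u within S)) \<and> (\<forall>e. continuous_on S (deriv_along S g e))"

lemma vec2_decomp: "e = e$1 *\<^sub>R E1 + e$2 *\<^sub>R E2" for e :: "real^2"
  by (simp add: vec_eq_iff forall_2 axis_def)

lemma linear_vec2:
  assumes "linear D" shows "D e = e$1 *\<^sub>R D E1 + e$2 *\<^sub>R D E2"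
  proof -
  have "D e = D (e$1 *\<^sub>R E1 + e$2 *\<^sub>R E2)" using vec2_decomp[of e] by simp
  also have "\<dots> = e$1 *\<^sub>R D E1 + e$2 *\<^sub>R D E2" using assms by (simp add: linear_add linear_scale)
  finally show ?thesis .
qed

lemma at_within_openin:
  assumes "openin (top_of_set T) S" "u \<in> S"
  shows "at u within S = at u within T"
proof -
  obtain W where "open W" "S = T \<inter> W" using assms(1) by (auto simp: openin_open)
  then show ?thesis using assms(2) by (intro at_within_nhd[of u W]) auto
qed

text \<open>Moving off a point of the half-plane in either coordinate direction, in the positive sense,
  stays inside it; that is enough to pin down the derivative at boundary points.\<close>

lemma relopen_derivative_unique:
  assumes S: "relopen S" and u: "u \<in> S"
    and D: "(g has_derivative D) (at u within S)" "(g has_derivative D') (at u within S)"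
  shows "D = D'"
proof (rule frechet_derivative_unique_within[OF D])
  fix i :: "real^2" and e :: real assume i: "i \<in> Basis" and e: "0 < e"
  obtain W where W: "open W" "S = half_plane \<inter> W" using S by (auto simp: openin_open)
  then obtain r where r: "r > 0" "ball u r \<subseteq> W" using u open_contains_ball by blast
  define d where "d = min e r / 2"
  have d: "0 < d" "d < e" "d < r" using e r by (auto simp: d_def min_def)
  have "norm (d *\<^sub>R i) < r" using i d by (simp add: norm_Basis)
  then have "u + d *\<^sub>R i \<in> ball u r" by (simp add: dist_norm)
  moreover have "u + d *\<^sub>R i \<in> half_plane"
    using u W(2) i d by (auto simp: half_plane_def Basis_vec_def axis_def)
  ultimately show "\<exists>d. 0 < \<bar>d\<bar> \<and> \<bar>d\<bar> < e \<and> u + d *\<^sub>R i \<in> S"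
    using W(2) r(2) d by (intro exI[of _ d]) auto
qed

lemma deriv_along_eq:
  assumes "relopen S" "u \<in> S" "(g has_derivative D) (at u within S)"
  shows "deriv_along S g e u = D e"
proof -
  have "(g has_derivative frechet_derivative g (at u within S)) (at u within S)"
    using assms(3) differentiableI frechet_derivative_works by blast
  from relopen_derivative_unique[OF assms(1,2) this assms(3)]
  show ?thesis by (simp add: deriv_along_def)
qed

lemma has_derivative_along:
  assumes "g differentiable (at u within S)"
  shows "(g has_derivative (\<lambda>e. deriv_along S g e u)) (at u within S)"
  using assms unfolding deriv_along_def by (simp add: frechet_derivative_works)

lemma linear_deriv_along:
  assumes "g differentiable (at u within S)"
  shows "linear (\<lambda>e. deriv_along S g e u)"
  using has_derivative_along[OF assms] has_derivative_linear by blast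

lemma C1_onD:
  assumes "C1_on S g" "u \<in> S"
  shows "(g has_derivative (\<lambda>e. deriv_along S g e u)) (at u within S)"
  using assms has_derivative_along unfolding C1_on_def by blast

lemma C1_on_imp_continuous_on: "C1_on S g \<Longrightarrow> continuous_on S g"
  unfolding C1_on_def continuous_on_eq_continuous_within
  using differentiable_imp_continuous_within by blast

lemma C1_onI:
  assumes "relopen S" "\<And>u. u \<in> S \<Longrightarrow> (g has_derivative g' u) (at u within S)"
    "\<And>e. continuous_on S (\<lambda>u. g' u e)"
  shows "C1_on S g"
  unfolding C1_on_def
proof (intro conjI ballI allI)
  fix u assume "u \<in> S" then show "g differentiable (at u within S)" using assms(2) differentiableI by blast
next
  fix e show "continuous_on S (deriv_along S g e)"
    using assms(3)[of e] by (rule continuous_on_eq) (simp add: deriv_along_eq[OF assms(1) _ assms(2)])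
qed

lemma deriv_along_cong:
  assumes "relopen S" "u \<in> S" "open W" "u \<in> W" "\<And>x. x \<in> S \<inter> W \<Longrightarrow> g x = h x"
  shows "g differentiable (at u within S) \<longleftrightarrow> h differentiable (at u within S)"
    "deriv_along S g e u = deriv_along S h e u"
proof -
  obtain r where r: "r > 0" "ball u r \<subseteq> W" using assms(3,4) open_contains_ball by blast
  have eq: "g x = h x" if "x \<in> S" "dist x u < r" for x
    using that r(2) assms(5)[of x] by (auto simp: dist_commute subset_iff)
  have *: "(g has_derivative D) (at u within S) \<longleftrightarrow> (h has_derivative D) (at u within S)" for D
    using eq assms(2) by (intro iffI; elim has_derivative_transform_within[OF _ r(1)]) auto
  show "g differentiable (at u within S) \<longleftrightarrow> h differentiable (at u within S)"
    by (simp add: differentiable_def *)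
  show "deriv_along S g e u = deriv_along S h e u"
    by (simp add: deriv_along_def frechet_derivative_def *)
qed


lemma C1_on_cong: "relopen S \<Longrightarrow> C1_on S g \<Longrightarrow> (\<And>x. x \<in> S \<Longrightarrow> g x = h x) \<Longrightarrow> C1_on S h"
  using deriv_along_cong[of S _ UNIV g h] unfolding C1_on_def
  by (auto intro: continuous_on_eq)

text \<open>Functions on a surface are often given by different formulas on different pieces, for example
  a bump inside its support and zero outside; regularity is then checked piece by piece.\<close>

lemma C1_on_local:
  assumes S: "relopen S"
    and loc: "\<And>u. u \<in> S \<Longrightarrow> \<exists>T h. openin (top_of_set S) T \<and> u \<in> T \<and> C1_on T h \<and> (\<forall>x\<in>T. g x = h x)"
  shows "C1_on S g"
proof -
  have *: "g differentiable (at u within S) \<and> (\<forall>e. continuous (at u within S) (deriv_along S g e))"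
    if u: "u \<in> S" for u
  proof -
    obtain T h where T: "openin (top_of_set S) T" "u \<in> T" "C1_on T h" "\<forall>x\<in>T. g x = h x"
      using loc u by blast
    have TS: "relopen T" using T(1) S openin_trans by blast
    have gT: "C1_on T g" by (rule C1_on_cong[OF TS T(3)]) (use T in auto)
    have at: "at x within T = at x within S" if "x \<in> T" for x
      using at_within_openin[OF T(1) that] .
    have d: "deriv_along T g e x = deriv_along S g e x" if "x \<in> T" for x e
      by (simp add: deriv_along_def at[OF that])
    have cT: "continuous_on T (deriv_along S g e)" for e
      by (rule continuous_on_eq[of T "deriv_along T g e"]) (use gT d in \<open>auto simp: C1_on_def\<close>)
    have "continuous (at u within S) (deriv_along S g e)" for e
      using cT[of e] T(2) unfolding continuous_on_eq_continuous_within at[OF T(2), symmetric] by blast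
    moreover have "g differentiable (at u within S)"
      using gT T(2) at unfolding C1_on_def by auto
    ultimately show ?thesis by blast
  qed
  then show ?thesis unfolding C1_on_def continuous_on_eq_continuous_within by blast
qed

lemma C1_on_subset:
  assumes "relopen S" "openin (top_of_set S) T" "C1_on S g" shows "C1_on T g"
proof -
  have TS: "relopen T" "T \<subseteq> S" using assms openin_trans openin_imp_subset by blast+
  show ?thesis
  proof (rule C1_onI[OF TS(1)])
    show "(g has_derivative (\<lambda>e. deriv_along S g e u)) (at u within T)" if "u \<in> T" for u
      using C1_onD[OF assms(3)] TS(2) that has_derivative_subset by blast
    show "continuous_on T (\<lambda>u. deriv_along S g e u)" for e
      using assms(3) TS(2) continuous_on_subset unfolding C1_on_def by blast
  qed
qed

lemma C1_on_const: "relopen S \<Longrightarrow> C1_on S (\<lambda>_. k)"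
  by (rule C1_onI[of _ _ "\<lambda>_ _. 0"]) auto

lemma C1_on_continuous_deriv: "C1_on S g \<Longrightarrow> continuous_on S (deriv_along S g e)"
  unfolding C1_on_def by blast

lemma C1_on_add:
  assumes S: "relopen S" and g: "C1_on S g" and h: "C1_on S h"
  shows "C1_on S (\<lambda>u. g u + h u)"
proof -
  have d: "((\<lambda>u. g u + h u) has_derivative (\<lambda>e. deriv_along S g e u + deriv_along S h e u)) (at u within S)"
    if "u \<in> S" for u by (intro has_derivative_add C1_onD g h that)
  show ?thesis
    by (rule C1_onI[OF S d]) (auto intro!: continuous_intros C1_on_continuous_deriv g h)
qed

lemma C1_on_sum: "relopen S \<Longrightarrow> (\<And>i. i \<in> I \<Longrightarrow> C1_on S (g i)) \<Longrightarrow> C1_on S (\<lambda>u. \<Sum>i\<in>I. g i u)"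
  by (induction I rule: infinite_finite_induct) (auto intro: C1_on_add C1_on_const)

lemma
  fixes g h :: "real^2 \<Rightarrow> real"
  assumes S: "relopen S" and g: "C1_on S g" and h: "C1_on S h"
  shows C1_on_mult: "C1_on S (\<lambda>u. g u * h u)"
    and deriv_along_mult: "u \<in> S \<Longrightarrow> deriv_along S (\<lambda>u. g u * h u) e u = deriv_along S g e u * h u + g u * deriv_along S h e u"
proof -
  have d: "((\<lambda>u. g u * h u) has_derivative (\<lambda>e. deriv_along S g e u * h u + g u * deriv_along S h e u)) (at u within S)"
    if "u \<in> S" for u
    using has_derivative_mult[OF C1_onD[OF g that] C1_onD[OF h that]] by (simp add: add.commute)
  show "C1_on S (\<lambda>u. g u * h u)"
    by (rule C1_onI[OF S d])
      (auto intro!: continuous_intros C1_on_continuous_deriv[OF g] C1_on_continuous_deriv[OF h]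
        C1_on_imp_continuous_on[OF g] C1_on_imp_continuous_on[OF h])
  show "u \<in> S \<Longrightarrow> deriv_along S (\<lambda>u. g u * h u) e u = deriv_along S g e u * h u + g u * deriv_along S h e u"
    using deriv_along_eq[OF S _ d] by blast
qed

lemma C1_on_inverse:
  fixes g :: "real^2 \<Rightarrow> real"
  assumes S: "relopen S" and g: "C1_on S g" and nz: "\<And>u. u \<in> S \<Longrightarrow> g u \<noteq> 0"
  shows "C1_on S (\<lambda>u. inverse (g u))"
proof (rule C1_onI[OF S])
  show "((\<lambda>u. inverse (g u)) has_derivative (\<lambda>e. - (inverse (g u) * deriv_along S g e u * inverse (g u)))) (at u within S)"
    if "u \<in> S" for u
    by (rule Deriv.has_derivative_inverse[OF nz[OF that] C1_onD[OF g that]])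
  show "continuous_on S (\<lambda>u. - (inverse (g u) * deriv_along S g e u * inverse (g u)))" for e
    by (auto intro!: continuous_intros C1_on_continuous_deriv[OF g] C1_on_imp_continuous_on[OF g] nz)
qed

lemma
  fixes \<tau> :: "real^2 \<Rightarrow> real^2"
  assumes S: "relopen S" "relopen T" and \<tau>: "C1_on S \<tau>" "\<tau> ` S \<subseteq> T" and g: "C1_on T g"
  shows C1_on_compose: "C1_on S (\<lambda>u. g (\<tau> u))"
    and deriv_along_compose: "u \<in> S \<Longrightarrow>
      deriv_along S (\<lambda>u. g (\<tau> u)) e u = deriv_along T g (deriv_along S \<tau> e u) (\<tau> u)"
proof -
  have d: "((\<lambda>u. g (\<tau> u)) has_derivative (\<lambda>e. deriv_along T g (deriv_along S \<tau> e u) (\<tau> u))) (at u within S)"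
    if "u \<in> S" for u
  proof -
    have "(g has_derivative (\<lambda>e. deriv_along T g e (\<tau> u))) (at (\<tau> u) within \<tau> ` S)"
      using C1_onD[OF g, of "\<tau> u"] \<tau>(2) that has_derivative_subset by blast
    from has_derivative_in_compose[OF C1_onD[OF \<tau>(1) that] this] show ?thesis by simp
  qed
  show "u \<in> S \<Longrightarrow> deriv_along S (\<lambda>u. g (\<tau> u)) e u = deriv_along T g (deriv_along S \<tau> e u) (\<tau> u)"
    using deriv_along_eq[OF S(1) _ d] by blast
  show "C1_on S (\<lambda>u. g (\<tau> u))"
  proof (rule C1_onI[OF S(1) d])
    fix e
    have lin: "linear (\<lambda>e. deriv_along T g e (\<tau> u))" if "u \<in> S" for u
      using linear_deriv_along g \<tau>(2) that unfolding C1_on_def by blast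
    have c: "continuous_on S (\<lambda>u. deriv_along T g e (\<tau> u))" for e
      by (rule continuous_on_compose2[OF C1_on_continuous_deriv[OF g] C1_on_imp_continuous_on[OF \<tau>(1)] \<tau>(2)])
    have "continuous_on S (\<lambda>u. (deriv_along S \<tau> e u)$1 *\<^sub>R deriv_along T g E1 (\<tau> u) +
        (deriv_along S \<tau> e u)$2 *\<^sub>R deriv_along T g E2 (\<tau> u))"
      by (intro continuous_intros c C1_on_continuous_deriv \<tau>)
    then show "continuous_on S (\<lambda>u. deriv_along T g (deriv_along S \<tau> e u) (\<tau> u))"
      by (rule continuous_on_eq) (simp add: linear_vec2[OF lin, symmetric])
  qed
qed

section \<open>Smooth maps on pieces of the half-plane\<close>

lemma smooth_on_local:
  assumes S: "relopen S" and F: "smooth_on S F" and u: "u \<in> S"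
  obtains W G where "open W" "u \<in> W" "\<And>k. C_k_on k W G"
    "\<And>y. y \<in> S \<inter> W \<Longrightarrow> (F has_derivative frechet_derivative G (at y)) (at y within S)"
    "\<And>y e. y \<in> S \<inter> W \<Longrightarrow> deriv_along S F e y = frechet_derivative G (at y) e"
    "\<And>y. y \<in> S \<inter> W \<Longrightarrow> F y = G y"
proof -
  obtain W G where W: "open W" "u \<in> W" "\<And>k. C_k_on k W G" "\<forall>y\<in>S \<inter> W. G y = F y"
    using F u unfolding smooth_on_def by blast
  have d: "(F has_derivative frechet_derivative G (at y)) (at y within S)" if y: "y \<in> S \<inter> W" for y
  proof -
    have "G differentiable (at y)" using W(3)[of 1] y by auto
    then have "(G has_derivative frechet_derivative G (at y)) (at y within S)"
      using frechet_derivative_works has_derivative_at_withinI by blast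
    moreover obtain r where r: "r > 0" "ball y r \<subseteq> W" using W(1) y open_contains_ball by blast
    have "G x = F x" if "x \<in> S" "dist x y < r" for x
      using that r(2) W(4) by (auto simp: dist_commute subset_iff)
    ultimately show ?thesis
      using y by (elim has_derivative_transform_within[OF _ r(1)]) auto
  qed
  show thesis
  proof (rule that[OF W(1-3) d])
    fix y assume y: "y \<in> S \<inter> W"
    show "deriv_along S F e y = frechet_derivative G (at y) e" for e
      by (rule deriv_along_eq[OF S _ d[OF y]]) (use y in blast)
    show "F y = G y" using W(4) y by simp
  qed
qed

lemma smooth_on_differentiable:
  assumes "relopen S" "smooth_on S F" "u \<in> S" shows "F differentiable (at u within S)"
proof (rule smooth_on_local[OF assms])
  fix W G assume W: "open W" "u \<in> W" "\<And>k. C_k_on k W G"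
    "\<And>y. y \<in> S \<inter> W \<Longrightarrow> (F has_derivative frechet_derivative G (at y)) (at y within S)"
    "\<And>y e. y \<in> S \<inter> W \<Longrightarrow> deriv_along S F e y = frechet_derivative G (at y) e"
    "\<And>y. y \<in> S \<inter> W \<Longrightarrow> F y = G y"
  then have "(F has_derivative frechet_derivative G (at u)) (at u within S)" using assms(3) by blast
  then show ?thesis by (rule differentiableI)
qed

lemma smooth_on_deriv_along:
  assumes S: "relopen S" and F: "smooth_on S F" shows "smooth_on S (deriv_along S F e)"
  unfolding smooth_on_def
proof
  fix u assume u: "u \<in> S"
  show "\<exists>W G. open W \<and> u \<in> W \<and> (\<forall>k. C_k_on k W G) \<and> (\<forall>y\<in>S \<inter> W. G y = deriv_along S F e y)"
  proof (rule smooth_on_local[OF S F u])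
    fix W G assume W: "open W" "u \<in> W" "\<And>k. C_k_on k W G"
    "\<And>y. y \<in> S \<inter> W \<Longrightarrow> (F has_derivative frechet_derivative G (at y)) (at y within S)"
    "\<And>y e. y \<in> S \<inter> W \<Longrightarrow> deriv_along S F e y = frechet_derivative G (at y) e"
    "\<And>y. y \<in> S \<inter> W \<Longrightarrow> F y = G y"
    have "C_k_on k W (\<lambda>x. frechet_derivative G (at x) e)" for k using W(3)[of "Suc k"] by simp
    then show ?thesis
      using W(1,2,5) by (intro exI[of _ W] exI[of _ "\<lambda>x. frechet_derivative G (at x) e"]) auto
  qed
qed

lemma smooth_on_imp_continuous_on:
  assumes "relopen S" "smooth_on S F" shows "continuous_on S F"
  unfolding continuous_on_eq_continuous_within
  using smooth_on_differentiable[OF assms] differentiable_imp_continuous_within by blast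

lemma smooth_on_imp_C1_on:
  assumes "relopen S" "smooth_on S F" shows "C1_on S F"
  unfolding C1_on_def
  using smooth_on_differentiable[OF assms]
    smooth_on_imp_continuous_on[OF assms(1) smooth_on_deriv_along[OF assms]] by blast

text \<open>Schwarz: both mixed derivatives are limits of the same second difference quotient
  (mean value theorem, applied once in each direction).\<close>

lemma mixed_difference_MVT:
  fixes g :: "'a::real_normed_vector \<Rightarrow> real"
  assumes h: "h > 0"
    and g: "\<And>s t. s \<in> {0..h} \<Longrightarrow> t \<in> {0..h} \<Longrightarrow> (g has_derivative g' (u + s *\<^sub>R a + t *\<^sub>R b)) (at (u + s *\<^sub>R a + t *\<^sub>R b))"
    and ga: "\<And>s t. s \<in> {0..h} \<Longrightarrow> t \<in> {0..h} \<Longrightarrow> ((\<lambda>x. g' x a) has_derivative ga' (u + s *\<^sub>R a + t *\<^sub>R b)) (at (u + s *\<^sub>R a + t *\<^sub>R b))"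
  shows "\<exists>s\<in>{0..h}. \<exists>t\<in>{0..h}. g (u + h *\<^sub>R a + h *\<^sub>R b) - g (u + h *\<^sub>R a) - g (u + h *\<^sub>R b) + g u
     = h^2 * ga' (u + s *\<^sub>R a + t *\<^sub>R b) b"
proof -
  define k where "k = (\<lambda>s. g (u + s *\<^sub>R a + h *\<^sub>R b) - g (u + s *\<^sub>R a))"
  have dk: "(k has_derivative (\<lambda>\<sigma>. \<sigma> * (g' (u + s *\<^sub>R a + h *\<^sub>R b) a - g' (u + s *\<^sub>R a) a))) (at s)"
    if "s \<in> {0..h}" for s
  proof -
    have 1: "((\<lambda>s. g (u + s *\<^sub>R a + t *\<^sub>R b)) has_derivative (\<lambda>\<sigma>. g' (u + s *\<^sub>R a + t *\<^sub>R b) (\<sigma> *\<^sub>R a))) (at s)"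
      if "t \<in> {0..h}" for t
      by (rule has_derivative_compose[where f = "\<lambda>s. u + s *\<^sub>R a + t *\<^sub>R b" and g = g,
            OF _ g[OF \<open>s \<in> {0..h}\<close> that]]) (auto intro!: derivative_eq_intros)
    have 2: "g' (u + s *\<^sub>R a + t *\<^sub>R b) (\<sigma> *\<^sub>R a) = \<sigma> * g' (u + s *\<^sub>R a + t *\<^sub>R b) a" if "t \<in> {0..h}" for t \<sigma>
      using linear_scale[OF has_derivative_linear[OF g[OF \<open>s \<in> {0..h}\<close> that]]] by simp
    show ?thesis unfolding k_def
      using has_derivative_diff[OF 1[of h] 1[of 0]] h
      by (simp add: 2[of h] 2[of 0, simplified] right_diff_distrib)
  qed
  have "\<exists>s\<in>{0<..<h}. k h - k 0 = (h - 0) * (g' (u + s *\<^sub>R a + h *\<^sub>R b) a - g' (u + s *\<^sub>R a) a)"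
    by (rule mvt_simple[of 0 h k "\<lambda>s \<sigma>. \<sigma> * (g' (u + s *\<^sub>R a + h *\<^sub>R b) a - g' (u + s *\<^sub>R a) a)", OF h])
      (auto intro!: has_derivative_at_withinI dk)
  then obtain s where "s \<in> {0<..<h}" "k h - k 0 = (h - 0) * (g' (u + s *\<^sub>R a + h *\<^sub>R b) a - g' (u + s *\<^sub>R a) a)" by blast
  then have s: "s \<in> {0..h}" "k h - k 0 = h * (g' (u + s *\<^sub>R a + h *\<^sub>R b) a - g' (u + s *\<^sub>R a) a)" by auto
  define l where "l = (\<lambda>t. g' (u + s *\<^sub>R a + t *\<^sub>R b) a)"
  have dl: "(l has_derivative (\<lambda>\<sigma>. \<sigma> * ga' (u + s *\<^sub>R a + t *\<^sub>R b) b)) (at t)" if "t \<in> {0..h}" for t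
  proof -
    have "(l has_derivative (\<lambda>\<sigma>. ga' (u + s *\<^sub>R a + t *\<^sub>R b) (\<sigma> *\<^sub>R b))) (at t)" unfolding l_def
      by (rule has_derivative_compose[where f = "\<lambda>t. u + s *\<^sub>R a + t *\<^sub>R b" and g = "\<lambda>x. g' x a",
            OF _ ga[OF s(1) that]]) (auto intro!: derivative_eq_intros)
    moreover have "ga' (u + s *\<^sub>R a + t *\<^sub>R b) (\<sigma> *\<^sub>R b) = \<sigma> * ga' (u + s *\<^sub>R a + t *\<^sub>R b) b" for \<sigma>
      using linear_scale[OF has_derivative_linear[OF ga[OF s(1) that]]] by simp
    ultimately show ?thesis by simp
  qed
  have "\<exists>t\<in>{0<..<h}. l h - l 0 = (h - 0) * ga' (u + s *\<^sub>R a + t *\<^sub>R b) b"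
    by (rule mvt_simple[of 0 h l "\<lambda>t \<sigma>. \<sigma> * ga' (u + s *\<^sub>R a + t *\<^sub>R b) b", OF h])
      (auto intro!: has_derivative_at_withinI dl)
  then obtain t where "t \<in> {0<..<h}" "l h - l 0 = (h - 0) * ga' (u + s *\<^sub>R a + t *\<^sub>R b) b" by blast
  then have t: "t \<in> {0..h}" "l h - l 0 = h * ga' (u + s *\<^sub>R a + t *\<^sub>R b) b" by auto
  have "k h - k 0 = h^2 * ga' (u + s *\<^sub>R a + t *\<^sub>R b) b"
    using s(2) t(2) by (simp add: l_def power2_eq_square)
  then have "g (u + h *\<^sub>R a + h *\<^sub>R b) - g (u + h *\<^sub>R a) - g (u + h *\<^sub>R b) + g u
     = h^2 * ga' (u + s *\<^sub>R a + t *\<^sub>R b) b" unfolding k_def by simp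
  then show ?thesis using s(1) t(1) by blast
qed

lemma mixed_derivatives_eq:
  fixes g :: "'a::real_normed_vector \<Rightarrow> real"
  assumes W: "open W" "u \<in> W"
    and g: "\<And>x. x \<in> W \<Longrightarrow> (g has_derivative g' x) (at x)"
    and ga: "\<And>x. x \<in> W \<Longrightarrow> ((\<lambda>x. g' x a) has_derivative ga' x) (at x)"
    and gb: "\<And>x. x \<in> W \<Longrightarrow> ((\<lambda>x. g' x b) has_derivative gb' x) (at x)"
    and c: "continuous_on W (\<lambda>x. ga' x b)" "continuous_on W (\<lambda>x. gb' x a)"
  shows "ga' u b = gb' u a"
proof -
  have "\<bar>ga' u b - gb' u a\<bar> < \<epsilon>" if e: "\<epsilon> > 0" for \<epsilon>
  proof -
    have "continuous (at u) (\<lambda>x. ga' x b)" "continuous (at u) (\<lambda>x. gb' x a)"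
      using c W continuous_on_eq_continuous_at by blast+
    then have "\<exists>d>0. \<forall>x. dist x u < d \<longrightarrow> dist (ga' x b) (ga' u b) < \<epsilon>/2"
      "\<exists>d>0. \<forall>x. dist x u < d \<longrightarrow> dist (gb' x a) (gb' u a) < \<epsilon>/2"
      using half_gt_zero[OF e] unfolding continuous_at_eps_delta by blast+
    then obtain d1 d2 where d: "d1 > 0" "d2 > 0"
      "\<And>x. dist x u < d1 \<Longrightarrow> dist (ga' x b) (ga' u b) < \<epsilon>/2"
      "\<And>x. dist x u < d2 \<Longrightarrow> dist (gb' x a) (gb' u a) < \<epsilon>/2" by auto
    obtain r where r: "r > 0" "ball u r \<subseteq> W" using W open_contains_ball by blast
    define \<delta> where "\<delta> = min r (min d1 d2)"
    define h where "h = \<delta> / (2 * (norm a + norm b + 1))"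
    have dp: "\<delta> > 0" using d r by (simp add: \<delta>_def)
    have n: "norm a + norm b + 1 > 0" by (simp add: add_nonneg_pos)
    have h: "h > 0" using dp n by (simp add: h_def)
    have near: "dist (u + s *\<^sub>R a + t *\<^sub>R b) u < \<delta>" if "s \<in> {0..h}" "t \<in> {0..h}" for s t
    proof -
      have "dist (u + s *\<^sub>R a + t *\<^sub>R b) u \<le> \<bar>s\<bar> * norm a + \<bar>t\<bar> * norm b"
        using norm_triangle_ineq[of "s *\<^sub>R a" "t *\<^sub>R b"] by (simp add: dist_norm)
      also have "\<dots> \<le> h * norm a + h * norm b"
        using that by (intro add_mono mult_right_mono) auto
      also have "\<dots> \<le> h * (norm a + norm b + 1)" using h by (simp add: algebra_simps)
      also have "\<dots> = \<delta> / 2" 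
      proof -
        have "\<delta> / (2 * m) * m = \<delta> / 2" if "m > 0" for m :: real using that by simp
        from this[OF n] show ?thesis unfolding h_def .
      qed
      also have "\<dots> < \<delta>" using dp by simp
      finally show ?thesis .
    qed
    have inW: "u + s *\<^sub>R a + t *\<^sub>R b \<in> W" if "s \<in> {0..h}" "t \<in> {0..h}" for s t
      using near[OF that] r(2) by (auto simp: \<delta>_def dist_commute subset_iff)
    have inW': "u + t *\<^sub>R b + s *\<^sub>R a \<in> W" if "s \<in> {0..h}" "t \<in> {0..h}" for s t
      using inW[OF that] by (simp add: algebra_simps)
    have "\<exists>s\<in>{0..h}. \<exists>t\<in>{0..h}. g (u + h *\<^sub>R a + h *\<^sub>R b) - g (u + h *\<^sub>R a) - g (u + h *\<^sub>R b) + g u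
        = h^2 * ga' (u + s *\<^sub>R a + t *\<^sub>R b) b"
      by (rule mixed_difference_MVT[OF h g[OF inW] ga[OF inW]])
    then obtain s t where st: "s \<in> {0..h}" "t \<in> {0..h}"
      "g (u + h *\<^sub>R a + h *\<^sub>R b) - g (u + h *\<^sub>R a) - g (u + h *\<^sub>R b) + g u = h^2 * ga' (u + s *\<^sub>R a + t *\<^sub>R b) b"
      by (elim bexE)
    have "\<exists>s\<in>{0..h}. \<exists>t\<in>{0..h}. g (u + h *\<^sub>R b + h *\<^sub>R a) - g (u + h *\<^sub>R b) - g (u + h *\<^sub>R a) + g u
        = h^2 * gb' (u + s *\<^sub>R b + t *\<^sub>R a) a"
      by (rule mixed_difference_MVT[OF h g[OF inW'] gb[OF inW']])
    then obtain s' t' where st': "s' \<in> {0..h}" "t' \<in> {0..h}"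
      "g (u + h *\<^sub>R b + h *\<^sub>R a) - g (u + h *\<^sub>R b) - g (u + h *\<^sub>R a) + g u = h^2 * gb' (u + s' *\<^sub>R b + t' *\<^sub>R a) a"
      by (elim bexE)
    have "g (u + h *\<^sub>R b + h *\<^sub>R a) = g (u + h *\<^sub>R a + h *\<^sub>R b)" by (simp add: algebra_simps)
    with st(3) st'(3) have "h\<^sup>2 * ga' (u + s *\<^sub>R a + t *\<^sub>R b) b = h^2 * gb' (u + s' *\<^sub>R b + t' *\<^sub>R a) a"
      by argo
    then have eq: "ga' (u + s *\<^sub>R a + t *\<^sub>R b) b = gb' (u + t' *\<^sub>R a + s' *\<^sub>R b) a"
      using h by (simp add: algebra_simps)
    have "dist (ga' (u + s *\<^sub>R a + t *\<^sub>R b) b) (ga' u b) < \<epsilon>/2"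
      "dist (gb' (u + t' *\<^sub>R a + s' *\<^sub>R b) a) (gb' u a) < \<epsilon>/2"
      using d(3)[of "u + s *\<^sub>R a + t *\<^sub>R b"] d(4)[of "u + t' *\<^sub>R a + s' *\<^sub>R b"] near[OF st(1,2)] near[OF st'(2,1)]
      by (auto simp: \<delta>_def)
    with eq show ?thesis unfolding dist_real_def by argo
  qed
  from this[of "\<bar>ga' u b - gb' u a\<bar>"] show ?thesis by (cases "ga' u b = gb' u a") auto
qed

lemma deriv_along_swap:
  fixes F :: "real^2 \<Rightarrow> real^'n"
  assumes S: "relopen S" and F: "smooth_on S F" and u: "u \<in> S"
  shows "deriv_along S (deriv_along S F a) b u = deriv_along S (deriv_along S F b) a u"
proof (rule smooth_on_local[OF S F u])
  fix W G assume W: "open W" "u \<in> W" "\<And>k. C_k_on k W G"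
    "\<And>y. y \<in> S \<inter> W \<Longrightarrow> (F has_derivative frechet_derivative G (at y)) (at y within S)"
    "\<And>y e. y \<in> S \<inter> W \<Longrightarrow> deriv_along S F e y = frechet_derivative G (at y) e"
    "\<And>y. y \<in> S \<inter> W \<Longrightarrow> F y = G y"
  define G' where "G' = (\<lambda>x. frechet_derivative G (at x))"
  define G'' where "G'' = (\<lambda>a x. frechet_derivative (\<lambda>x. G' x a) (at x))"
  have dG: "(G has_derivative G' x) (at x)" if "x \<in> W" for x
    using W(3)[of 1] that unfolding G'_def by (auto simp flip: frechet_derivative_works)
  have dG': "((\<lambda>x. G' x a) has_derivative G'' a x) (at x)" if "x \<in> W" for x a
    using W(3)[of 2] that unfolding G''_def G'_def
    by (auto simp flip: frechet_derivative_works simp: numeral_2_eq_2)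
  have cG: "continuous_on W (\<lambda>x. G'' a x b)" for a b
    using W(3)[of 2] unfolding G''_def G'_def by (auto simp: numeral_2_eq_2)
  have "G'' a u b $ i = G'' b u a $ i" for i
  proof (rule mixed_derivatives_eq[OF W(1,2), where g = "\<lambda>x. G x $ i" and g' = "\<lambda>x e. G' x e $ i"
        and ga' = "\<lambda>x e. G'' a x e $ i" and gb' = "\<lambda>x e. G'' b x e $ i"])
  qed (auto intro!: continuous_intros cG bounded_linear.has_derivative[OF bounded_linear_vec_nth] dG dG')
  then have sym: "G'' a u b = G'' b u a" by (simp add: vec_eq_iff)
  have "deriv_along S (deriv_along S F a) b u = G'' a u b" for a b
  proof -
    have "((\<lambda>x. G' x a) has_derivative G'' a u) (at u within S)"
      using dG'[OF W(2)] has_derivative_at_withinI by blast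
    then have "deriv_along S (\<lambda>x. G' x a) b u = G'' a u b" by (rule deriv_along_eq[OF S u])
    then show ?thesis
      using deriv_along_cong(2)[OF S u W(1,2), of "deriv_along S F a" "\<lambda>x. G' x a"] W(5) by (simp add: G'_def)
  qed
  with sym show ?thesis by simp
qed

section \<open>Green's formula on the half-plane\<close>

definition pt :: "real \<Rightarrow> real \<Rightarrow> real^2" where "pt s t = s *\<^sub>R E1 + t *\<^sub>R E2"

lemma pt_nth [simp]: "pt s t $ 1 = s" "pt s t $ 2 = t"
  by (auto simp: pt_def axis_def)

lemma pt_eta [simp]: "pt (u$1) (u$2) = u"
  by (simp add: vec_eq_iff forall_2)

lemma norm_pt_ge: "\<bar>s\<bar> \<le> norm (pt s t)" "\<bar>t\<bar> \<le> norm (pt s t)"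
  using component_le_norm_cart[of "pt s t" 1] component_le_norm_cart[of "pt s t" 2] by auto

lemma pt_in_half_plane [simp]: "pt s t \<in> half_plane \<longleftrightarrow> t \<ge> 0"
  by (simp add: half_plane_def)

lemma closed_half_plane: "closed half_plane"
  unfolding half_plane_def by (rule closed_halfspace_component_ge_cart)

lemma measurable_pt: "(\<lambda>(s, t). pt s t) \<in> borel_measurable (lborel \<Otimes>\<^sub>M lborel)"
proof -
  have "continuous_on UNIV (\<lambda>x. pt (fst x) (snd x))" unfolding pt_def by (intro continuous_intros)
  then have "(\<lambda>x. pt (fst x) (snd x)) \<in> borel_measurable borel"
    by (rule borel_measurable_continuous_onI)
  moreover have "(borel_measurable (lborel \<Otimes>\<^sub>M lborel) :: (real \<times> real \<Rightarrow> real^2) set) = borel_measurable borel"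
  proof (intro measurable_cong_sets refl)
    have "sets (lborel \<Otimes>\<^sub>M lborel :: (real \<times> real) measure) = sets (borel \<Otimes>\<^sub>M borel)"
      by (intro sets_pair_measure_cong) auto
    then show "sets (lborel \<Otimes>\<^sub>M lborel) = sets (borel :: (real \<times> real) measure)"
      by (simp only: borel_prod)
  qed
  ultimately show ?thesis by (simp add: case_prod_unfold)
qed

text \<open>Lebesgue measure of the plane as a product, so that Fubini's theorem applies to the two
  coordinates.\<close>

lemma lborel_vec2: "distr (lborel \<Otimes>\<^sub>M lborel) borel (\<lambda>(s, t). pt s t) = lborel"
proof (rule lborel_eqI[symmetric])
  fix l u :: "real^2" assume le: "\<And>b. b \<in> Basis \<Longrightarrow> l \<bullet> b \<le> u \<bullet> b"
  have le': "l$1 \<le> u$1" "l$2 \<le> u$2"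
    using le[of E1] le[of E2] by (auto simp: Basis_vec_def inner_axis)
  have pre: "(\<lambda>(s, t). pt s t) -` box l u \<inter> space (lborel \<Otimes>\<^sub>M lborel) = box (l$1) (u$1) \<times> box (l$2) (u$2)"
    by (auto simp: space_pair_measure mem_box_cart forall_2)
  have B: "Basis = {E1, E2}" "E1 \<noteq> E2"
    by (auto simp: Basis_vec_def axis_eq_axis) (metis exhaust_2)
  have "emeasure (distr (lborel \<Otimes>\<^sub>M lborel) borel (\<lambda>(s, t). pt s t)) (box l u)
      = emeasure (lborel \<Otimes>\<^sub>M lborel) (box (l$1) (u$1) \<times> box (l$2) (u$2))"
    by (subst emeasure_distr[OF measurable_pt]) (auto simp: pre)
  also have "\<dots> = emeasure lborel (box (l$1) (u$1)) * emeasure lborel (box (l$2) (u$2))"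
    by (rule lborel.emeasure_pair_measure_Times) auto
  also have "\<dots> = ennreal (u$1 - l$1) * ennreal (u$2 - l$2)"
    using le' by simp
  also have "\<dots> = ennreal (\<Prod>b\<in>Basis. (u - l) \<bullet> b)"
    using le' B(2) by (simp add: B(1) inner_axis ennreal_mult)
  finally show "emeasure (distr (lborel \<Otimes>\<^sub>M lborel) borel (\<lambda>(s, t). pt s t)) (box l u)
    = ennreal (\<Prod>b\<in>Basis. (u - l) \<bullet> b)" .
qed simp

lemma
  fixes h :: "real^2 \<Rightarrow> real"
  assumes h: "integrable lborel h"
  shows integral_vec2_fst: "integral\<^sup>L lborel h = (LINT s|lborel. LINT t|lborel. h (pt s t))"
    and integral_vec2_snd: "integral\<^sup>L lborel h = (LINT t|lborel. LINT s|lborel. h (pt s t))"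
proof -
  have hm: "h \<in> borel_measurable borel" using h by auto
  have "integrable (distr (lborel \<Otimes>\<^sub>M lborel) borel (\<lambda>(s, t). pt s t)) h"
    using h by (simp add: lborel_vec2)
  then have i: "integrable (lborel \<Otimes>\<^sub>M lborel) (\<lambda>(s, t). h (pt s t))"
    by (subst (asm) integrable_distr_eq[OF measurable_pt hm]) (simp add: case_prod_unfold)
  have "integral\<^sup>L lborel h = integral\<^sup>L (distr (lborel \<Otimes>\<^sub>M lborel) borel (\<lambda>(s, t). pt s t)) h"
    by (simp add: lborel_vec2)
  also have "\<dots> = integral\<^sup>L (lborel \<Otimes>\<^sub>M lborel) (\<lambda>(s, t). h (pt s t))"
    by (subst integral_distr[OF measurable_pt hm]) (simp add: case_prod_unfold)
  finally have e: "integral\<^sup>L lborel h = integral\<^sup>L (lborel \<Otimes>\<^sub>M lborel) (\<lambda>(s, t). h (pt s t))" .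
  show "integral\<^sup>L lborel h = (LINT s|lborel. LINT t|lborel. h (pt s t))"
    using lborel_pair.integral_fst[OF i] e by simp
  show "integral\<^sup>L lborel h = (LINT t|lborel. LINT s|lborel. h (pt s t))"
    using lborel_pair.integral_snd[OF i] e by simp
qed

lemma integrable_compact_support:
  fixes h :: "'a::euclidean_space \<Rightarrow> real"
  assumes "compact K" "K \<subseteq> S" "continuous_on S h" "\<And>u. u \<in> S - K \<Longrightarrow> h u = 0"
  shows "integrable lborel (\<lambda>u. indicator S u * h u)"
proof -
  have "integrable lborel (\<lambda>u. indicator K u *\<^sub>R h u)"
    using assms continuous_on_subset by (intro borel_integrable_compact) blast+
  moreover have "indicator K u *\<^sub>R h u = indicator S u * h u" for u
    using assms(2) assms(4)[of u] by (auto simp: indicator_def)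
  ultimately show ?thesis by (simp only:)
qed

lemma
  fixes h :: "'a::euclidean_space \<Rightarrow> real"
  assumes "integrable lborel (\<lambda>u. indicator S u * h u)"
  shows absolutely_integrable_on_lborel: "h absolutely_integrable_on S"
    and integral_eq_lborel: "integral S h = (LINT u|lborel. indicator S u * h u)"
proof -
  have 1: "integrable lebesgue (\<lambda>u. indicator S u * h u)"
    using assms integrable_completion[of "\<lambda>u. indicator S u * h u" lborel] by auto
  then show a: "h absolutely_integrable_on S" by (simp add: set_integrable_def)
  have "integral S h = (LINT u|lebesgue. indicator S u * h u)"
    using set_lebesgue_integral_eq_integral(2)[OF a] by (simp add: set_lebesgue_integral_def)
  also have "\<dots> = (LINT u|lborel. indicator S u * h u)"
    using assms by (intro integral_completion) auto
  finally show "integral S h = (LINT u|lborel. indicator S u * h u)" .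
qed

lemmas absolutely_integrable_compact_support =
  absolutely_integrable_on_lborel[OF integrable_compact_support]

lemma relopen_half_plane: "relopen half_plane" by auto

lemma deriv_along_outside_support:
  assumes "relopen S" "closed K" "u \<in> S - K" "\<And>v. v \<in> S - K \<Longrightarrow> h v = 0"
  shows "deriv_along S h e u = 0"
proof -
  have "deriv_along S h e u = deriv_along S (\<lambda>_. 0) e u"
    using assms by (intro deriv_along_cong(2)[of S u "- K"]) auto
  also have "\<dots> = 0" using assms by (intro deriv_along_eq[of S u _ "\<lambda>_. 0"]) auto
  finally show ?thesis .
qed

context
  fixes h :: "real^2 \<Rightarrow> real" and K :: "(real^2) set"
  assumes h: "C1_on half_plane h" and K: "compact K" "K \<subseteq> half_plane"
    and supp: "\<And>u. u \<in> half_plane - K \<Longrightarrow> h u = 0"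
begin

lemma support_bound:
  "\<exists>L>0. \<forall>u\<in>half_plane. L \<le> norm u \<longrightarrow> h u = 0 \<and> (\<forall>e. deriv_along half_plane h e u = 0)"
proof -
  obtain L where L: "L > 0" "\<forall>u\<in>K. norm u < L"
    using compact_imp_bounded[OF K(1)] bounded_pos_less by metis
  have "h u = 0 \<and> (\<forall>e. deriv_along half_plane h e u = 0)" if u: "u \<in> half_plane" "L \<le> norm u" for u
  proof -
    have "u \<in> half_plane - K" using L(2) u by force
    then show ?thesis
      using supp deriv_along_outside_support[OF relopen_half_plane compact_imp_closed[OF K(1)], of u h] by auto
  qed
  with L(1) show ?thesis by blast
qed

lemma integrable_deriv_half_plane:
  "integrable lborel (\<lambda>u. indicator half_plane u * deriv_along half_plane h e u)"
  using deriv_along_outside_support[OF relopen_half_plane compact_imp_closed[OF K(1)]] supp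
  by (intro integrable_compact_support[OF K] C1_on_continuous_deriv h) auto

lemma h_pt_derivative:
  shows "t \<ge> 0 \<Longrightarrow> ((\<lambda>s. h (pt s t)) has_vector_derivative deriv_along half_plane h E1 (pt s t)) (at s within X)"
    and "t \<ge> 0 \<Longrightarrow> ((\<lambda>t. h (pt s t)) has_vector_derivative deriv_along half_plane h E2 (pt s t)) (at t within {0..L})"
proof -
  have lin: "linear (\<lambda>e. deriv_along half_plane h e u)" if "u \<in> half_plane" for u
    using h that linear_deriv_along unfolding C1_on_def by blast
  have d: "(h has_derivative (\<lambda>e. deriv_along half_plane h e (pt s t))) (at (pt s t) within Y)"
    if "t \<ge> 0" "Y \<subseteq> half_plane" for Y s t
    using C1_onD[OF h, of "pt s t"] that has_derivative_subset by fastforce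
  show "((\<lambda>s. h (pt s t)) has_vector_derivative deriv_along half_plane h E1 (pt s t)) (at s within X)"
    if "t \<ge> 0"
  proof -
    have "((\<lambda>s. pt s t) has_derivative (\<lambda>\<sigma>. \<sigma> *\<^sub>R E1)) (at s within X)"
      unfolding pt_def by (auto intro!: derivative_eq_intros)
    from has_derivative_in_compose[OF this d[OF that]] show ?thesis
      using that by (auto simp: has_vector_derivative_def linear_scale[OF lin] image_subset_iff)
  qed
  show "((\<lambda>t. h (pt s t)) has_vector_derivative deriv_along half_plane h E2 (pt s t)) (at t within {0..L})"
    if "t \<ge> 0"
  proof -
    have "((\<lambda>t. pt s t) has_derivative (\<lambda>\<sigma>. \<sigma> *\<^sub>R E2)) (at t within {0..L})"
      unfolding pt_def by (auto intro!: derivative_eq_intros)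
    from has_derivative_in_compose[OF this d[OF that]] show ?thesis
      using that by (auto simp: has_vector_derivative_def linear_scale[OF lin] image_subset_iff)
  qed
qed

lemma continuous_pt: "continuous_on X (\<lambda>s. pt s t)" "continuous_on X (\<lambda>t. pt s t)"
  unfolding pt_def by (intro continuous_intros)+

lemma integral_deriv_E1:
  "(LINT u|lborel. indicator half_plane u * deriv_along half_plane h E1 u) = 0"
proof -
  obtain L where L: "L > 0" "\<And>u. u \<in> half_plane \<Longrightarrow> L \<le> norm u \<Longrightarrow> h u = 0"
    "\<And>u e. u \<in> half_plane \<Longrightarrow> L \<le> norm u \<Longrightarrow> deriv_along half_plane h e u = 0"
    using support_bound by auto
  have "(LINT s|lborel. indicator half_plane (pt s t) * deriv_along half_plane h E1 (pt s t)) = 0" for t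
  proof (cases "t \<ge> 0")
    case True
    have bi: "has_bochner_integral lborel (\<lambda>s. indicator {-L..L} s *\<^sub>R deriv_along half_plane h E1 (pt s t)) (h (pt L t) - h (pt (-L) t))"
    proof (rule has_bochner_integral_FTC_Icc)
      show "continuous_on {- L..L} (\<lambda>x. deriv_along half_plane h E1 (pt x t))"
        using True by (intro continuous_on_compose2[OF C1_on_continuous_deriv[OF h] continuous_pt(1)]) auto
    qed (use L(1) True h_pt_derivative(1) in auto)
    have z: "h (pt L t) = 0" "h (pt (-L) t) = 0"
      using L(2)[of "pt L t"] L(2)[of "pt (-L) t"] norm_pt_ge(1)[of L t] norm_pt_ge(1)[of "-L" t] True L(1) by auto
    have eq: "indicator {-L..L} s *\<^sub>R deriv_along half_plane h E1 (pt s t)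
      = indicator half_plane (pt s t) * deriv_along half_plane h E1 (pt s t)" for s
      using L(3)[of "pt s t" E1] norm_pt_ge(1)[of s t] True
      by (cases "L \<le> norm (pt s t)") (auto simp: indicator_def)
    from has_bochner_integral_integral_eq[OF bi[unfolded eq]] z show ?thesis by simp
  qed (simp add: indicator_def)
  then show ?thesis by (simp add: integral_vec2_snd[OF integrable_deriv_half_plane])
qed

lemma integral_deriv_E2:
  "(LINT u|lborel. indicator half_plane u * deriv_along half_plane h E2 u) = - (LINT s|lborel. h (pt s 0))"
proof -
  obtain L where L: "L > 0" "\<And>u. u \<in> half_plane \<Longrightarrow> L \<le> norm u \<Longrightarrow> h u = 0"
    "\<And>u e. u \<in> half_plane \<Longrightarrow> L \<le> norm u \<Longrightarrow> deriv_along half_plane h e u = 0"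
    using support_bound by auto
  have "(LINT t|lborel. indicator half_plane (pt s t) * deriv_along half_plane h E2 (pt s t)) = - h (pt s 0)" for s
  proof -
    have bi: "has_bochner_integral lborel (\<lambda>t. indicator {0..L} t *\<^sub>R deriv_along half_plane h E2 (pt s t)) (h (pt s L) - h (pt s 0))"
    proof (rule has_bochner_integral_FTC_Icc)
      show "continuous_on {0..L} (\<lambda>t. deriv_along half_plane h E2 (pt s t))"
        by (intro continuous_on_compose2[OF C1_on_continuous_deriv[OF h] continuous_pt(2)]) auto
    qed (use L(1) h_pt_derivative(2) in auto)
    have z: "h (pt s L) = 0"
      using L(2)[of "pt s L"] norm_pt_ge(2)[of L s] L(1) by auto
    have eq: "indicator {0..L} t *\<^sub>R deriv_along half_plane h E2 (pt s t)
      = indicator half_plane (pt s t) * deriv_along half_plane h E2 (pt s t)" for t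
      using L(3)[of "pt s t" E2] norm_pt_ge(2)[of t s]
      by (cases "L \<le> norm (pt s t)") (auto simp: indicator_def)
    from has_bochner_integral_integral_eq[OF bi[unfolded eq]] z show ?thesis by simp
  qed
  then show ?thesis by (simp add: integral_vec2_fst[OF integrable_deriv_half_plane])
qed

lemma boundary_integral_nonneg:
  assumes nn: "\<And>s. h (pt s 0) \<ge> 0"
  shows "(LINT s|lborel. h (pt s 0)) \<ge> 0"
    and "(LINT s|lborel. h (pt s 0)) = 0 \<Longrightarrow> h (pt s 0) = 0"
proof -
  show "(LINT s|lborel. h (pt s 0)) \<ge> 0" by (rule Bochner_Integration.integral_nonneg) (use nn in auto)
next
  assume 0: "(LINT s|lborel. h (pt s 0)) = 0"
  obtain L where L: "L > 0" "\<And>u. u \<in> half_plane \<Longrightarrow> L \<le> norm u \<Longrightarrow> h u = 0"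
    using support_bound by auto
  have z: "h (pt s 0) = 0" if "s \<notin> {-L..L}" for s
    using L(2)[of "pt s 0"] norm_pt_ge(1)[of s 0] that by auto
  have c: "continuous_on {-L..L} (\<lambda>s. h (pt s 0))"
    by (intro continuous_on_compose2[OF C1_on_imp_continuous_on[OF h] continuous_pt(1)]) auto
  have i: "indicator {-L..L} s * h (pt s 0) = h (pt s 0)" for s
    using z[of s] by (auto simp: indicator_def)
  have "integrable lborel (\<lambda>s. indicator {-L..L} s * h (pt s 0))"
    by (rule integrable_compact_support[OF _ subset_refl c]) auto
  from integral_eq_lborel[OF this] have "integral {-L..L} (\<lambda>s. h (pt s 0)) = 0" using 0 by (simp only: i)
  moreover have "box (-L) L \<noteq> {}" using L(1) by (simp add: box_ne_empty)
  ultimately have "\<forall>s\<in>{-L..L}. h (pt s 0) = 0"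
    using integral_cbox_eq_0_iff[of "-L" L "\<lambda>s. h (pt s 0)"] c nn by auto
  then show "h (pt s 0) = 0" using z by blast
qed

end

text \<open>Green's formula turns the integral of the exterior derivative of a compactly supported
  form \<open>a du\<^sub>1 + b du\<^sub>2\<close> into the integral of \<open>a\<close> over the boundary line. For
  \<open>a \<ge> 0\<close> the latter is nonnegative, and it is zero only if \<open>a\<close> vanishes on the line.\<close>

proposition half_plane_Green:
  fixes a b :: "real^2 \<Rightarrow> real"
  assumes S: "relopen S" and a: "C1_on S a" and b: "C1_on S b"
    and K: "compact K" "K \<subseteq> S" and supp: "\<And>u. u \<in> S - K \<Longrightarrow> a u = 0" "\<And>u. u \<in> S - K \<Longrightarrow> b u = 0"
    and nn: "\<And>u. u \<in> S \<Longrightarrow> u$2 = 0 \<Longrightarrow> a u \<ge> 0"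
  defines "d \<equiv> \<lambda>u. deriv_along S b E1 u - deriv_along S a E2 u"
  shows "integral S d \<ge> 0"
    and "integral S d = 0 \<Longrightarrow> u \<in> S \<Longrightarrow> u$2 = 0 \<Longrightarrow> a u = 0"
proof -
  have SH: "S \<subseteq> half_plane" using S openin_imp_subset by blast
  have KH: "K \<subseteq> half_plane" using SH K by blast
  \<comment> \<open>extension by zero stays continuously differentiable because the supports are compact in \<open>S\<close>\<close>
  define ext where "ext = (\<lambda>h u. if u \<in> S then h u else 0 :: real)"
  have ext0: "ext h u = 0" if "\<And>u. u \<in> S - K \<Longrightarrow> h u = 0" "u \<in> half_plane - K" for h u
    using that by (auto simp: ext_def)
  have extC: "C1_on half_plane (ext h)" if h: "C1_on S h" "\<And>u. u \<in> S - K \<Longrightarrow> h u = 0" for h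
  proof (rule C1_on_local[OF relopen_half_plane])
    fix u assume u: "u \<in> half_plane"
    show "\<exists>T k. relopen T \<and> u \<in> T \<and> C1_on T k \<and> (\<forall>x\<in>T. ext h x = k x)"
    proof (cases "u \<in> S")
      case True then show ?thesis
        using S h(1) by (intro exI[of _ S] exI[of _ h]) (auto simp: ext_def)
    next
      case False
      have o: "relopen (half_plane - K)"
        using compact_imp_closed[OF K(1)] by (metis Diff_eq open_Compl openin_open_Int)
      show ?thesis using ext0[OF h(2)] u False K(2) C1_on_const[OF o]
        by (intro exI[of _ "half_plane - K"] exI[of _ "\<lambda>_. 0"]) (auto simp: o)
    qed
  qed
  have d: "deriv_along S h e u = deriv_along half_plane (ext h) e u" if "u \<in> S" for h e u
  proof -
    have "deriv_along S h e u = deriv_along S (ext h) e u"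
      using that S by (intro deriv_along_cong(2)[of S u UNIV]) (auto simp: ext_def)
    then show ?thesis unfolding deriv_along_def using at_within_openin[OF S that] by simp
  qed
  note A = extC[OF a supp(1)] and B = extC[OF b supp(2)]
  note A0 = ext0[OF supp(1)] and B0 = ext0[OF supp(2)]
  let ?D = "\<lambda>u. indicator half_plane u * deriv_along half_plane (ext b) E1 u -
    indicator half_plane u * deriv_along half_plane (ext a) E2 u"
  have eq: "indicator S u * d u = ?D u" for u
  proof (cases "u \<in> S")
    case True then show ?thesis using SH by (auto simp: d_def d)
  next
    case False
    then have "deriv_along half_plane (ext h) e u = 0" if "u \<in> half_plane" "\<And>u. u \<in> S - K \<Longrightarrow> h u = 0" for h e
      using that K(2) ext0[OF that(2)]
      by (intro deriv_along_outside_support[OF relopen_half_plane compact_imp_closed[OF K(1)]]) auto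
    then show ?thesis using False supp by (cases "u \<in> half_plane") auto
  qed
  have i1: "integrable lborel (\<lambda>u. indicator half_plane u * deriv_along half_plane (ext b) E1 u)"
    by (rule integrable_deriv_half_plane[OF B K(1) KH B0])
  have i2: "integrable lborel (\<lambda>u. indicator half_plane u * deriv_along half_plane (ext a) E2 u)"
    by (rule integrable_deriv_half_plane[OF A K(1) KH A0])
  have "integrable lborel (\<lambda>u. indicator S u * d u)"
    unfolding eq by (intro Bochner_Integration.integrable_diff i1 i2)
  then have "integral S d = (LINT u|lborel. ?D u)"
    by (simp add: integral_eq_lborel eq)
  also have "\<dots> = (LINT u|lborel. indicator half_plane u * deriv_along half_plane (ext b) E1 u) -
      (LINT u|lborel. indicator half_plane u * deriv_along half_plane (ext a) E2 u)"
    by (rule Bochner_Integration.integral_diff[OF i1 i2])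
  also have "\<dots> = (LINT s|lborel. ext a (pt s 0))"
    using integral_deriv_E1[OF B K(1) KH B0] integral_deriv_E2[OF A K(1) KH A0] by simp
  finally have main: "integral S d = (LINT s|lborel. ext a (pt s 0))" .
  have pos: "ext a (pt s 0) \<ge> 0" for s using nn[of "pt s 0"] by (simp add: ext_def)
  show "integral S d \<ge> 0"
    unfolding main by (rule boundary_integral_nonneg(1)[OF A K(1) KH A0 pos])
  show "a u = 0" if "integral S d = 0" "u \<in> S" "u$2 = 0"
  proof -
    have "ext a (pt (u$1) 0) = 0"
      using boundary_integral_nonneg(2)[OF A K(1) KH A0 pos] that(1) main by simp
    moreover have "pt (u$1) 0 = u" using pt_eta[of u] that(3) by simp
    ultimately show ?thesis using that(2) by (simp add: ext_def)
  qed
qed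

section \<open>Charts\<close>

definition img :: "'a chart \<Rightarrow> (real^2) set" where "img a = snd a ` fst a"
definition par :: "'a chart \<Rightarrow> real^2 \<Rightarrow> 'a" where "par a = inv_into (fst a) (snd a)"
definition overlap :: "'a chart \<Rightarrow> 'a chart \<Rightarrow> (real^2) set" where
  "overlap a b = snd a ` (fst a \<inter> fst b)"
definition transition :: "'a chart \<Rightarrow> 'a chart \<Rightarrow> real^2 \<Rightarrow> real^2" where
  "transition a b = snd b \<circ> par a"
abbreviation dtrans :: "'a chart \<Rightarrow> 'a chart \<Rightarrow> real^2 \<Rightarrow> real^2 \<Rightarrow> real^2" where
  "dtrans a b u e \<equiv> deriv_along (overlap a b) (transition a b) e u"
definition jac :: "'a chart \<Rightarrow> 'a chart \<Rightarrow> real^2 \<Rightarrow> real" where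
  "jac a b u = dtrans a b u E1 $ 1 * dtrans a b u E2 $ 2 - dtrans a b u E1 $ 2 * dtrans a b u E2 $ 1"

lemma det_matrix_2: "det (matrix D) = D E1 $ 1 * D E2 $ 2 - D E1 $ 2 * D E2 $ 1" for D :: "real^2 \<Rightarrow> real^2"
  by (simp add: det_2 matrix_def)

locale surface =
  fixes X :: "'a topology" and A :: "'a chart set"
  assumes surface: "smooth_surface X A"
begin

lemma chart:
  assumes "a \<in> A"
  shows "openin X (fst a)" "relopen (img a)"
    "homeomorphic_map (subtopology X (fst a)) (top_of_set (img a)) (snd a)"
  using surface assms unfolding smooth_surface_def is_chart_def img_def by (auto simp: case_prod_unfold)

lemma chart_subset: "a \<in> A \<Longrightarrow> fst a \<subseteq> topspace X"
  using chart(1) openin_subset by blast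

lemma ex_chart: "p \<in> topspace X \<Longrightarrow> \<exists>a\<in>A. p \<in> fst a"
  using surface unfolding smooth_surface_def by (auto simp: case_prod_unfold)

lemma inj_chart:
  assumes "a \<in> A" shows "inj_on (snd a) (fst a)"
  using homeomorphic_imp_injective_map[OF chart(3)[OF assms]] Int_absorb1[OF chart_subset[OF assms]] by simp

lemma par_chart [simp]: "a \<in> A \<Longrightarrow> p \<in> fst a \<Longrightarrow> par a (snd a p) = p"
  unfolding par_def by (simp add: inj_chart)

lemma chart_par [simp]: "u \<in> img a \<Longrightarrow> snd a (par a u) = u"
  unfolding par_def img_def by (simp add: f_inv_into_f)

lemma par_in [simp]: "u \<in> img a \<Longrightarrow> par a u \<in> fst a"
  unfolding par_def img_def by (simp add: inv_into_into)

lemma chart_in [simp]: "p \<in> fst a \<Longrightarrow> snd a p \<in> img a"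
  by (simp add: img_def)

lemma par_in_topspace: "a \<in> A \<Longrightarrow> u \<in> img a \<Longrightarrow> par a u \<in> topspace X"
  using chart_subset par_in by blast

lemma img_subset: "a \<in> A \<Longrightarrow> img a \<subseteq> half_plane"
  using chart(2) openin_imp_subset by blast

lemma overlap_iff: "a \<in> A \<Longrightarrow> u \<in> overlap a b \<longleftrightarrow> u \<in> img a \<and> par a u \<in> fst b"
  unfolding overlap_def img_def by (auto simp flip: img_def) (metis IntI chart_par image_eqI img_def imageI par_in)

lemma preimage_open:
  assumes a: "a \<in> A" and V: "openin X V"
  shows "openin (top_of_set (img a)) {u \<in> img a. par a u \<in> V}"
proof -
  have "openin (subtopology X (fst a)) (fst a \<inter> V)"
    using V openin_subtopology_Int2 by blast
  then have "openin (top_of_set (img a)) (snd a ` (fst a \<inter> V))"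
    using homeomorphic_imp_open_map[OF chart(3)[OF a]] unfolding open_map_def by blast
  moreover have "snd a ` (fst a \<inter> V) = {u \<in> img a. par a u \<in> V}"
  proof (intro equalityI subsetI)
    fix u assume "u \<in> {u \<in> img a. par a u \<in> V}"
    then show "u \<in> snd a ` (fst a \<inter> V)" by (intro image_eqI[of _ _ "par a u"]) auto
  qed (use a in auto)
  ultimately show ?thesis by simp
qed

lemma overlap_open:
  assumes "a \<in> A" "b \<in> A"
  shows "openin (top_of_set (img a)) (overlap a b)" "relopen (overlap a b)"
proof -
  have "overlap a b = {u \<in> img a. par a u \<in> fst b}" using overlap_iff[OF assms(1)] by blast
  then show "openin (top_of_set (img a)) (overlap a b)" using preimage_open[OF assms(1) chart(1)[OF assms(2)]] by simp
  then show "relopen (overlap a b)" using chart(2)[OF assms(1)] openin_trans by blast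
qed

lemma overlap_subset: "a \<in> A \<Longrightarrow> overlap a b \<subseteq> img a"
  using overlap_iff by blast

lemma par_trans: "a \<in> A \<Longrightarrow> b \<in> A \<Longrightarrow> u \<in> overlap a b \<Longrightarrow> par b (transition a b u) = par a u"
  using overlap_iff unfolding transition_def by simp

lemma transition_in: "a \<in> A \<Longrightarrow> b \<in> A \<Longrightarrow> u \<in> overlap a b \<Longrightarrow> transition a b u \<in> overlap b a"
  using overlap_iff[of a u b] overlap_iff[of b "transition a b u" a] par_trans[of a b u] unfolding transition_def by simp

lemma transition_transition: "a \<in> A \<Longrightarrow> b \<in> A \<Longrightarrow> u \<in> overlap a b \<Longrightarrow> transition b a (transition a b u) = u"
  using par_trans[of a b u] overlap_iff[of a u b] unfolding transition_def by simp

lemma transition_image: "a \<in> A \<Longrightarrow> b \<in> A \<Longrightarrow> transition a b ` overlap a b = overlap b a"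
  using transition_in[of a b] transition_in[of b a] transition_transition[of b a] by (force simp: image_iff)

lemma C1_on_trans:
  assumes "a \<in> A" "b \<in> A" shows "C1_on (overlap a b) (transition a b)"
proof -
  have "smooth_on (overlap a b) (transition a b)"
    using surface assms unfolding smooth_surface_def overlap_def transition_def par_def
    by (force simp: case_prod_unfold)
  then show ?thesis using smooth_on_imp_C1_on overlap_open(2)[OF assms] by blast
qed

lemma linear_dtrans:
  assumes "a \<in> A" "b \<in> A" "u \<in> overlap a b" shows "linear (dtrans a b u)"
  using C1_on_trans[OF assms(1,2)] assms(3) linear_deriv_along unfolding C1_on_def by blast

lemma deriv_along_par:
  assumes ab: "a \<in> A" "b \<in> A" and u: "u \<in> overlap a b" and g: "C1_on (img b) (\<lambda>u. g (par b u))"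
  shows "deriv_along (img a) (\<lambda>u. g (par a u)) e u
    = deriv_along (img b) (\<lambda>u. g (par b u)) (dtrans a b u e) (transition a b u)"
proof -
  have "deriv_along (img a) (\<lambda>u. g (par a u)) e u = deriv_along (overlap a b) (\<lambda>u. g (par a u)) e u"
    using at_within_openin[OF overlap_open(1)[OF ab] u] by (simp add: deriv_along_def)
  also have "\<dots> = deriv_along (overlap a b) (\<lambda>u. g (par b (transition a b u))) e u"
    using par_trans[OF ab] by (intro deriv_along_cong(2)[OF overlap_open(2)[OF ab] u, of UNIV]) auto
  also have "\<dots> = deriv_along (img b) (\<lambda>u. g (par b u)) (dtrans a b u e) (transition a b u)"
    using transition_image[OF ab] overlap_subset[OF ab(2)]
    by (intro deriv_along_compose[OF overlap_open(2)[OF ab] chart(2)[OF ab(2)] C1_on_trans[OF ab] _ g u]) auto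
  finally show ?thesis .
qed

lemma dtrans_dtrans:
  assumes "a \<in> A" "b \<in> A" "u \<in> overlap a b"
  shows "dtrans b a (transition a b u) (dtrans a b u e) = e"
proof -
  note o = overlap_open(2)[OF assms(1,2)] overlap_open(2)[OF assms(2,1)]
  have "deriv_along (overlap a b) (\<lambda>u. transition b a (transition a b u)) e u = dtrans b a (transition a b u) (dtrans a b u e)"
    using transition_image[OF assms(1,2)]
    by (intro deriv_along_compose[OF o C1_on_trans[OF assms(1,2)] _ C1_on_trans[OF assms(2,1)] assms(3)]) auto
  moreover have "deriv_along (overlap a b) (\<lambda>u. transition b a (transition a b u)) e u = deriv_along (overlap a b) (\<lambda>u. u) e u"
    using transition_transition[OF assms(1,2)] by (intro deriv_along_cong(2)[OF o(1) assms(3), of UNIV]) auto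
  moreover have "deriv_along (overlap a b) (\<lambda>u. u) e u = e"
    by (rule deriv_along_eq[OF o(1) assms(3)]) auto
  ultimately show ?thesis by simp
qed

lemma jac_nonzero:
  assumes "a \<in> A" "b \<in> A" "u \<in> overlap a b" shows "jac a b u \<noteq> 0"
proof
  assume 0: "jac a b u = 0"
  let ?P = "dtrans a b u E1" and ?Q = "dtrans a b u E2"
  have lin: "linear (dtrans b a (transition a b u))"
    using linear_dtrans[OF assms(2,1) transition_in[OF assms]] .
  have z: "dtrans b a (transition a b u) (x *\<^sub>R ?P + y *\<^sub>R ?Q) = x *\<^sub>R E1 + y *\<^sub>R E2" for x y
    by (simp add: linear_add[OF lin] linear_scale[OF lin] dtrans_dtrans[OF assms])
  have ind: "x = 0 \<and> y = 0" if "x *\<^sub>R ?P + y *\<^sub>R ?Q = 0" for x y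
  proof -
    have "x *\<^sub>R E1 + y *\<^sub>R E2 = 0" using z[of x y] that by (simp add: linear_0[OF lin])
    then show ?thesis by (auto simp: vec_eq_iff axis_def forall_2)
  qed
  have "(?Q$1) *\<^sub>R ?P + (- ?P$1) *\<^sub>R ?Q = 0" "(?Q$2) *\<^sub>R ?P + (- ?P$2) *\<^sub>R ?Q = 0"
    using 0 by (simp_all add: vec_eq_iff forall_2 jac_def algebra_simps)
  from ind[OF this(1)] ind[OF this(2)] have "?P = 0" by (simp add: vec_eq_iff forall_2)
  then show False using ind[of 1 0] by simp
qed

text \<open>A transition map takes values in the half-plane, so its second coordinate has a minimum at a
  boundary point that it maps to the boundary. Its derivative there vanishes along the boundary and
  is nonnegative inwards, hence positive inwards as the Jacobian is not zero.\<close>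

lemma dtrans_boundary:
  assumes ab: "a \<in> A" "b \<in> A" and u: "u \<in> overlap a b" and bd: "u$2 = 0" "transition a b u $ 2 = 0"
  shows "dtrans a b u E1 $ 2 = 0" "sgn (jac a b u) = sgn (dtrans a b u E1 $ 1)"
proof -
  define k where "k = (\<lambda>v. transition a b v $ 2)"
  have o: "relopen (overlap a b)" using overlap_open(2)[OF ab] .
  have "(k has_derivative (\<lambda>e. dtrans a b u e $ 2)) (at u within overlap a b)"
    unfolding k_def by (intro bounded_linear.has_derivative[OF bounded_linear_vec_nth] C1_onD C1_on_trans ab u)
  then have dk: "(k has_derivative (\<lambda>e. dtrans a b u e $ 2)) (at u within half_plane)"
    using at_within_openin[OF o u] by simp
  obtain W where W: "open W" "overlap a b = half_plane \<inter> W" using o by (auto simp: openin_open)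
  obtain r where r: "r > 0" "ball u r \<subseteq> W" using W u open_contains_ball by blast
  have knn: "k v \<ge> 0" if "v \<in> half_plane" "dist u v < r" for v
  proof -
    have "v \<in> overlap a b" using that r W by auto
    then have "transition a b v \<in> half_plane" using transition_in[OF ab] overlap_subset[OF ab(2)] img_subset[OF ab(2)] by blast
    then show ?thesis by (simp add: k_def half_plane_def)
  qed
  have k0: "k u = 0" using bd by (simp add: k_def)
  have lin: "linear (dtrans a b u)" by (rule linear_dtrans[OF ab u])
  \<comment> \<open>a function that is nonnegative on the half-plane and vanishes at a boundary point
      does not decrease, to first order, in a direction that points into the half-plane\<close>
  have dir: "dtrans a b u e $ 2 \<ge> 0" if e: "e$2 \<ge> 0" for e
  proof (rule ccontr)
    assume "\<not> dtrans a b u e $ 2 \<ge> 0"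
    then have neg: "dtrans a b u e $ 2 < 0" by simp
    have "((\<lambda>t. u + t *\<^sub>R e) has_derivative (\<lambda>t. t *\<^sub>R e)) (at 0 within {0..})"
      by (auto intro!: derivative_eq_intros)
    moreover have "(k has_derivative (\<lambda>e. dtrans a b u e $ 2)) (at (u + 0 *\<^sub>R e) within (\<lambda>t. u + t *\<^sub>R e) ` {0..})"
    proof -
      have "(\<lambda>t. u + t *\<^sub>R e) ` {0..} \<subseteq> half_plane"
        using e bd by (auto simp: half_plane_def)
      then show ?thesis using has_derivative_subset[OF dk] by simp
    qed
    ultimately have "((\<lambda>t. k (u + t *\<^sub>R e)) has_derivative (\<lambda>t. dtrans a b u (t *\<^sub>R e) $ 2)) (at 0 within {0..})"
      by (rule has_derivative_in_compose)
    then have "((\<lambda>t. k (u + t *\<^sub>R e)) has_real_derivative (dtrans a b u e $ 2)) (at 0 within {0..})"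
      by (simp add: linear_scale[OF lin] has_field_derivative_def mult.commute[of _ "dtrans a b u e $ 2"])
    from has_real_derivative_neg_dec_right[OF this neg] obtain d where
      d: "d > 0" "\<And>h. h > 0 \<Longrightarrow> h \<in> {0..} \<Longrightarrow> h < d \<Longrightarrow> k (u + h *\<^sub>R e) < k u" by auto
    define h where "h = min (d/2) (r / (2 * (norm e + 1)))"
    have n: "norm e + 1 > 0" by (simp add: add_nonneg_pos)
    have h: "h > 0" "h < d" using d(1) r(1) n by (auto simp: h_def)
    have "h * norm e \<le> h * (norm e + 1)" using h by simp
    also have "\<dots> \<le> r / (2 * (norm e + 1)) * (norm e + 1)" by (rule mult_right_mono) (auto simp: h_def)
    also have "\<dots> = r / 2" using n by (simp add: divide_simps)
    also have "\<dots> < r" using r by simp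
    finally have "dist u (u + h *\<^sub>R e) < r" using h by (simp add: dist_norm)
    moreover have "u + h *\<^sub>R e \<in> half_plane" using h e bd by (simp add: half_plane_def)
    ultimately have "k (u + h *\<^sub>R e) \<ge> 0" using knn by blast
    then show False using d(2)[of h] h k0 by simp
  qed
  have "dtrans a b u E1 $ 2 \<ge> 0" "dtrans a b u (- E1) $ 2 \<ge> 0" using dir by (auto simp: axis_def)
  moreover have "dtrans a b u (- E1) = - dtrans a b u E1" using lin linear_neg by blast
  ultimately show P2: "dtrans a b u E1 $ 2 = 0" by simp
  have j: "jac a b u = dtrans a b u E1 $ 1 * dtrans a b u E2 $ 2" using P2 by (simp add: jac_def)
  moreover have "dtrans a b u E2 $ 2 \<ge> 0" using dir by (simp add: axis_def)
  ultimately have "dtrans a b u E2 $ 2 > 0" using jac_nonzero[OF ab u] by (cases "dtrans a b u E2 $ 2 = 0") auto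
  with j show "sgn (jac a b u) = sgn (dtrans a b u E1 $ 1)" by (simp add: sgn_mult)
qed

section \<open>Partitions of unity\<close>

definition C1_fun :: "('a \<Rightarrow> real) \<Rightarrow> bool" where
  "C1_fun g \<longleftrightarrow> (\<forall>a\<in>A. C1_on (img a) (\<lambda>u. g (par a u)))"

lemma continuous_par:
  assumes a: "a \<in> A" shows "continuous_map (top_of_set (img a)) X (par a)"
  using preimage_open[OF a] par_in_topspace[OF a] unfolding continuous_map_def by auto

lemma closedin_par_image:
  assumes a: "a \<in> A" and K: "compact K" "K \<subseteq> img a"
  shows "closedin X (par a ` K)"
proof -
  have "compactin (top_of_set (img a)) K" using K by (simp add: compactin_subtopology)
  then have "compactin X (par a ` K)" using image_compactin continuous_par[OF a] by blast
  moreover have "Hausdorff_space X" using surface by (simp add: smooth_surface_def)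
  ultimately show ?thesis by (rule compactin_imp_closedin[rotated])
qed

end

lemma has_real_derivative_max_square:
  "((\<lambda>x. (max 0 x)\<^sup>2) has_real_derivative 2 * max 0 x) (at (x::real))"
proof (cases x "0::real" rule: linorder_cases)
  case less
  have "((\<lambda>_. 0) has_real_derivative 0) (at x)" by simp
  then have "((\<lambda>x. (max 0 x)\<^sup>2) has_real_derivative 0) (at x)"
    by (rule has_field_derivative_transform_within_open[of _ _ _ "{..<0}"]) (use less in auto)
  then show ?thesis using less by simp
next
  case equal
  have "((\<lambda>h. max 0 h) \<longlongrightarrow> max 0 (0::real)) (at 0)" by (intro tendsto_intros)
  then have lim: "((\<lambda>h. max 0 h) \<longlongrightarrow> (0::real)) (at 0)" by simp
  have eq: "max 0 h = ((max 0 h)\<^sup>2 - (max 0 0)\<^sup>2) / (h - 0)" if "h \<noteq> 0" for h :: real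
    using that by (auto simp: max_def power2_eq_square)
  have "\<forall>\<^sub>F h in at (0::real). max 0 h = ((max 0 h)\<^sup>2 - (max 0 0)\<^sup>2) / (h - 0)"
    unfolding eventually_at_filter by (rule always_eventually) (use eq in blast)
  with lim have "((\<lambda>h. ((max 0 h)\<^sup>2 - (max 0 0)\<^sup>2) / (h - 0)) \<longlongrightarrow> (0::real)) (at 0)"
    by (rule Lim_transform_eventually)
  then show ?thesis using equal by (simp add: has_field_derivative_iff)
next
  case greater
  have "((\<lambda>x. x\<^sup>2) has_real_derivative 2 * x) (at x)" by (auto intro!: derivative_eq_intros)
  then have "((\<lambda>x. (max 0 x)\<^sup>2) has_real_derivative 2 * x) (at x)"
    by (rule has_field_derivative_transform_within_open[of _ _ _ "{0<..}"]) (use greater in auto)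
  then show ?thesis using greater by simp
qed

text \<open>The square makes the derivative continuous across the boundary of the disc.\<close>

definition bump :: "real^2 \<Rightarrow> real \<Rightarrow> real^2 \<Rightarrow> real" where
  "bump u0 r u = (max 0 (r\<^sup>2 - (u - u0) \<bullet> (u - u0)))\<^sup>2"

lemma bump_pos_iff: "r > 0 \<Longrightarrow> bump u0 r u > 0 \<longleftrightarrow> dist u0 u < r"
proof -
  assume r: "r > 0"
  have "bump u0 r u > 0 \<longleftrightarrow> (u - u0) \<bullet> (u - u0) < r\<^sup>2" by (auto simp: bump_def max_def)
  also have "\<dots> \<longleftrightarrow> (norm (u - u0))\<^sup>2 < r\<^sup>2" by (simp add: power2_norm_eq_inner)
  also have "\<dots> \<longleftrightarrow> dist u0 u < r" 
    using power2_less_imp_less[of "norm (u - u0)" r] power_strict_mono[of "norm (u - u0)" r 2] r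
    by (auto simp: dist_norm norm_minus_commute)
  finally show ?thesis .
qed

lemma bump_nonneg: "bump u0 r u \<ge> 0" by (simp add: bump_def)

lemma C1_on_bump: "relopen S \<Longrightarrow> C1_on S (bump u0 r)"
proof (rule C1_onI)
  fix u assume "u \<in> S"
  have "((\<lambda>u. r\<^sup>2 - (u - u0) \<bullet> (u - u0)) has_derivative (\<lambda>e. - 2 * ((u - u0) \<bullet> e))) (at u within S)"
    by (auto intro!: derivative_eq_intros simp: inner_commute)
  then show "(bump u0 r has_derivative (\<lambda>e. 2 * max 0 (r\<^sup>2 - (u - u0) \<bullet> (u - u0)) * (- 2 * ((u - u0) \<bullet> e)))) (at u within S)"
    unfolding bump_def
    by (rule has_derivative_compose[OF _ has_real_derivative_max_square[unfolded has_field_derivative_def]])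
next
  show "continuous_on S (\<lambda>u. 2 * max 0 (r\<^sup>2 - (u - u0) \<bullet> (u - u0)) * (- 2 * ((u - u0) \<bullet> e)))" for e
    by (intro continuous_intros)
qed

context surface
begin

text \<open>The bump of a small disc in the chart, extended by zero. Its support is the image of a compact
  set, which is closed in the Hausdorff surface, so in every other chart the extension is zero on an
  open set around each point where the formula does not apply.\<close>

lemma ex_bump:
  assumes a: "a \<in> A" and p: "p \<in> fst a"
  shows "\<exists>\<beta> K. C1_fun \<beta> \<and> (\<forall>q. \<beta> q \<ge> 0) \<and> \<beta> p > 0 \<and> compact K \<and> K \<subseteq> img a \<and>
    (\<forall>q. q \<notin> par a ` K \<longrightarrow> \<beta> q = 0) \<and> openin X {q. \<beta> q > 0}"
proof -
  obtain W where W: "open W" "img a = half_plane \<inter> W" using chart(2)[OF a] by (auto simp: openin_open)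
  define u0 where "u0 = snd a p"
  have u0: "u0 \<in> img a" using p by (simp add: u0_def)
  obtain r where r: "r > 0" "cball u0 r \<subseteq> W" using W u0 open_contains_cball by blast
  define K where "K = cball u0 r \<inter> half_plane"
  have K: "compact K" "K \<subseteq> img a"
    using r W closed_half_plane by (auto simp: K_def intro: compact_Int_closed)
  define \<beta> where "\<beta> = (\<lambda>q. if q \<in> fst a then bump u0 r (snd a q) else 0)"
  have zero: "\<beta> q = 0" if "q \<notin> par a ` K" for q
  proof (rule ccontr)
    assume "\<beta> q \<noteq> 0"
    then have q: "q \<in> fst a" "bump u0 r (snd a q) > 0"
      using bump_nonneg[of u0 r "snd a q"] by (auto simp: \<beta>_def split: if_splits)
    then have "snd a q \<in> K" using bump_pos_iff[OF r(1)] chart_in[OF q(1)] W by (auto simp: K_def)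
    then show False using that par_chart[OF a q(1)] by (metis imageI)
  qed
  have "C1_fun \<beta>" unfolding C1_fun_def
  proof
    fix b assume b: "b \<in> A"
    show "C1_on (img b) (\<lambda>u. \<beta> (par b u))"
    proof (rule C1_on_local[OF chart(2)[OF b]])
      fix u assume u: "u \<in> img b"
      show "\<exists>T h. openin (top_of_set (img b)) T \<and> u \<in> T \<and> C1_on T h \<and> (\<forall>x\<in>T. \<beta> (par b x) = h x)"
      proof (cases "par b u \<in> fst a")
        case True
        have "transition b a ` overlap b a \<subseteq> half_plane"
          using transition_image[OF b a] overlap_subset[OF a] img_subset[OF a] by blast
        then have "C1_on (overlap b a) (\<lambda>u. bump u0 r (transition b a u))"
          by (intro C1_on_compose[OF overlap_open(2)[OF b a] relopen_half_plane C1_on_trans[OF b a] _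
                C1_on_bump[OF relopen_half_plane]])
        moreover have "\<beta> (par b x) = bump u0 r (transition b a x)" if "x \<in> overlap b a" for x
          using that overlap_iff[OF b] by (simp add: \<beta>_def transition_def)
        ultimately show ?thesis
          using overlap_open(1)[OF b a] overlap_iff[OF b] u True by blast
      next
        case False
        define T where "T = {u \<in> img b. par b u \<in> topspace X - par a ` K}"
        have T: "openin (top_of_set (img b)) T" unfolding T_def
          by (intro preimage_open[OF b] openin_diff openin_topspace closedin_par_image[OF a K])
        have "par a ` K \<subseteq> fst a" using K(2) par_in by blast
        then have "u \<in> T" using u False par_in_topspace[OF b u] by (auto simp: T_def)
        moreover have "C1_on T (\<lambda>_. 0 :: real)"
          using T chart(2)[OF b] openin_trans by (intro C1_on_const) blast
        moreover have "\<forall>x\<in>T. \<beta> (par b x) = 0" using zero by (auto simp: T_def)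
        ultimately show ?thesis using T by blast
      qed
    qed
  qed
  moreover have "openin X {q. \<beta> q > 0}"
  proof -
    have "continuous_map (subtopology X (fst a)) (top_of_set (img a)) (snd a)"
      using chart(3)[OF a] homeomorphic_imp_continuous_map by blast
    moreover have "openin (top_of_set (img a)) (img a \<inter> ball u0 r)" by (simp add: openin_open_Int)
    ultimately have "openin (subtopology X (fst a)) {q \<in> topspace (subtopology X (fst a)). snd a q \<in> img a \<inter> ball u0 r}"
      unfolding continuous_map_def by blast
    moreover have "{q \<in> topspace (subtopology X (fst a)). snd a q \<in> img a \<inter> ball u0 r} = {q. \<beta> q > 0}"
      using chart_subset[OF a] bump_pos_iff[OF r(1)] by (auto simp: \<beta>_def split: if_splits)
    ultimately show ?thesis using chart(1)[OF a] openin_open_subtopology by metis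
  qed
  moreover have "\<beta> p > 0" using p r bump_pos_iff[OF r(1)] by (simp add: \<beta>_def u0_def)
  moreover have "\<forall>q. \<beta> q \<ge> 0" using bump_nonneg by (simp add: \<beta>_def)
  ultimately show ?thesis using K zero by blast
qed

end

section \<open>Closed forms that are nonnegative along the boundary\<close>

lemma integral_eq_on_support:
  fixes h :: "'b::euclidean_space \<Rightarrow> real"
  assumes "T \<subseteq> S" "\<And>u. u \<in> S - T \<Longrightarrow> h u = 0"
  shows "integral S h = integral T h"
proof -
  have "(\<lambda>u. if u \<in> S then h u else 0) = (\<lambda>u. if u \<in> T then h u else 0)"
    using assms by fastforce
  then show ?thesis by (metis integral_restrict_UNIV)
qed

lemma integral_change_of_variables_real:
  fixes h :: "real^2 \<Rightarrow> real" and g :: "real^2 \<Rightarrow> real^2"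
  assumes S: "S \<in> sets lebesgue" and g: "\<And>x. x \<in> S \<Longrightarrow> (g has_derivative g' x) (at x within S)"
    and inj: "inj_on g S" and h: "h absolutely_integrable_on g ` S"
  shows "integral (g ` S) h = integral S (\<lambda>x. \<bar>det (matrix (g' x))\<bar> *\<^sub>R h (g x))"
proof -
  have "(\<lambda>x. vec (h x) :: real^1) absolutely_integrable_on g ` S"
    using h by (simp add: absolutely_integrable_on_1_iff)
  then have "integral (g ` S) (\<lambda>x. vec (h x) :: real^1)
      = integral S (\<lambda>x. \<bar>det (matrix (g' x))\<bar> *\<^sub>R (vec (h (g x)) :: real^1))"
    by (intro integral_change_of_variables[OF S g inj] disjI1)
  then show ?thesis by (simp add: integral_on_1_eq vec_eq_iff)
qed

text \<open>A closed 1-form given by its expressions in the charts, which changes sign when the orientation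
  of the chart does. On an oriented surface this is a closed form multiplied by the sign of the chart.\<close>

locale twisted_form = surface X A for X :: "'a topology" and A +
  fixes \<omega> :: "'a chart \<Rightarrow> real^2 \<Rightarrow> real^2 \<Rightarrow> real"
  assumes compact: "compact_space X"
    and form_linear: "\<And>a u. a \<in> A \<Longrightarrow> u \<in> img a \<Longrightarrow> linear (\<omega> a u)"
    and form_C1: "\<And>a e. a \<in> A \<Longrightarrow> C1_on (img a) (\<lambda>u. \<omega> a u e)"
    and closed: "\<And>a u. a \<in> A \<Longrightarrow> u \<in> img a \<Longrightarrow>
      deriv_along (img a) (\<lambda>u. \<omega> a u E2) E1 u = deriv_along (img a) (\<lambda>u. \<omega> a u E1) E2 u"
    and twisted: "\<And>a b u e. a \<in> A \<Longrightarrow> b \<in> A \<Longrightarrow> u \<in> overlap a b \<Longrightarrow>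
      \<omega> a u e = sgn (jac a b u) * \<omega> b (transition a b u) (dtrans a b u e)"
begin

text \<open>The density of \<open>dg \<and> \<omega>\<close> in a chart.\<close>

definition wedge :: "('a \<Rightarrow> real) \<Rightarrow> 'a chart \<Rightarrow> real^2 \<Rightarrow> real" where
  "wedge g a u = deriv_along (img a) (\<lambda>u. g (par a u)) E1 u * \<omega> a u E2
     - deriv_along (img a) (\<lambda>u. g (par a u)) E2 u * \<omega> a u E1"

lemma par_notin:
  assumes "K \<subseteq> img a" "u \<in> img a - K" shows "par a u \<notin> par a ` K"
proof
  assume "par a u \<in> par a ` K"
  then obtain v where v: "v \<in> K" "par a u = par a v" by blast
  then have "u = v" using chart_par[of u a] chart_par[of v a] assms by auto
  then show False using v assms by simp
qed

lemma continuous_on_wedge: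
  assumes "C1_fun g" "a \<in> A" shows "continuous_on (img a) (wedge g a)"
proof -
  have "C1_on (img a) (\<lambda>u. g (par a u))" using assms by (simp add: C1_fun_def)
  note 1 = C1_on_continuous_deriv[OF this]
  note 2 = C1_on_imp_continuous_on[OF form_C1[OF assms(2)]]
  show ?thesis unfolding wedge_def
    by (intro continuous_on_diff continuous_on_mult 1 2)
qed

text \<open>Two orientation signs cancel, so the density transforms with the absolute value of the
  Jacobian: it can be integrated over the surface without an orientation.\<close>

lemma wedge_trans:
  assumes g: "C1_fun g" and ab: "a \<in> A" "b \<in> A" and u: "u \<in> overlap a b"
  shows "wedge g a u = \<bar>jac a b u\<bar> * wedge g b (transition a b u)"
proof -
  define P where "P = dtrans a b u E1"
  define Q where "Q = dtrans a b u E2"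
  define v where "v = transition a b u"
  have v: "v \<in> overlap b a" "v \<in> img b"
    using transition_in[OF ab u] overlap_subset[OF ab(2)] unfolding v_def by blast+
  have gb: "C1_on (img b) (\<lambda>u. g (par b u))" using g ab by (simp add: C1_fun_def)
  have dg: "deriv_along (img a) (\<lambda>u. g (par a u)) e u = deriv_along (img b) (\<lambda>u. g (par b u)) (dtrans a b u e) v" for e
    unfolding v_def by (rule deriv_along_par[OF ab u gb])
  have lg: "linear (\<lambda>e. deriv_along (img b) (\<lambda>u. g (par b u)) e v)"
    using gb v linear_deriv_along unfolding C1_on_def by blast
  have dgPQ: "deriv_along (img b) (\<lambda>u. g (par b u)) e v =
     e$1 * deriv_along (img b) (\<lambda>u. g (par b u)) E1 v + e$2 * deriv_along (img b) (\<lambda>u. g (par b u)) E2 v" for e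
    using linear_vec2[OF lg, of e] by simp
  have wPQ: "\<omega> b v e = e$1 * \<omega> b v E1 + e$2 * \<omega> b v E2" for e
    using linear_vec2[OF form_linear[OF ab(2) v(2)], of e] by simp
  have j: "jac a b u = P$1 * Q$2 - P$2 * Q$1" by (simp add: jac_def P_def Q_def)
  have "wedge g a u = deriv_along (img b) (\<lambda>u. g (par b u)) P v * (sgn (jac a b u) * \<omega> b v Q)
      - deriv_along (img b) (\<lambda>u. g (par b u)) Q v * (sgn (jac a b u) * \<omega> b v P)"
    unfolding wedge_def dg twisted[OF ab u] P_def Q_def v_def ..
  also have "\<dots> = sgn (jac a b u) * (P$1 * Q$2 - P$2 * Q$1) * wedge g b v"
    unfolding dgPQ[of P] dgPQ[of Q] wPQ[of P] wPQ[of Q] wedge_def by algebra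
  also have "sgn (jac a b u) * (P$1 * Q$2 - P$2 * Q$1) = \<bar>jac a b u\<bar>"
    unfolding j by (simp add: abs_sgn mult.commute)
  finally show ?thesis unfolding v_def .
qed

lemma wedge_zero:
  assumes a: "a \<in> A" "b \<in> A" and K: "compact K" "K \<subseteq> img b" "\<And>q. q \<notin> par b ` K \<Longrightarrow> g q = 0"
    and u: "u \<in> img a" "par a u \<notin> fst b"
  shows "wedge g a u = 0"
proof -
  define T where "T = {u \<in> img a. par a u \<in> topspace X - par b ` K}"
  have T: "openin (top_of_set (img a)) T" unfolding T_def
    by (intro preimage_open[OF a(1)] openin_diff openin_topspace closedin_par_image[OF a(2) K(1,2)])
  have "par b ` K \<subseteq> fst b" using K(2) par_in by blast
  then have uT: "u \<in> T" using u par_in_topspace[OF a(1)] by (auto simp: T_def)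
  obtain W where W: "open W" "T = img a \<inter> W" using T by (auto simp: openin_open)
  have "deriv_along (img a) (\<lambda>u. g (par a u)) e u = deriv_along (img a) (\<lambda>_. 0) e u" for e
  proof (rule deriv_along_cong(2)[OF chart(2)[OF a(1)] u(1) W(1)])
    show "u \<in> W" using uT W(2) by blast
    fix x assume "x \<in> img a \<inter> W"
    then have "x \<in> T" using W(2) by blast
    then show "g (par a x) = 0" using K(3) by (auto simp: T_def)
  qed
  moreover have "deriv_along (img a) (\<lambda>_. 0 :: real) e u = 0" for e
    by (rule deriv_along_eq[OF chart(2)[OF a(1)] u(1)]) auto
  ultimately show ?thesis by (simp add: wedge_def)
qed

text \<open>The factor \<open>g\<close> is supported in the first chart and \<open>h\<close> in the second, so both integrals
  extend over the overlap only, where the transition map is a change of variables.\<close>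

lemma integral_wedge_swap:
  assumes ab: "a \<in> A" "b \<in> A"
    and g: "C1_fun g" and Kg: "compact Kg" "Kg \<subseteq> img a" "\<And>q. q \<notin> par a ` Kg \<Longrightarrow> g q = 0"
    and h: "C1_fun h" and Kh: "compact Kh" "Kh \<subseteq> img b" "\<And>q. q \<notin> par b ` Kh \<Longrightarrow> h q = 0"
  shows "integral (img a) (\<lambda>u. h (par a u) * wedge g a u) = integral (img b) (\<lambda>u. h (par b u) * wedge g b u)"
proof -
  let ?f = "\<lambda>c u. h (par c u) * wedge g c u"
  have inb: "par b ` Kh \<subseteq> fst b" using Kh(2) par_in by blast
  have c: "continuous_on (img a) (?f a)"
    using h ab(1) C1_on_imp_continuous_on unfolding C1_fun_def
    by (intro continuous_on_mult continuous_on_wedge[OF g ab(1)]) blast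
  have z: "?f a u = 0" if u: "u \<in> img a - Kg" for u
  proof -
    have "wedge g a u = 0"
    proof -
      have "(\<lambda>u. g (par a u)) v = 0" if v: "v \<in> img a - Kg" for v
        using Kg(3) par_notin[OF Kg(2) v] by simp
      then have "deriv_along (img a) (\<lambda>u. g (par a u)) e u = 0" for e
        using u by (intro deriv_along_outside_support[OF chart(2)[OF ab(1)] compact_imp_closed[OF Kg(1)]])
      then show ?thesis by (simp add: wedge_def)
    qed
    then show ?thesis by simp
  qed
  have "?f a absolutely_integrable_on img a"
    using absolutely_integrable_compact_support[OF Kg(1,2) c z] .
  moreover have lm: "overlap a b \<in> sets lebesgue" if ab': "a \<in> A" "b \<in> A" for a b
  proof -
    obtain W where "open W" "overlap a b = half_plane \<inter> W" using overlap_open(2)[OF ab'] by (auto simp: openin_open)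
    then have "overlap a b \<in> sets borel" using closed_half_plane by auto
    then show ?thesis by simp
  qed
  ultimately have ai: "?f a absolutely_integrable_on overlap a b"
    using set_integrable_subset lm[OF ab] overlap_subset[OF ab(1)] by blast
  have "integral (img a) (?f a) = integral (overlap a b) (?f a)"
  proof (rule integral_eq_on_support[OF overlap_subset[OF ab(1)]])
    fix u assume "u \<in> img a - overlap a b"
    then have "par a u \<notin> par b ` Kh" using overlap_iff[OF ab(1)] inb by auto
    then show "?f a u = 0" using Kh(3) by simp
  qed
  also have "\<dots> = integral (transition b a ` overlap b a) (?f a)"
    using transition_image[OF ab(2,1)] by simp
  also have "\<dots> = integral (overlap b a) (\<lambda>u. \<bar>det (matrix (dtrans b a u))\<bar> *\<^sub>R ?f a (transition b a u))"
  proof -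
    have "inj_on (transition b a) (overlap b a)"
      using transition_transition[OF ab(2,1)] by (metis inj_on_inverseI)
    moreover have "?f a absolutely_integrable_on transition b a ` overlap b a"
      using transition_image[OF ab(2,1)] ai by simp
    ultimately show ?thesis
      by (intro integral_change_of_variables_real lm ab C1_onD C1_on_trans)
  qed
  also have "\<dots> = integral (overlap b a) (?f b)"
  proof (rule integral_cong)
    fix u assume u: "u \<in> overlap b a"
    have "det (matrix (dtrans b a u)) = jac b a u" by (simp add: det_matrix_2 jac_def)
    then show "\<bar>det (matrix (dtrans b a u))\<bar> *\<^sub>R ?f a (transition b a u) = ?f b u"
      using wedge_trans[OF g ab(2,1) u] par_trans[OF ab(2,1) u] by simp
  qed
  also have "\<dots> = integral (img b) (?f b)"
  proof (rule integral_eq_on_support[OF overlap_subset[OF ab(2)], symmetric])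
    fix u assume "u \<in> img b - overlap b a"
    then have "u \<in> img b" "par b u \<notin> fst a" using overlap_iff[OF ab(2)] by auto
    from wedge_zero[OF ab(2,1) Kg this] show "?f b u = 0" by simp
  qed
  finally show ?thesis .
qed

text \<open>The point \<open>p0\<close> keeps its prescribed chart \<open>a0\<close>, and \<open>\<rho> p0\<close> is positive there. So a
  conclusion about \<open>\<rho> p0\<close> on the boundary line of \<open>a0\<close> says something about \<open>p0\<close>, whatever
  coordinates the other charts give to that point.\<close>

lemma ex_partition_of_unity:
  assumes a0: "a0 \<in> A" "p0 \<in> fst a0"
  shows "\<exists>(Q::'a set) c \<rho> K. finite Q \<and> p0 \<in> Q \<and> c p0 = a0 \<and> \<rho> p0 p0 > 0 \<and>
    (\<forall>p\<in>Q. c p \<in> A \<and> C1_fun (\<rho> p) \<and> (\<forall>q\<in>topspace X. \<rho> p q \<ge> 0) \<and> compact (K p) \<and> K p \<subseteq> img (c p) \<and>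
      (\<forall>q. q \<notin> par (c p) ` K p \<longrightarrow> \<rho> p q = 0)) \<and>
    (\<forall>q\<in>topspace X. (\<Sum>p\<in>Q. \<rho> p q) = 1)"
proof -
  let ?good = "\<lambda>p c \<beta> K. c \<in> A \<and> p \<in> fst c \<and> (p = p0 \<longrightarrow> c = a0) \<and> C1_fun \<beta> \<and> (\<forall>q. \<beta> q \<ge> 0) \<and> \<beta> p > 0 \<and>
    compact K \<and> K \<subseteq> img c \<and> (\<forall>q. q \<notin> par c ` K \<longrightarrow> \<beta> q = 0) \<and> openin X {q. \<beta> q > (0::real)}"
  have "\<forall>p\<in>topspace X. \<exists>c \<beta> K. ?good p c \<beta> K"
  proof
    fix p assume "p \<in> topspace X"
    then obtain c where c: "c \<in> A" "p \<in> fst c" "p = p0 \<longrightarrow> c = a0" using ex_chart a0 by metis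
    obtain \<beta> K where "C1_fun \<beta> \<and> (\<forall>q. \<beta> q \<ge> 0) \<and> \<beta> p > 0 \<and> compact K \<and> K \<subseteq> img c \<and>
      (\<forall>q. q \<notin> par c ` K \<longrightarrow> \<beta> q = 0) \<and> openin X {q. \<beta> q > 0}" using ex_bump[OF c(1,2)] by (elim exE)
    with c have "?good p c \<beta> K" by simp
    then show "\<exists>c \<beta> K. ?good p c \<beta> K" by (intro exI)
  qed
  from bchoice[OF this] obtain c where "\<forall>p\<in>topspace X. \<exists>\<beta> K. ?good p (c p) \<beta> K" by (elim exE)
  from bchoice[OF this] obtain \<beta> where "\<forall>p\<in>topspace X. \<exists>K. ?good p (c p) (\<beta> p) K" by (elim exE)
  from bchoice[OF this] obtain K where good: "\<forall>p\<in>topspace X. ?good p (c p) (\<beta> p) (K p)" by (elim exE)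
  have p0: "p0 \<in> topspace X" using a0 chart_subset by blast
  let ?V = "\<lambda>p. {q. \<beta> p q > 0}"
  have "compactin X (topspace X)" using compact by (simp add: compact_space_def)
  moreover have "\<forall>V\<in>?V ` topspace X. openin X V" using good by auto
  moreover have "topspace X \<subseteq> \<Union>(?V ` topspace X)" using good by auto
  ultimately obtain \<F> where F: "finite \<F>" "\<F> \<subseteq> ?V ` topspace X" "topspace X \<subseteq> \<Union>\<F>"
    unfolding compactin_def by meson
  obtain Q' where Q': "Q' \<subseteq> topspace X" "finite Q'" "\<F> = ?V ` Q'"
    using finite_subset_image[OF F(1,2)] by metis
  define Q where "Q = insert p0 Q'"
  have Q: "finite Q" "Q \<subseteq> topspace X" "p0 \<in> Q" using Q' p0 by (auto simp: Q_def)
  define \<sigma> where "\<sigma> = (\<lambda>q. \<Sum>p\<in>Q. \<beta> p q)"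
  have \<sigma>: "\<sigma> q > 0" if q: "q \<in> topspace X" for q
  proof -
    obtain p where "p \<in> Q'" "\<beta> p q > 0" using F(3) Q'(3) q by auto
    then show ?thesis unfolding \<sigma>_def using Q good
      by (intro sum_pos2[of Q p]) (auto simp: Q_def)
  qed
  define \<rho> where "\<rho> = (\<lambda>p q. \<beta> p q * inverse (\<sigma> q))"
  have C1\<sigma>: "C1_fun \<sigma>" unfolding C1_fun_def \<sigma>_def
  proof (intro ballI C1_on_sum chart(2))
    fix a p assume "a \<in> A" "p \<in> Q"
    then show "C1_on (img a) (\<lambda>u. \<beta> p (par a u))" using good Q(2) unfolding C1_fun_def by blast
  qed
  have "C1_fun (\<rho> p)" if "p \<in> Q" for p unfolding C1_fun_def
  proof
    fix a assume a: "a \<in> A"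
    have "C1_on (img a) (\<lambda>u. inverse (\<sigma> (par a u)))"
      using C1\<sigma> a par_in_topspace[OF a] \<sigma> unfolding C1_fun_def
      by (intro C1_on_inverse chart(2)) (auto, force)
    moreover have "C1_on (img a) (\<lambda>u. \<beta> p (par a u))" using good Q(2) that a unfolding C1_fun_def by blast
    ultimately show "C1_on (img a) (\<lambda>u. \<rho> p (par a u))"
      unfolding \<rho>_def by (intro C1_on_mult chart(2) a)
  qed
  moreover have "(\<Sum>p\<in>Q. \<rho> p q) = 1" if "q \<in> topspace X" for q
  proof -
    have "(\<Sum>p\<in>Q. \<rho> p q) = \<sigma> q * inverse (\<sigma> q)"
      by (simp only: \<rho>_def \<sigma>_def sum_distrib_right)
    then show ?thesis using \<sigma>[OF that] by simp
  qed
  moreover have "\<rho> p q \<ge> 0" if "p \<in> Q" "q \<in> topspace X" for p q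
    using good Q(2) that \<sigma>[OF that(2)] by (force simp: \<rho>_def)
  moreover have "\<rho> p0 p0 > 0" "c p0 = a0" using good p0 \<sigma>[OF p0] by (auto simp: \<rho>_def)
  moreover have "\<forall>p\<in>Q. c p \<in> A \<and> compact (K p) \<and> K p \<subseteq> img (c p) \<and> (\<forall>q. q \<notin> par (c p) ` K p \<longrightarrow> \<rho> p q = 0)"
    using good Q(2) by (auto simp: \<rho>_def)
  ultimately show ?thesis using Q(1,3) by (intro exI[of _ Q] exI[of _ c] exI[of _ \<rho>] exI[of _ K]) simp
qed

text \<open>With a partition of unity \<open>\<rho>\<close>, the sum of the boundary integrals of \<open>\<rho>\<^sub>i \<omega>\<close> is the integral
  of \<open>\<Sum> d\<rho>\<^sub>i \<and> \<omega> = 0\<close>; all of them are nonnegative, so none is positive.\<close>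

theorem nonneg_on_boundary_imp_zero:
  assumes nn: "\<And>a u. a \<in> A \<Longrightarrow> u \<in> img a \<Longrightarrow> u$2 = 0 \<Longrightarrow> \<omega> a u E1 \<ge> 0"
    and a0: "a0 \<in> A" and u0: "u0 \<in> img a0" "u0$2 = 0"
  shows "\<omega> a0 u0 E1 = 0"
proof -
  define p0 where "p0 = par a0 u0"
  have "p0 \<in> fst a0" using u0 by (simp add: p0_def)
  from ex_partition_of_unity[OF a0 this] obtain Q c \<rho> K where
    "finite Q \<and> p0 \<in> Q \<and> c p0 = a0 \<and> \<rho> p0 p0 > 0 \<and>
    (\<forall>p\<in>Q. c p \<in> A \<and> C1_fun (\<rho> p) \<and> (\<forall>q\<in>topspace X. \<rho> p q \<ge> 0) \<and> compact (K p) \<and> K p \<subseteq> img (c p) \<and>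
      (\<forall>q. q \<notin> par (c p) ` K p \<longrightarrow> \<rho> p q = 0)) \<and>
    (\<forall>q\<in>topspace X. (\<Sum>p\<in>Q. \<rho> p q) = 1)" by (elim exE)
  then have Q: "finite Q" "p0 \<in> Q" "c p0 = a0" "\<rho> p0 p0 > 0"
    and c: "\<And>p. p \<in> Q \<Longrightarrow> c p \<in> A" and \<rho>: "\<And>p. p \<in> Q \<Longrightarrow> C1_fun (\<rho> p)"
    and \<rho>nn: "\<And>p q. p \<in> Q \<Longrightarrow> q \<in> topspace X \<Longrightarrow> \<rho> p q \<ge> 0"
    and K: "\<And>p. p \<in> Q \<Longrightarrow> compact (K p)" "\<And>p. p \<in> Q \<Longrightarrow> K p \<subseteq> img (c p)"
      "\<And>p q. p \<in> Q \<Longrightarrow> q \<notin> par (c p) ` K p \<Longrightarrow> \<rho> p q = 0"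
    and one: "\<And>q. q \<in> topspace X \<Longrightarrow> (\<Sum>p\<in>Q. \<rho> p q) = 1" by auto
  have \<rho>C1: "C1_on (img a) (\<lambda>u. \<rho> p (par a u))" if "p \<in> Q" "a \<in> A" for p a
    using \<rho>[OF that(1)] that(2) by (simp add: C1_fun_def)
  have \<rho>0: "\<rho> p (par (c p) u) = 0" if "p \<in> Q" "u \<in> img (c p) - K p" for p u
    using K(3)[OF that(1)] par_notin[OF K(2)[OF that(1)] that(2)] by blast
  \<comment> \<open>\<open>d(\<rho> \<omega>) = d\<rho> \<and> \<omega>\<close> because \<open>\<omega>\<close> is closed\<close>
  have d: "deriv_along (img (c p)) (\<lambda>u. \<rho> p (par (c p) u) * \<omega> (c p) u E2) E1 u
      - deriv_along (img (c p)) (\<lambda>u. \<rho> p (par (c p) u) * \<omega> (c p) u E1) E2 u = wedge (\<rho> p) (c p) u"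
    if p: "p \<in> Q" and u: "u \<in> img (c p)" for p u
    using closed[OF c[OF p] u]
    by (simp add: wedge_def deriv_along_mult[OF chart(2)[OF c[OF p]] \<rho>C1[OF p c[OF p]] form_C1[OF c[OF p]] u])
  let ?I = "\<lambda>p. integral (img (c p)) (wedge (\<rho> p) (c p))"
  have I: "?I p = integral (img (c p)) (\<lambda>u. deriv_along (img (c p)) (\<lambda>u. \<rho> p (par (c p) u) * \<omega> (c p) u E2) E1 u
      - deriv_along (img (c p)) (\<lambda>u. \<rho> p (par (c p) u) * \<omega> (c p) u E1) E2 u)" if "p \<in> Q" for p
    using d[OF that] by (intro integral_cong) simp
  have Green: "?I p \<ge> 0" "\<And>u. ?I p = 0 \<Longrightarrow> u \<in> img (c p) \<Longrightarrow> u$2 = 0 \<Longrightarrow> \<rho> p (par (c p) u) * \<omega> (c p) u E1 = 0"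
    if p: "p \<in> Q" for p
  proof -
    have C: "C1_on (img (c p)) (\<lambda>u. \<rho> p (par (c p) u) * \<omega> (c p) u e)" for e
      by (intro C1_on_mult chart(2) c p \<rho>C1 form_C1)
    have Z: "\<rho> p (par (c p) u) * \<omega> (c p) u e = 0" if "u \<in> img (c p) - K p" for u e
      using \<rho>0[OF p that] by simp
    have N: "\<rho> p (par (c p) u) * \<omega> (c p) u E1 \<ge> 0" if "u \<in> img (c p)" "u$2 = 0" for u
      using nn[OF c[OF p] that] \<rho>nn[OF p par_in_topspace[OF c[OF p] that(1)]] by simp
    show "?I p \<ge> 0" unfolding I[OF p]
      by (rule half_plane_Green(1)[OF chart(2)[OF c[OF p]] C C K(1,2)[OF p] Z Z N])
    show "\<rho> p (par (c p) u) * \<omega> (c p) u E1 = 0" if "?I p = 0" "u \<in> img (c p)" "u$2 = 0" for u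
      by (rule half_plane_Green(2)[OF chart(2)[OF c[OF p]] C C K(1,2)[OF p] Z Z N _ that(2,3)])
        (use that(1) I[OF p] in auto)
  qed
  \<comment> \<open>cut every term once more with the partition, to compare it with the same term in the other charts\<close>
  let ?G = "\<lambda>p q a u. \<rho> q (par a u) * wedge (\<rho> p) a u"
  have Gi: "?G p q (c p) integrable_on img (c p)" "?G p q (c q) integrable_on img (c q)" if p: "p \<in> Q" and q: "q \<in> Q" for p q
  proof -
    have cont: "continuous_on (img a) (?G p q a)" if "a \<in> A" for a
      by (intro continuous_on_mult C1_on_imp_continuous_on[OF \<rho>C1] continuous_on_wedge \<rho> p q that)
    have "wedge (\<rho> p) (c p) u = 0" if "u \<in> img (c p) - K p" for u
    proof -
      have "deriv_along (img (c p)) (\<lambda>u. \<rho> p (par (c p) u)) e u = 0" for e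
        using that by (rule deriv_along_outside_support[OF chart(2)[OF c[OF p]] compact_imp_closed[OF K(1)[OF p]] _ \<rho>0[OF p]])
      then show ?thesis by (simp add: wedge_def)
    qed
    then have "?G p q (c p) absolutely_integrable_on img (c p)"
      by (intro absolutely_integrable_compact_support[OF K(1,2)[OF p] cont[OF c[OF p]]]) simp
    then show "?G p q (c p) integrable_on img (c p)" using absolutely_integrable_on_def by blast
    have "?G p q (c q) absolutely_integrable_on img (c q)"
      using \<rho>0[OF q] by (intro absolutely_integrable_compact_support[OF K(1,2)[OF q] cont[OF c[OF q]]]) simp
    then show "?G p q (c q) integrable_on img (c q)" using absolutely_integrable_on_def by blast
  qed
  have "?I p = (\<Sum>q\<in>Q. integral (img (c p)) (?G p q (c p)))" if p: "p \<in> Q" for p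
  proof -
    have "?I p = integral (img (c p)) (\<lambda>u. \<Sum>q\<in>Q. ?G p q (c p) u)"
    proof (rule integral_cong)
      fix u assume "u \<in> img (c p)"
      then have "(\<Sum>q\<in>Q. \<rho> q (par (c p) u)) = 1" using one par_in_topspace[OF c[OF p]] by blast
      then show "wedge (\<rho> p) (c p) u = (\<Sum>q\<in>Q. ?G p q (c p) u)" by (simp flip: sum_distrib_right)
    qed
    also have "\<dots> = (\<Sum>q\<in>Q. integral (img (c p)) (?G p q (c p)))"
      using Gi(1)[OF p] by (intro integral_sum Q(1))
    finally show ?thesis .
  qed
  then have "(\<Sum>p\<in>Q. ?I p) = (\<Sum>p\<in>Q. \<Sum>q\<in>Q. integral (img (c p)) (?G p q (c p)))" by simp
  also have "\<dots> = (\<Sum>p\<in>Q. \<Sum>q\<in>Q. integral (img (c q)) (?G p q (c q)))"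
  proof (intro sum.cong refl)
    fix p q assume p: "p \<in> Q" and q: "q \<in> Q"
    show "integral (img (c p)) (?G p q (c p)) = integral (img (c q)) (?G p q (c q))"
      by (rule integral_wedge_swap[OF c[OF p] c[OF q] \<rho>[OF p] K(1,2)[OF p] K(3)[OF p] \<rho>[OF q] K(1,2)[OF q] K(3)[OF q]])
  qed
  also have "\<dots> = (\<Sum>q\<in>Q. \<Sum>p\<in>Q. integral (img (c q)) (?G p q (c q)))" by (rule sum.swap)
  also have "\<dots> = (\<Sum>q\<in>Q. 0)"
  proof (rule sum.cong[OF refl])
    fix q assume q: "q \<in> Q"
    have "(\<Sum>p\<in>Q. integral (img (c q)) (?G p q (c q))) = integral (img (c q)) (\<lambda>u. \<Sum>p\<in>Q. ?G p q (c q) u)"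
      using Gi(2)[OF _ q] by (intro integral_sum[symmetric] Q(1))
    also have "\<dots> = integral (img (c q)) (\<lambda>_. 0)"
    proof (rule integral_cong)
      fix u assume u: "u \<in> img (c q)"
      have "(\<Sum>p\<in>Q. deriv_along (img (c q)) (\<lambda>u. \<rho> p (par (c q) u)) e u) = 0" for e
      proof -
        have "((\<lambda>u. \<Sum>p\<in>Q. \<rho> p (par (c q) u)) has_derivative
          (\<lambda>e. \<Sum>p\<in>Q. deriv_along (img (c q)) (\<lambda>u. \<rho> p (par (c q) u)) e u)) (at u within img (c q))"
          by (intro has_derivative_sum C1_onD[OF \<rho>C1] c q u)
        from deriv_along_eq[OF chart(2)[OF c[OF q]] u this]
        have "(\<Sum>p\<in>Q. deriv_along (img (c q)) (\<lambda>u. \<rho> p (par (c q) u)) e u)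
          = deriv_along (img (c q)) (\<lambda>u. \<Sum>p\<in>Q. \<rho> p (par (c q) u)) e u" by simp
        also have "\<dots> = deriv_along (img (c q)) (\<lambda>_. 1) e u"
          using one par_in_topspace[OF c[OF q]]
          by (intro deriv_along_cong(2)[OF chart(2)[OF c[OF q]] u, of UNIV]) auto
        also have "\<dots> = 0" by (rule deriv_along_eq[OF chart(2)[OF c[OF q]] u]) auto
        finally show ?thesis .
      qed
      then have "(\<Sum>p\<in>Q. wedge (\<rho> p) (c q) u) = 0"
        by (simp add: wedge_def sum_subtractf flip: sum_distrib_right)
      then show "(\<Sum>p\<in>Q. ?G p q (c q) u) = 0" by (simp flip: sum_distrib_left)
    qed
    finally show "(\<Sum>p\<in>Q. integral (img (c q)) (?G p q (c q))) = 0" by simp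
  qed
  finally have "(\<Sum>p\<in>Q. ?I p) = 0" by simp
  then have "?I p0 = 0" using Green(1) Q(1,2) sum_nonneg_eq_0_iff[of Q ?I] by blast
  with Green(2)[OF Q(2)] Q(3) u0 have "\<rho> p0 (par a0 u0) * \<omega> a0 u0 E1 = 0" by metis
  then show ?thesis using Q(4) by (simp add: p0_def)
qed

end

section \<open>Levi-Civita derivatives for diagonal metrics\<close>

lemma matrix_inv_eqI:
  fixes A B :: "'a::semiring_1^'n^'n"
  assumes "A ** B = mat 1" "B ** A = mat 1" shows "matrix_inv A = B"
proof -
  have "A ** matrix_inv A = mat 1 \<and> matrix_inv A ** A = mat 1"
    unfolding matrix_inv_def by (rule someI[of _ B]) (use assms in blast)
  then have "matrix_inv A = matrix_inv A ** (A ** B)" using assms by simp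
  also have "\<dots> = B" using \<open>_ \<and> _\<close> by (simp add: matrix_mul_assoc)
  finally show ?thesis .
qed

definition diag :: "('n::finite \<Rightarrow> real) \<Rightarrow> real^'n^'n" where
  "diag d = (\<chi> i j. if i = j then d i else 0)"

lemma diag_mult: "diag d ** diag e = diag (\<lambda>i. d i * e i)"
proof -
  have "(if i = k then d i else 0) * (if k = j then e k else 0)
    = (if i = k then (if i = j then d i * e i else 0) else 0)" for i j k by simp
  then show ?thesis by (simp add: diag_def matrix_matrix_mult_def vec_eq_iff)
qed

lemma matrix_inv_diag:
  assumes "\<And>i. d i \<noteq> 0" shows "matrix_inv (diag d) = diag (\<lambda>i. 1 / d i)"
  using assms by (intro matrix_inv_eqI) (auto simp: diag_mult, auto simp: diag_def mat_def vec_eq_iff)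

lemma christoffel_diag:
  fixes g :: "('n::finite) riem_metric"
  assumes g: "\<And>q. metric_matrix g q = diag (D q)" and nz: "\<And>i. D p i \<noteq> 0"
    and D': "\<And>i. ((\<lambda>q. D q i) has_derivative D' i) (at p)"
  shows "christoffel g p k i j = ((if j = k then D' k (axis i 1) else 0) + (if i = k then D' k (axis j 1) else 0)
      - (if i = j then D' i (axis k 1) else 0)) / (2 * D p k)"
proof -
  have mp: "metric_partial g i j l p = (if j = l then D' j (axis i 1) else 0)" for i j l
  proof -
    have "((\<lambda>q. metric_matrix g q $ j $ l) has_derivative (\<lambda>e. if j = l then D' j e else 0)) (at p)"
      using D'[of l] unfolding g diag_def by (cases "j = l") auto
    from frechet_derivative_at[OF this, symmetric] show ?thesis
      by (simp add: metric_partial_def deriv_along_def)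
  qed
  have inv: "matrix_inv (metric_matrix g p) $ k $ l = (if k = l then 1 / D p k else 0)" for l
    unfolding g matrix_inv_diag[of "D p", OF nz] by (simp add: diag_def)
  have "christoffel g p k i j = (1 / D p k * (metric_partial g i j k p + metric_partial g j i k p - metric_partial g k i j p)) / 2"
    proof -
    have "(if k = l then 1 / D p k else 0) * x = (if k = l then 1 / D p k * x else 0)" for l x by simp
    then show ?thesis unfolding christoffel_def inv by simp
  qed
  then show ?thesis by (auto simp: mp)
qed

lemma P_metric_eq: "P_metric q v w = exp (- 2 * q$2) * v$1 * w$1 + v$2 * w$2"
  by (simp add: P_metric_def P_incl_def sol_metric_def)

lemma christoffel_P:
  "christoffel P_metric p 1 i j = (if (i, j) = (1, 2) \<or> (i, j) = (2, 1) then -1 else 0)"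
  "christoffel P_metric p 2 i j = (if (i, j) = (1, 1) then exp (- 2 * p$2) else 0)"
proof -
  define D where "D = (\<lambda>(q::real^2) (i::2). if i = 1 then exp (- 2 * q$2) else 1)"
  define D' where "D' = (\<lambda>(i::2) (e::real^2). if i = 1 then exp (- 2 * p$2) * (- 2 * e$2) else 0)"
  have g: "metric_matrix P_metric q = diag (D q)" for q
    by (auto simp: metric_matrix_def diag_def vec_eq_iff D_def P_metric_eq axis_def forall_2)
  have D': "((\<lambda>q. D q i) has_derivative D' i) (at p)" for i
  proof (cases "i = 1")
    case True then show ?thesis unfolding D_def D'_def
      by (auto intro!: derivative_eq_intros bounded_linear.has_derivative[OF bounded_linear_vec_nth])
  next
    case False then show ?thesis by (simp add: D_def D'_def)
  qed
  note c = christoffel_diag[of P_metric D, OF g _ D', unfolded D_def]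
  show "christoffel P_metric p 1 i j = (if (i, j) = (1, 2) \<or> (i, j) = (2, 1) then -1 else 0)"
    using exhaust_2[of i] exhaust_2[of j] by (subst c) (auto simp: D'_def axis_def)
  show "christoffel P_metric p 2 i j = (if (i, j) = (1, 1) then exp (- 2 * p$2) else 0)"
    using exhaust_2[of i] exhaust_2[of j] by (subst c) (auto simp: D'_def axis_def)
qed

lemma covariant_deriv_P:
  "covariant_deriv P_metric S F V e u $ 1 = deriv_along S V e u $ 1
     - (deriv_along S F e u $ 1 * V u $ 2 + deriv_along S F e u $ 2 * V u $ 1)"
  "covariant_deriv P_metric S F V e u $ 2 = deriv_along S V e u $ 2
     + exp (- 2 * F u $ 2) * deriv_along S F e u $ 1 * V u $ 1"
  by (simp_all add: covariant_deriv_def sum_2 christoffel_P)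

text \<open>The Christoffel symbols of Sol as a bilinear map.\<close>

definition sol_Gamma :: "real^3 \<Rightarrow> real^3 \<Rightarrow> real^3 \<Rightarrow> real^3" where
  "sol_Gamma p v w = vector [v$1 * w$3 + v$3 * w$1, - (v$2 * w$3 + v$3 * w$2),
     exp (- 2 * p$3) * v$2 * w$2 - exp (2 * p$3) * v$1 * w$1]"

lemma christoffel_sol:
  "christoffel sol_metric p 1 i j = (if (i, j) = (1, 3) \<or> (i, j) = (3, 1) then 1 else 0)"
  "christoffel sol_metric p 2 i j = (if (i, j) = (2, 3) \<or> (i, j) = (3, 2) then -1 else 0)"
  "christoffel sol_metric p 3 i j = (if (i, j) = (1, 1) then - exp (2 * p$3)
     else if (i, j) = (2, 2) then exp (- 2 * p$3) else 0)"
proof -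
  define D where "D = (\<lambda>(q::real^3) (i::3). if i = 1 then exp (2 * q$3) else if i = 2 then exp (- 2 * q$3) else 1)"
  define D' where "D' = (\<lambda>(i::3) (e::real^3). if i = 1 then exp (2 * p$3) * (2 * e$3)
     else if i = 2 then exp (- 2 * p$3) * (- 2 * e$3) else 0)"
  have g: "metric_matrix sol_metric q = diag (D q)" for q
    by (auto simp: metric_matrix_def diag_def vec_eq_iff D_def sol_metric_def axis_def forall_3)
  have D': "((\<lambda>q. D q i) has_derivative D' i) (at p)" for i
  proof -
    have 1: "((\<lambda>q. exp (2 * q$3)) has_derivative (\<lambda>e. exp (2 * p$3) * (2 * e$3))) (at p)"
      by (auto intro!: derivative_eq_intros bounded_linear.has_derivative[OF bounded_linear_vec_nth])
    have 2: "((\<lambda>q. exp (- 2 * q$3)) has_derivative (\<lambda>e. exp (- 2 * p$3) * (- 2 * e$3))) (at p)"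
      by (auto intro!: derivative_eq_intros bounded_linear.has_derivative[OF bounded_linear_vec_nth])
    show ?thesis using exhaust_3[of i] 1 2 by (auto simp: D_def D'_def)
  qed
  note c = christoffel_diag[of sol_metric D, OF g _ D', unfolded D_def]
  show "christoffel sol_metric p 1 i j = (if (i, j) = (1, 3) \<or> (i, j) = (3, 1) then 1 else 0)"
    using exhaust_3[of i] exhaust_3[of j] by (subst c) (auto simp: D'_def axis_def)
  show "christoffel sol_metric p 2 i j = (if (i, j) = (2, 3) \<or> (i, j) = (3, 2) then -1 else 0)"
    using exhaust_3[of i] exhaust_3[of j] by (subst c) (auto simp: D'_def axis_def)
  show "christoffel sol_metric p 3 i j = (if (i, j) = (1, 1) then - exp (2 * p$3)
     else if (i, j) = (2, 2) then exp (- 2 * p$3) else 0)"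
    using exhaust_3[of i] exhaust_3[of j] by (subst c) (auto simp: D'_def axis_def)
qed

lemma covariant_deriv_sol:
  "covariant_deriv sol_metric S F V e u = deriv_along S V e u + sol_Gamma (F u) (deriv_along S F e u) (V u)"
  by (simp add: covariant_deriv_def vec_eq_iff forall_3 sum_3 christoffel_sol sol_Gamma_def)

section \<open>Circles of curvature greater than one in the plane\<close>

lemma smooth_curve_derivatives:
  fixes \<gamma> :: "real \<Rightarrow> real^2"
  assumes "smooth_on UNIV \<gamma>"
  defines "v \<equiv> deriv_along UNIV \<gamma> 1" and "a \<equiv> deriv_along UNIV (deriv_along UNIV \<gamma> 1) 1"
  shows "(\<gamma> has_vector_derivative v t) (at t)" "(v has_vector_derivative a t) (at t)" "continuous_on UNIV a"
proof -
  have *: "(\<gamma> has_vector_derivative v t) (at t) \<and> (v has_vector_derivative a t) (at t) \<and> isCont a t" for t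
  proof -
    obtain W G where "open W \<and> t \<in> W \<and> (\<forall>k. C_k_on k W G) \<and> (\<forall>y\<in>UNIV \<inter> W. G y = \<gamma> y)"
      using assms(1) unfolding smooth_on_def by (meson UNIV_I)
    then have W: "open W" "t \<in> W" "C_k_on 2 W G" and eq: "\<And>x. x \<in> W \<Longrightarrow> G x = \<gamma> x" by auto
    have works: "(h has_vector_derivative frechet_derivative h (at x) 1) (at x)"
      if "h differentiable (at x)" for h :: "real \<Rightarrow> real^2" and x
    proof -
      have D: "(h has_derivative frechet_derivative h (at x)) (at x)"
        using that frechet_derivative_works by blast
      have "frechet_derivative h (at x) = (\<lambda>t. t *\<^sub>R frechet_derivative h (at x) 1)"
      proof
        fix t
        show "frechet_derivative h (at x) t = t *\<^sub>R frechet_derivative h (at x) 1"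
          using linear_scale[OF has_derivative_linear[OF D], of t 1]
          by (simp only: real_scaleR_def mult_1_right)
      qed
      from has_derivative_eq_rhs[OF D this] show ?thesis unfolding has_vector_derivative_def .
    qed
    have unique: "frechet_derivative h (at x) 1 = d" if "(h has_vector_derivative d) (at x)"
      for h :: "real \<Rightarrow> real^2" and x d
      using frechet_derivative_at[OF that[unfolded has_vector_derivative_def], symmetric] by simp
    define G1 where "G1 = (\<lambda>x. frechet_derivative G (at x) 1)"
    define G2 where "G2 = (\<lambda>x. frechet_derivative G1 (at x) 1)"
    have d: "(G has_vector_derivative G1 x) (at x)" "(G1 has_vector_derivative G2 x) (at x)" if "x \<in> W" for x
      using W(3) that unfolding G1_def G2_def numeral_2_eq_2 by (auto intro!: works)
    have c: "continuous_on W G2" using W(3) unfolding G1_def G2_def numeral_2_eq_2 by auto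
    have g1: "(\<gamma> has_vector_derivative G1 x) (at x)" if "x \<in> W" for x
      by (rule has_vector_derivative_transform_within_open[OF d(1)[OF that] W(1) that eq])
    have v: "v x = G1 x" if "x \<in> W" for x
      using unique[OF g1[OF that]] by (simp add: v_def deriv_along_def)
    have g2: "(v has_vector_derivative G2 x) (at x)" if "x \<in> W" for x
      by (rule has_vector_derivative_transform_within_open[OF d(2)[OF that] W(1) that]) (simp add: v)
    have a: "a x = G2 x" if "x \<in> W" for x
      using unique[OF g2[OF that]] by (simp add: a_def v_def deriv_along_def)
    have "continuous_on W a" using c by (rule continuous_on_eq) (simp add: a)
    then have "isCont a t" using W continuous_on_eq_continuous_at by blast
    with g1 g2 v a W(2) show ?thesis by simp
  qed
  show "(\<gamma> has_vector_derivative v t) (at t)" "(v has_vector_derivative a t) (at t)" "continuous_on UNIV a"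
    using * by (auto simp: continuous_on_eq_continuous_at)
qed

text \<open>The angle is an antiderivative of \<open>\<omega>\<close>. In the time \<open>2 * pi / m\<close> it sweeps an interval of
  length at least \<open>2 * pi\<close>.\<close>

lemma unit_circle_surj:
  fixes P Q :: "real \<Rightarrow> real"
  assumes P: "\<And>t. (P has_real_derivative - (Q t * \<omega> t)) (at t)"
    and Q: "\<And>t. (Q has_real_derivative P t * \<omega> t) (at t)"
    and one: "\<And>t. (P t)\<^sup>2 + (Q t)\<^sup>2 = 1" and \<omega>: "continuous_on UNIV \<omega>" "\<And>t. \<bar>\<omega> t\<bar> \<ge> m" and m: "m > 0"
  shows "\<exists>t. P t = cos \<phi> \<and> Q t = sin \<phi>"
proof -
  define L where "L = 2 * pi / m"
  have L: "L > 0" "m * L = 2 * pi" using m by (auto simp: L_def)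
  obtain g0 where g0: "\<And>x. x \<in> {0..L} \<Longrightarrow> (g0 has_vector_derivative \<omega> x) (at x within {0..L})"
    using antiderivative_continuous[OF continuous_on_subset[OF \<omega>(1)]] by blast
  obtain \<theta>0 where \<theta>0: "P 0 = cos \<theta>0" "Q 0 = sin \<theta>0" using sincos_total_2pi[OF one[of 0]] by metis
  define g where "g = (\<lambda>x. g0 x - g0 0 + \<theta>0)"
  have g: "(g has_real_derivative \<omega> x) (at x within {0..L})" if "x \<in> {0..L}" for x
    unfolding g_def using g0[OF that]
    by (auto intro!: derivative_eq_intros simp: has_real_derivative_iff_has_vector_derivative)
  define k where "k = (\<lambda>x. P x * cos (g x) + Q x * sin (g x))"
  have "(k has_real_derivative 0) (at x within {0..L})" if "x \<in> {0..L}" for x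
    unfolding k_def
    by (rule derivative_eq_intros g[OF that] has_field_derivative_at_within[OF P]
        has_field_derivative_at_within[OF Q] refl)+ (simp add: algebra_simps)
  then obtain k0 where k0: "\<And>x. x \<in> {0..L} \<Longrightarrow> k x = k0"
    using has_field_derivative_zero_constant[of "{0..L}" k] by auto
  have "k 0 = 1" using \<theta>0 by (simp add: k_def g_def flip: power2_eq_square)
  then have k1: "k x = 1" if "x \<in> {0..L}" for x using k0[OF that] k0[of 0] L by simp
  have PQ: "P x = cos (g x) \<and> Q x = sin (g x)" if "x \<in> {0..L}" for x
  proof -
    have "(P x - cos (g x))\<^sup>2 + (Q x - sin (g x))\<^sup>2 = ((P x)\<^sup>2 + (Q x)\<^sup>2) + ((cos (g x))\<^sup>2 + (sin (g x))\<^sup>2) - 2 * k x"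
      by (simp add: k_def power2_eq_square algebra_simps)
    also have "\<dots> = 0" using one k1[OF that] by simp
    finally show ?thesis by (simp add: sum_power2_eq_zero_iff)
  qed
  have gc: "continuous_on {0..L} g"
    using g by (meson DERIV_continuous continuous_on_eq_continuous_within)
  have "\<exists>x\<in>{0<..<L}. g L - g 0 = (\<lambda>h. \<omega> x * h) (L - 0)"
    using L(1) g by (intro mvt_simple) (auto simp: has_field_derivative_def)
  then obtain x where "g L - g 0 = \<omega> x * L" by auto
  then have "\<bar>g L - g 0\<bar> \<ge> m * L" using \<omega>(2)[of x] L(1) by (simp add: abs_mult mult_right_mono)
  then have long: "\<bar>g L - g 0\<bar> \<ge> 2 * pi" using L(2) by simp
  define b where "b = min (g 0) (g L)"
  define n where "n = \<lceil>(b - \<phi>) / (2 * pi)\<rceil>"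
  have "(b - \<phi>) / (2 * pi) \<le> n" "n \<le> (b - \<phi>) / (2 * pi) + 1" unfolding n_def by linarith+
  then have n: "b \<le> \<phi> + 2 * pi * n" "\<phi> + 2 * pi * n \<le> b + 2 * pi" by (auto simp: field_simps)
  have "\<exists>x\<in>{0..L}. g x = \<phi> + 2 * pi * n"
  proof (cases "g 0 \<le> g L")
    case True
    then show ?thesis using n long L(1) IVT'[of g 0 "\<phi> + 2 * pi * n" L] gc by (auto simp: b_def)
  next
    case False
    then show ?thesis using n long L(1) IVT2'[of g L "\<phi> + 2 * pi * n" 0] gc by (auto simp: b_def)
  qed
  then obtain x where "x \<in> {0..L}" "g x = \<phi> + 2 * pi * n" by blast
  then have "P x = cos \<phi>" "Q x = sin \<phi>" using PQ[of x] by (simp_all add: cos_add sin_add)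
  then show ?thesis by blast
qed

text \<open>The Euclidean circle of radius \<open>R\<close> about \<open>(Y, R c)\<close> in the half-plane with the coordinates
  \<open>y\<close> and \<open>exp z\<close>, traversed from its lowest point.\<close>

definition horo :: "real \<Rightarrow> real \<Rightarrow> real \<Rightarrow> real \<Rightarrow> real^3" where
  "horo c Y R \<theta> = vector [0, Y + R * sin \<theta>, ln (R * (c - cos \<theta>))]"

text \<open>In the coordinates \<open>y\<close> and \<open>exp z\<close> a curve of constant curvature \<open>c\<close> is the Euclidean circle
  of some radius \<open>R\<close> whose centre has height \<open>R c\<close>; the centre and the radius are first integrals
  of the equation of constant curvature.\<close>

lemma circle_of_curvature_param:
  assumes c: "c > 1" and \<Gamma>: "circle_of_curvature c \<Gamma>"
  shows "\<exists>Y R. R > 0 \<and> \<Gamma> = range (horo c Y R)"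
proof -
  have "\<exists>\<gamma> :: real \<Rightarrow> real^2. smooth_on UNIV \<gamma> \<and> \<Gamma> = P_incl ` range \<gamma> \<and>
    (\<forall>t. P_metric (\<gamma> t) (deriv_along UNIV \<gamma> 1 t) (deriv_along UNIV \<gamma> 1 t) = 1 \<and>
      sqrt (P_metric (\<gamma> t) (covariant_deriv P_metric UNIV \<gamma> (deriv_along UNIV \<gamma> 1) 1 t)
        (covariant_deriv P_metric UNIV \<gamma> (deriv_along UNIV \<gamma> 1) 1 t)) = c)"
    using \<Gamma> unfolding circle_of_curvature_def Let_def
    by (elim exE conjE) (intro exI conjI, assumption+)
  then obtain \<gamma> :: "real \<Rightarrow> real^2" where \<gamma>: "smooth_on UNIV \<gamma> \<and> \<Gamma> = P_incl ` range \<gamma> \<and>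
    (\<forall>t. P_metric (\<gamma> t) (deriv_along UNIV \<gamma> 1 t) (deriv_along UNIV \<gamma> 1 t) = 1 \<and>
      sqrt (P_metric (\<gamma> t) (covariant_deriv P_metric UNIV \<gamma> (deriv_along UNIV \<gamma> 1) 1 t)
        (covariant_deriv P_metric UNIV \<gamma> (deriv_along UNIV \<gamma> 1) 1 t)) = c)" by (elim exE)
  then have sm: "smooth_on UNIV \<gamma>" and \<Gamma>: "\<Gamma> = P_incl ` range \<gamma>"
    and un: "\<And>t. P_metric (\<gamma> t) (deriv_along UNIV \<gamma> 1 t) (deriv_along UNIV \<gamma> 1 t) = 1"
    and cu: "\<And>t. sqrt (P_metric (\<gamma> t) (covariant_deriv P_metric UNIV \<gamma> (deriv_along UNIV \<gamma> 1) 1 t)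
        (covariant_deriv P_metric UNIV \<gamma> (deriv_along UNIV \<gamma> 1) 1 t)) = c" by simp_all
  define v where "v = deriv_along UNIV \<gamma> 1"
  define a where "a = deriv_along UNIV (deriv_along UNIV \<gamma> 1) 1"
  note sc = smooth_curve_derivatives[OF sm, folded v_def a_def]
  define y where "y = (\<lambda>t. \<gamma> t $ 1)"
  define z where "z = (\<lambda>t. \<gamma> t $ 2)"
  \<comment> \<open>\<open>(p, q)\<close> and \<open>(A, B)\<close> are the velocity and the acceleration in the orthonormal frame\<close>
  define p where "p = (\<lambda>t. exp (- z t) * v t $ 1)"
  define q where "q = (\<lambda>t. v t $ 2)"
  define p' where "p' = (\<lambda>t. exp (- z t) * (a t $ 1 - v t $ 1 * v t $ 2))"
  define q' where "q' = (\<lambda>t. a t $ 2)"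
  have nth: "((\<lambda>t. h t $ i) has_real_derivative d $ i) (at t)" if "(h has_vector_derivative d) (at t)"
    for h :: "real \<Rightarrow> real^2" and d i t
    using bounded_linear.has_vector_derivative[OF bounded_linear_vec_nth that]
    by (simp add: has_real_derivative_iff_has_vector_derivative)
  have dy: "(y has_real_derivative v t $ 1) (at t)" and dz: "(z has_real_derivative q t) (at t)" for t
    unfolding y_def z_def q_def by (intro nth sc)+
  have dv: "((\<lambda>t. v t $ 1) has_real_derivative a t $ 1) (at t)" and dq: "(q has_real_derivative q' t) (at t)" for t
    unfolding q_def q'_def by (intro nth sc)+
  have dp: "(p has_real_derivative p' t) (at t)" for t
    unfolding p_def by (rule derivative_eq_intros dz dv refl)+ (simp add: p'_def q_def algebra_simps)
  have vp: "v t $ 1 = exp (z t) * p t" for t by (simp add: p_def exp_minus)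
  have e2: "exp (- 2 * z t) = exp (- z t) * exp (- z t)" for t by (simp flip: exp_add)
  have one: "(p t)\<^sup>2 + (q t)\<^sup>2 = 1" for t
    using un[of t, folded v_def] unfolding P_metric_eq p_def q_def e2[of t, unfolded z_def] z_def by algebra
  define A where "A = (\<lambda>t. p' t - p t * q t)"
  define B where "B = (\<lambda>t. q' t + (p t)\<^sup>2)"
  have AB: "(A t)\<^sup>2 + (B t)\<^sup>2 = c\<^sup>2" for t
  proof -
    define \<alpha> where "\<alpha> = covariant_deriv P_metric UNIV \<gamma> v 1 t"
    have 1: "\<alpha> $ 1 = a t $ 1 - 2 * v t $ 1 * v t $ 2"
      unfolding \<alpha>_def covariant_deriv_P by (simp add: a_def v_def)
    have 2: "\<alpha> $ 2 = a t $ 2 + exp (- 2 * z t) * v t $ 1 * v t $ 1"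
      unfolding \<alpha>_def covariant_deriv_P by (simp add: a_def v_def z_def)
    have "exp (- z t) * \<alpha> $ 1 = A t" unfolding 1 A_def p'_def p_def q_def by (simp add: algebra_simps)
    moreover have "\<alpha> $ 2 = B t" unfolding 2 B_def q'_def p_def e2 by (simp add: power2_eq_square)
    moreover have "P_metric (\<gamma> t) \<alpha> \<alpha> = c\<^sup>2"
    proof -
      have x: "x = c\<^sup>2" if "sqrt x = c" for x :: real
      proof -
        have "sqrt x > 0" using that c by simp
        then have "x > 0" by simp
        then show ?thesis using real_sqrt_pow2[of x] that by simp
      qed
      have "sqrt (P_metric (\<gamma> t) \<alpha> \<alpha>) = c" using cu[of t] unfolding \<alpha>_def v_def .
      then show ?thesis by (rule x)
    qed
    moreover have "P_metric (\<gamma> t) \<alpha> \<alpha> = (exp (- z t) * \<alpha> $ 1)\<^sup>2 + (\<alpha> $ 2)\<^sup>2"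
      unfolding P_metric_eq e2[of t, unfolded z_def] z_def by algebra
    ultimately show ?thesis by simp
  qed
  have orth: "p t * A t + q t * B t = 0" for t
  proof -
    have "((\<lambda>t. (p t)\<^sup>2 + (q t)\<^sup>2) has_real_derivative 2 * (p t * p' t + q t * q' t)) (at t)"
      by (auto intro!: derivative_eq_intros dp dq)
    moreover have "((\<lambda>t. (p t)\<^sup>2 + (q t)\<^sup>2) has_real_derivative 0) (at t)" by (simp add: one)
    ultimately have "p t * p' t + q t * q' t = 0" using DERIV_unique by fastforce
    then show ?thesis unfolding A_def B_def by algebra
  qed
  \<comment> \<open>the geodesic curvature with its sign; it is continuous with values \<open>c\<close> and \<open>- c\<close>, hence constant\<close>
  define \<kappa> where "\<kappa> = (\<lambda>t. p t * B t - q t * A t)"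
  have \<kappa>2: "(\<kappa> t)\<^sup>2 = c\<^sup>2" for t
  proof -
    have "(\<kappa> t)\<^sup>2 = ((p t)\<^sup>2 + (q t)\<^sup>2) * ((A t)\<^sup>2 + (B t)\<^sup>2) - (p t * A t + q t * B t)\<^sup>2"
      unfolding \<kappa>_def by algebra
    then show ?thesis by (simp add: one AB orth)
  qed
  have cont: "continuous_on UNIV h" if "\<And>t. (h has_real_derivative h' t) (at t)" for h h' :: "real \<Rightarrow> real"
    using that DERIV_isCont by (metis continuous_at_imp_continuous_on)
  have "continuous_on UNIV \<kappa>"
    unfolding \<kappa>_def A_def B_def p'_def q'_def
    by (intro continuous_intros cont[OF dp] cont[OF dq] cont[OF dz] cont[OF dv] sc(3) cont[OF dq, unfolded q_def])
  moreover have "finite (range \<kappa>)"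
  proof (rule finite_subset)
    show "range \<kappa> \<subseteq> {c, -c}" using \<kappa>2 by (auto simp: power2_eq_iff)
  qed simp
  ultimately have "\<kappa> constant_on UNIV" using continuous_finite_range_constant[of UNIV \<kappa>] by simp
  then obtain k where k: "\<And>t. \<kappa> t = k" by (auto simp: constant_on_def)
  have AB': "A t = - q t * k" "B t = p t * k" for t
  proof -
    have "A t = ((p t)\<^sup>2 + (q t)\<^sup>2) * A t" by (simp add: one)
    also have "\<dots> = p t * (p t * A t + q t * B t) - q t * \<kappa> t" unfolding \<kappa>_def by algebra
    finally show "A t = - q t * k" by (simp add: orth k)
    have "B t = ((p t)\<^sup>2 + (q t)\<^sup>2) * B t" by (simp add: one)
    also have "\<dots> = q t * (p t * A t + q t * B t) + p t * \<kappa> t" unfolding \<kappa>_def by algebra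
    finally show "B t = p t * k" by (simp add: orth k)
  qed
  have p'eq: "p' t = - q t * (k - p t)" and q'eq: "q' t = p t * (k - p t)" for t
    using AB'[of t] unfolding A_def B_def by (simp_all add: algebra_simps power2_eq_square)
  define \<epsilon> where "\<epsilon> = k / c"
  have \<epsilon>: "\<epsilon> = 1 \<or> \<epsilon> = -1" "k = \<epsilon> * c" "\<epsilon> * \<epsilon> = 1"
    using \<kappa>2[of 0] c by (auto simp: k \<epsilon>_def power2_eq_iff)
  have ple: "\<bar>p t\<bar> \<le> 1" for t
    using one[of t] by (metis abs_le_square_iff abs_one le_add_same_cancel1 one_power2 zero_le_power2)
  have den: "c - \<epsilon> * p t > 0" "\<bar>k - p t\<bar> \<ge> c - 1" for t
    using ple[of t] \<epsilon>(1) c \<epsilon>(2) by (auto simp: abs_le_iff)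
  have kp: "k - p t = \<epsilon> * (c - \<epsilon> * p t)" for t using \<epsilon>(2,3) by (simp add: algebra_simps flip: mult.assoc)
  have const: "\<exists>r. \<forall>t. h t = r" if "\<And>t. (h has_real_derivative 0) (at t)" for h :: "real \<Rightarrow> real"
    using that has_field_derivative_zero_constant[of UNIV h] by auto
  \<comment> \<open>the first integrals: the radius and the \<open>y\<close>-coordinate of the centre\<close>
  have "\<exists>r. \<forall>t. exp (z t) / (c - \<epsilon> * p t) = r"
  proof (rule const)
    fix t
    have "((\<lambda>t. exp (z t) / (c - \<epsilon> * p t)) has_real_derivative
       (exp (z t) * q t * (c - \<epsilon> * p t) - exp (z t) * (- (\<epsilon> * p' t))) / ((c - \<epsilon> * p t) * (c - \<epsilon> * p t))) (at t)"
      using den(1)[of t] by (auto intro!: derivative_eq_intros dz dp)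
    moreover have "exp (z t) * q t * (c - \<epsilon> * p t) - exp (z t) * (- (\<epsilon> * p' t)) = exp (z t) * q t * (c - \<epsilon> * p t) * (1 - \<epsilon> * \<epsilon>)"
      unfolding p'eq kp by algebra
    ultimately show "((\<lambda>t. exp (z t) / (c - \<epsilon> * p t)) has_real_derivative 0) (at t)" by (simp add: \<epsilon>(3))
  qed
  then obtain R where R: "\<And>t. exp (z t) / (c - \<epsilon> * p t) = R" by blast
  have Rpos: "R > 0" using R[of 0] den(1)[of 0] by (metis divide_pos_pos exp_gt_zero)
  have ez: "exp (z t) = R * (c - \<epsilon> * p t)" for t using R[of t] den(1)[of t] by (simp add: field_simps)
  have "\<exists>r. \<forall>t. y t - R * (\<epsilon> * q t) = r"
  proof (rule const)
    fix t
    have "((\<lambda>t. y t - R * (\<epsilon> * q t)) has_real_derivative (v t $ 1 - R * (\<epsilon> * q' t))) (at t)"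
      by (auto intro!: derivative_eq_intros dy dq)
    moreover have "v t $ 1 - R * (\<epsilon> * q' t) = R * p t * (c - \<epsilon> * p t) * (1 - \<epsilon> * \<epsilon>)"
      unfolding vp q'eq kp ez by algebra
    ultimately show "((\<lambda>t. y t - R * (\<epsilon> * q t)) has_real_derivative 0) (at t)" by (simp add: \<epsilon>(3))
  qed
  then obtain Y where Y: "\<And>t. y t - R * (\<epsilon> * q t) = Y" by blast
  have pt: "P_incl (\<gamma> t) = horo c Y R \<theta>" if "\<epsilon> * p t = cos \<theta>" "\<epsilon> * q t = sin \<theta>" for t \<theta>
  proof -
    have "y t = Y + R * sin \<theta>" using Y[of t] that by simp
    moreover have "z t = ln (R * (c - cos \<theta>))" using ez[of t] that by (metis ln_exp)
    ultimately show ?thesis by (simp add: P_incl_def horo_def y_def z_def)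
  qed
  have eone: "(\<epsilon> * p t)\<^sup>2 + (\<epsilon> * q t)\<^sup>2 = 1" for t
    using one[of t] \<epsilon>(1) by auto
  have "\<Gamma> = range (horo c Y R)"
  proof (intro equalityI subsetI)
    fix x assume "x \<in> \<Gamma>"
    then obtain t where t: "x = P_incl (\<gamma> t)" using \<Gamma> by auto
    obtain \<theta> where "\<epsilon> * p t = cos \<theta>" "\<epsilon> * q t = sin \<theta>" using sincos_total_2pi[OF eone[of t]] by metis
    then show "x \<in> range (horo c Y R)" using t pt by auto
  next
    fix x assume "x \<in> range (horo c Y R)"
    then obtain \<theta> where \<theta>: "x = horo c Y R \<theta>" by auto
    have "\<exists>t. \<epsilon> * p t = cos \<theta> \<and> \<epsilon> * q t = sin \<theta>"
    proof (rule unit_circle_surj[where \<omega> = "\<lambda>t. k - p t" and m = "c - 1"])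
      show "((\<lambda>t. \<epsilon> * p t) has_real_derivative - (\<epsilon> * q t * (k - p t))) (at t)" for t
        using DERIV_cmult[OF dp[of t], of \<epsilon>] by (simp add: p'eq mult.assoc)
      show "((\<lambda>t. \<epsilon> * q t) has_real_derivative \<epsilon> * p t * (k - p t)) (at t)" for t
        using DERIV_cmult[OF dq[of t], of \<epsilon>] by (simp add: q'eq mult.assoc)
    qed (use eone den(2) c in \<open>auto intro!: continuous_intros cont[OF dp]\<close>)
    then obtain t where "\<epsilon> * p t = cos \<theta>" "\<epsilon> * q t = sin \<theta>" by (elim exE conjE)
    from pt[OF this] \<theta> have "x = P_incl (\<gamma> t)" by simp
    then show "x \<in> \<Gamma>" unfolding \<Gamma> by (intro image_eqI[of _ _ "\<gamma> t"]) auto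
  qed
  with Rpos show ?thesis by blast
qed

section \<open>Surfaces of constant mean curvature in Sol\<close>

text \<open>Coordinates of a tangent vector in the left-invariant orthonormal frame.\<close>

definition frame :: "real^3 \<Rightarrow> real^3 \<Rightarrow> real^3" where
  "frame p v = vector [exp (p$3) * v$1, exp (- p$3) * v$2, v$3]"

lemma exp_double: "exp (2 * x) = exp x * exp x" "exp (- 2 * x) = exp (- x) * exp (- x)" for x :: real
  by (simp_all flip: exp_add)

lemma inner_3: "x \<bullet> y = x$1 * y$1 + x$2 * y$2 + x$3 * y$3" for x y :: "real^3"
  by (simp add: inner_vec_def sum_3)

lemma sol_metric_frame: "sol_metric p v w = frame p v \<bullet> frame p w"
  unfolding sol_metric_def inner_3 frame_def exp_double by (simp add: algebra_simps)

lemma linear_frame: "linear (frame p)"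
  by (rule linearI) (simp_all add: frame_def vec_eq_iff forall_3 algebra_simps)

lemma frame_eq_0 [simp]: "frame p v = 0 \<longleftrightarrow> v = 0"
  by (simp add: frame_def vec_eq_iff forall_3)

lemma cross_parallel_normal:
  assumes "n \<bullet> n = 1" "x \<bullet> n = 0" "y \<bullet> n = 0"
  shows "cross3 x y = (cross3 x y \<bullet> n) *\<^sub>R n"
proof -
  have "cross3 n (cross3 x y) = 0"
    using assms by (simp add: Lagrange inner_commute)
  then have "cross3 n (cross3 n (cross3 x y)) = 0" by simp
  then show ?thesis using assms Lagrange[of n n "cross3 x y"] by (simp add: inner_commute)
qed

text \<open>If \<open>b\<^sub>i\<close> is the derivative of the unit normal \<open>n\<close> in the direction of the tangent vector
  \<open>a\<^sub>i\<close>, this says that the derivative of the area element under a unit parallel displacement is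
  \<open>- 2 H\<close> times the area element. All the cross products are multiples of \<open>n\<close>, so it is enough to
  compare inner products with \<open>a\<^sub>1 \<times> a\<^sub>2\<close>.\<close>

lemma weingarten_cross:
  assumes n: "n \<bullet> n = 1" and a: "a1 \<bullet> n = 0" "a2 \<bullet> n = 0" and b: "b1 \<bullet> n = 0" "b2 \<bullet> n = 0"
    and nz: "cross3 a1 a2 \<noteq> 0"
    and H: "(b1 \<bullet> a1) * (a2 \<bullet> a2) - (b1 \<bullet> a2) * (a2 \<bullet> a1) + (a1 \<bullet> a1) * (b2 \<bullet> a2) - (a1 \<bullet> a2) * (b2 \<bullet> a1)
      = - 2 * H * ((a1 \<bullet> a1) * (a2 \<bullet> a2) - (a1 \<bullet> a2) * (a2 \<bullet> a1))"
  shows "cross3 b1 a2 + cross3 a1 b2 = (- 2 * H) *\<^sub>R cross3 a1 a2"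
proof -
  define X where "X = cross3 b1 a2 + cross3 a1 b2"
  define Y where "Y = cross3 a1 a2"
  have X: "X = (X \<bullet> n) *\<^sub>R n"
    using cross_parallel_normal[OF n b(1) a(2)] cross_parallel_normal[OF n a(1) b(2)]
    unfolding X_def by (metis inner_add_left scaleR_left.add)
  have Y: "Y = (Y \<bullet> n) *\<^sub>R n" using cross_parallel_normal[OF n a] unfolding Y_def .
  have XY: "x \<bullet> Y = (x \<bullet> n) * (Y \<bullet> n)" for x by (subst Y) simp
  have y: "Y \<bullet> n \<noteq> 0" using Y nz unfolding Y_def by auto
  have "X \<bullet> Y = - 2 * H * (Y \<bullet> Y)"
    unfolding X_def Y_def inner_add_left dot_cross using H by (simp add: inner_commute)
  then have "(X \<bullet> n) * (Y \<bullet> n) = (- 2 * H * (Y \<bullet> n)) * (Y \<bullet> n)" by (simp add: XY)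
  then have "X \<bullet> n = - 2 * H * (Y \<bullet> n)" by (rule mult_right_cancel[OF y, THEN iffD1])
  then show ?thesis using X Y unfolding X_def[symmetric] Y_def[symmetric] by (metis scaleR_scaleR)
qed

lemma trace_matrix_inv_2:
  fixes I B :: "real^2^2"
  assumes d: "I$1$1 * I$2$2 - I$1$2 * I$2$1 \<noteq> 0"
  shows "trace (matrix_inv I ** B) * (I$1$1 * I$2$2 - I$1$2 * I$2$1)
    = I$2$2 * B$1$1 - I$1$2 * B$2$1 - I$2$1 * B$1$2 + I$1$1 * B$2$2"
proof -
  define D where "D = I$1$1 * I$2$2 - I$1$2 * I$2$1"
  define J :: "real^2^2" where "J = vector [vector [I$2$2 / D, - I$1$2 / D], vector [- I$2$1 / D, I$1$1 / D]]"
  have D: "D \<noteq> 0" using d by (simp add: D_def)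
  have "matrix_inv I = J"
  proof (rule matrix_inv_eqI)
    show "I ** J = mat 1" "J ** I = mat 1"
      using D by (simp_all add: J_def matrix_matrix_mult_def mat_def vec_eq_iff forall_2 sum_2 field_simps)
        (simp_all add: D_def algebra_simps)
  qed
  then show ?thesis using D
    by (simp add: trace_def sum_2 matrix_matrix_mult_def J_def field_simps flip: D_def)
qed

text \<open>The Levi-Civita connection is compatible with the metric.\<close>

lemma has_derivative_sol_metric:
  assumes F: "(F has_derivative F') (at u within S)" and V: "(V has_derivative V') (at u within S)"
    and W: "(W has_derivative W') (at u within S)"
  shows "((\<lambda>u. sol_metric (F u) (V u) (W u)) has_derivative
    (\<lambda>e. sol_metric (F u) (V' e + sol_Gamma (F u) (F' e) (V u)) (W u)
       + sol_metric (F u) (V u) (W' e + sol_Gamma (F u) (F' e) (W u)))) (at u within S)"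
proof -
  note nth = bounded_linear.has_derivative[OF bounded_linear_vec_nth]
  show ?thesis unfolding sol_metric_def
    by (rule derivative_eq_intros nth[OF F] nth[OF V] nth[OF W] refl)+
      (rule ext, simp add: sol_Gamma_def algebra_simps)
qed

locale cmc_patch =
  fixes S :: "(real^2) set" and F N :: "real^2 \<Rightarrow> real^3" and H :: real
  assumes S: "relopen S" and F: "smooth_on S F"
    and immersed: "\<And>u. u \<in> S \<Longrightarrow> inj (\<lambda>e. deriv_along S F e u)"
    and normal: "unit_normal_field S F N"
    and cmc: "\<And>u. u \<in> S \<Longrightarrow> mean_curvature S F N u = H"
begin

text \<open>The differential of the immersion and the covariant derivative of the normal, in the orthonormal
  frame.\<close>

definition tang :: "real^2 \<Rightarrow> real^2 \<Rightarrow> real^3" where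
  "tang u e = frame (F u) (deriv_along S F e u)"
definition wein :: "real^2 \<Rightarrow> real^2 \<Rightarrow> real^3" where
  "wein u e = frame (F u) (deriv_along S N e u + sol_Gamma (F u) (deriv_along S F e u) (N u))"

lemma N: "smooth_on S N" using normal by (simp add: unit_normal_field_def)

lemma F_has_derivative: "u \<in> S \<Longrightarrow> (F has_derivative (\<lambda>e. deriv_along S F e u)) (at u within S)"
  by (intro has_derivative_along smooth_on_differentiable S F)

lemma N_has_derivative: "u \<in> S \<Longrightarrow> (N has_derivative (\<lambda>e. deriv_along S N e u)) (at u within S)"
  by (intro has_derivative_along smooth_on_differentiable S N)

lemma dF_has_derivative: "u \<in> S \<Longrightarrow>
    (deriv_along S F e has_derivative (\<lambda>e'. deriv_along S (deriv_along S F e) e' u)) (at u within S)"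
  by (intro has_derivative_along smooth_on_differentiable S smooth_on_deriv_along F)

lemma linear_dF: "u \<in> S \<Longrightarrow> linear (\<lambda>e. deriv_along S F e u)"
  using F_has_derivative has_derivative_linear by blast

lemma linear_dN: "u \<in> S \<Longrightarrow> linear (\<lambda>e. deriv_along S N e u)"
  using N_has_derivative has_derivative_linear by blast

lemma linear_tang: "u \<in> S \<Longrightarrow> linear (tang u)"
  unfolding tang_def using linear_compose[OF linear_dF linear_frame] by (simp add: o_def)

lemma linear_wein:
  assumes u: "u \<in> S" shows "linear (wein u)"
proof -
  have "linear (\<lambda>v. sol_Gamma (F u) v (N u))"
    by (rule linearI) (simp_all add: sol_Gamma_def vec_eq_iff forall_3 algebra_simps)
  from linear_compose_add[OF linear_dN[OF u] linear_compose[OF linear_dF[OF u] this]] show ?thesis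
    unfolding wein_def using linear_compose[OF _ linear_frame] by (fastforce simp: o_def)
qed

lemma normal_unit: "u \<in> S \<Longrightarrow> frame (F u) (N u) \<bullet> frame (F u) (N u) = 1"
  using normal by (simp add: unit_normal_field_def sol_metric_frame)

lemma tang_normal: "u \<in> S \<Longrightarrow> tang u e \<bullet> frame (F u) (N u) = 0"
  using normal by (simp add: unit_normal_field_def sol_metric_frame tang_def)

lemma wein_normal:
  assumes u: "u \<in> S" shows "wein u e \<bullet> frame (F u) (N u) = 0"
proof -
  let ?d = "\<lambda>e. sol_metric (F u) (deriv_along S N e u + sol_Gamma (F u) (deriv_along S F e u) (N u)) (N u)
       + sol_metric (F u) (N u) (deriv_along S N e u + sol_Gamma (F u) (deriv_along S F e u) (N u))"
  have d: "((\<lambda>u. sol_metric (F u) (N u) (N u)) has_derivative ?d) (at u within S)"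
    by (intro has_derivative_sol_metric F_has_derivative N_has_derivative u)
  have "deriv_along S (\<lambda>u. sol_metric (F u) (N u) (N u)) e u = deriv_along S (\<lambda>_. 1) e u"
    using normal by (intro deriv_along_cong(2)[OF S u, of UNIV]) (auto simp: unit_normal_field_def)
  also have "\<dots> = 0" by (rule deriv_along_eq[OF S u]) auto
  finally have "?d e = 0" using deriv_along_eq[OF S u d] by simp
  then show ?thesis by (simp add: sol_metric_frame wein_def inner_commute)
qed

text \<open>Differentiate the orthogonality of \<open>N\<close> to the tangent vectors (Weingarten's equation).\<close>

lemma second_form_wein:
  assumes u: "u \<in> S"
  shows "second_form S F N u $ i $ j = - (wein u (axis i 1) \<bullet> tang u (axis j 1))"
proof -
  let ?e = "axis i 1" and ?V = "deriv_along S F (axis j 1)"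
  let ?d = "\<lambda>e. sol_metric (F u) (deriv_along S ?V e u + sol_Gamma (F u) (deriv_along S F e u) (?V u)) (N u)
       + sol_metric (F u) (?V u) (deriv_along S N e u + sol_Gamma (F u) (deriv_along S F e u) (N u))"
  have d: "((\<lambda>u. sol_metric (F u) (?V u) (N u)) has_derivative ?d) (at u within S)"
    by (intro has_derivative_sol_metric F_has_derivative dF_has_derivative N_has_derivative u)
  have "deriv_along S (\<lambda>u. sol_metric (F u) (?V u) (N u)) ?e u = deriv_along S (\<lambda>_. 0) ?e u"
    using normal by (intro deriv_along_cong(2)[OF S u, of UNIV]) (auto simp: unit_normal_field_def)
  also have "\<dots> = 0" by (rule deriv_along_eq[OF S u]) auto
  finally have "?d ?e = 0" using deriv_along_eq[OF S u d] by simp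
  moreover have "second_form S F N u $ i $ j =
    sol_metric (F u) (deriv_along S ?V ?e u + sol_Gamma (F u) (deriv_along S F ?e u) (?V u)) (N u)"
    by (simp add: second_form_def covariant_deriv_sol)
  moreover have "sol_metric (F u) (?V u) (deriv_along S N ?e u + sol_Gamma (F u) (deriv_along S F ?e u) (N u))
    = wein u ?e \<bullet> tang u (axis j 1)"
    by (simp add: sol_metric_frame wein_def tang_def inner_commute)
  ultimately show ?thesis by simp
qed

lemma first_form_tang: "first_form S F u $ i $ j = tang u (axis i 1) \<bullet> tang u (axis j 1)"
  by (simp add: first_form_def sol_metric_frame tang_def)

lemma cross_tang_nonzero:
  assumes u: "u \<in> S" shows "cross3 (tang u E1) (tang u E2) \<noteq> 0"
proof
  let ?a = "tang u E1" and ?b = "tang u E2"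
  have zero: "e = 0" if "tang u e = 0" for e
  proof -
    have "deriv_along S F e u = deriv_along S F 0 u"
      using that linear_0[OF linear_dF[OF u]] by (simp add: tang_def)
    then show ?thesis using immersed[OF u] by (meson injD)
  qed
  have b: "?b \<noteq> 0" using zero[of E2] by (auto simp: axis_eq_0_iff)
  assume 0: "cross3 ?a ?b = 0"
  have "cross3 ?b (cross3 ?a ?b) = (?b \<bullet> ?b) *\<^sub>R ?a - (?b \<bullet> ?a) *\<^sub>R ?b" by (simp add: Lagrange)
  also have "\<dots> = tang u ((?b \<bullet> ?b) *\<^sub>R E1 - (?b \<bullet> ?a) *\<^sub>R E2)"
    by (simp add: linear_diff[OF linear_tang[OF u]] linear_scale[OF linear_tang[OF u]])
  finally have "tang u ((?b \<bullet> ?b) *\<^sub>R E1 - (?b \<bullet> ?a) *\<^sub>R E2) = 0" unfolding 0 by simp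
  from zero[OF this] have "(?b \<bullet> ?b) *\<^sub>R E1 - (?b \<bullet> ?a) *\<^sub>R E2 = 0" .
  then have "?b \<bullet> ?b = 0" by (auto simp: vec_eq_iff forall_2 axis_def)
  with b show False by simp
qed

lemma wein_cross_E:
  assumes u: "u \<in> S"
  shows "cross3 (wein u E1) (tang u E2) + cross3 (tang u E1) (wein u E2)
    = (- 2 * H) *\<^sub>R cross3 (tang u E1) (tang u E2)"
proof (rule weingarten_cross[OF normal_unit[OF u] tang_normal[OF u] tang_normal[OF u]
      wein_normal[OF u] wein_normal[OF u] cross_tang_nonzero[OF u]])
  let ?a = "tang u E1" and ?b = "tang u E2"
  let ?I = "first_form S F u" and ?B = "second_form S F N u"
  have "(?a \<bullet> ?a) * (?b \<bullet> ?b) - (?a \<bullet> ?b) * (?b \<bullet> ?a) = cross3 ?a ?b \<bullet> cross3 ?a ?b" by (simp add: dot_cross)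
  then have "(?a \<bullet> ?a) * (?b \<bullet> ?b) - (?a \<bullet> ?b) * (?b \<bullet> ?a) \<noteq> 0" using cross_tang_nonzero[OF u] by simp
  then have "?I$1$1 * ?I$2$2 - ?I$1$2 * ?I$2$1 \<noteq> 0" by (simp add: first_form_tang)
  from trace_matrix_inv_2[OF this, of ?B] cmc[OF u]
  have "2 * H * (?I$1$1 * ?I$2$2 - ?I$1$2 * ?I$2$1)
    = ?I$2$2 * ?B$1$1 - ?I$1$2 * ?B$2$1 - ?I$2$1 * ?B$1$2 + ?I$1$1 * ?B$2$2"
    by (simp add: mean_curvature_def)
  then have "- 2 * H * ((?a \<bullet> ?a) * (?b \<bullet> ?b) - (?a \<bullet> ?b) * (?b \<bullet> ?a)) =
      - ((?b \<bullet> ?b) * - (wein u E1 \<bullet> ?a) - (?a \<bullet> ?b) * - (wein u E2 \<bullet> ?a)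
        - (?b \<bullet> ?a) * - (wein u E1 \<bullet> ?b) + (?a \<bullet> ?a) * - (wein u E2 \<bullet> ?b))"
    unfolding first_form_tang second_form_wein[OF u] by linarith
  also have "\<dots> = (wein u E1 \<bullet> ?a) * (?b \<bullet> ?b) - (wein u E1 \<bullet> ?b) * (?b \<bullet> ?a) + (?a \<bullet> ?a) * (wein u E2 \<bullet> ?b)
      - (?a \<bullet> ?b) * (wein u E2 \<bullet> ?a)" by algebra
  finally show "(wein u E1 \<bullet> ?a) * (?b \<bullet> ?b) - (wein u E1 \<bullet> ?b) * (?b \<bullet> ?a) + (?a \<bullet> ?a) * (wein u E2 \<bullet> ?b)
      - (?a \<bullet> ?b) * (wein u E2 \<bullet> ?a) = - 2 * H * ((?a \<bullet> ?a) * (?b \<bullet> ?b) - (?a \<bullet> ?b) * (?b \<bullet> ?a))" by simp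
qed

text \<open>Both sides are alternating and bilinear in \<open>P\<close> and \<open>Q\<close>, and the plane has dimension two.\<close>

lemma alternating_2:
  assumes "linear w" "linear t"
  shows "cross3 (w P) (t Q) + cross3 (t P) (w Q) =
    (P$1 * Q$2 - P$2 * Q$1) *\<^sub>R (cross3 (w E1) (t E2) + cross3 (t E1) (w E2))"
  unfolding linear_vec2[OF assms(1), of P] linear_vec2[OF assms(1), of Q]
    linear_vec2[OF assms(2), of P] linear_vec2[OF assms(2), of Q]
  by (simp add: vec_eq_iff forall_3 cross3_def algebra_simps)

lemma wein_cross:
  assumes u: "u \<in> S"
  shows "cross3 (wein u P) (tang u Q) + cross3 (tang u P) (wein u Q)
    = (- 2 * H * (P$1 * Q$2 - P$2 * Q$1)) *\<^sub>R cross3 (tang u E1) (tang u E2)"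
  using alternating_2[OF linear_wein[OF u] linear_tang[OF u], of P Q] wein_cross_E[OF u]
  by (simp add: mult.commute)

lemma cross_tang:
  assumes u: "u \<in> S"
  shows "cross3 (tang u P) (tang u Q) = (P$1 * Q$2 - P$2 * Q$1) *\<^sub>R cross3 (tang u E1) (tang u E2)"
proof -
  have "(2::real) *\<^sub>R cross3 (tang u P) (tang u Q) =
      2 *\<^sub>R ((P$1 * Q$2 - P$2 * Q$1) *\<^sub>R cross3 (tang u E1) (tang u E2))"
    using alternating_2[OF linear_tang[OF u] linear_tang[OF u], of P Q]
    by (simp only: scaleR_2 scaleR_add_right)
  then show ?thesis by (rule scaleR_left_imp_eq[rotated]) simp
qed

end

text \<open>The flux form. Its first part is the conormal flux of the Killing field \<open>\<partial>\<^sub>x\<close>; the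
  second is \<open>2 H\<close> times a primitive of \<open>dy \<and> dz\<close>, which is the volume form contracted with that
  field. Adding an exact form to \<open>(y - Y) dz\<close> makes the primitive a positive multiple of the
  angular form everywhere on the circle, not only on average.\<close>

definition prim :: "real \<Rightarrow> real \<Rightarrow> real \<Rightarrow> real^3 \<Rightarrow> real^3 \<Rightarrow> real" where
  "prim c Y R p w = (p$2 - Y) * w$3
     + ((c - exp (p$3) / R) * w$2 - (p$2 - Y) * (exp (p$3) / R) * w$3) / (2 * (c + 1))"

definition flux :: "real \<Rightarrow> real \<Rightarrow> real \<Rightarrow> real \<Rightarrow> real^3 \<Rightarrow> real^3 \<Rightarrow> real^3 \<Rightarrow> real" where
  "flux c Y R H p n w = n$2 * w$3 - n$3 * w$2 + 2 * H * prim c Y R p w"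

lemma linear_flux: "linear (flux c Y R H p n)"
  by (rule linearI) (simp_all add: flux_def prim_def divide_inverse algebra_simps)

lemma has_derivative_flux:
  assumes F: "(F has_derivative F') (at u within S)" and N: "(N has_derivative N') (at u within S)"
    and V: "(V has_derivative V') (at u within S)"
  shows "((\<lambda>u. flux c Y R H (F u) (N u) (V u)) has_derivative
    (\<lambda>e. flux c Y R H (F u) (N u) (V' e) + N' e $ 2 * V u $ 3 - N' e $ 3 * V u $ 2
      + 2 * H * (F' e $ 2 * V u $ 3
        + (- (exp (F u $ 3) / R) * (F' e $ 3 * V u $ 2 + F' e $ 2 * V u $ 3)
           - (F u $ 2 - Y) * (exp (F u $ 3) / R) * F' e $ 3 * V u $ 3) / (2 * (c + 1))))) (at u within S)"
proof -
  note nth = bounded_linear.has_derivative[OF bounded_linear_vec_nth]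
  show ?thesis unfolding flux_def prim_def divide_inverse
    by (rule derivative_eq_intros nth[OF F] nth[OF N] nth[OF V] refl)+
      (rule ext, simp add: algebra_simps)
qed

context cmc_patch
begin

lemma continuous_on_components:
  "continuous_on S (\<lambda>u. F u $ i)" "continuous_on S (\<lambda>u. N u $ i)"
  "continuous_on S (\<lambda>u. deriv_along S F e u $ i)" "continuous_on S (\<lambda>u. deriv_along S N e u $ i)"
  "continuous_on S (\<lambda>u. deriv_along S (deriv_along S F e) e' u $ i)"
  by (intro continuous_on_component smooth_on_imp_continuous_on smooth_on_deriv_along S F N)+

lemma C1_on_flux: "C1_on S (\<lambda>u. flux c Y R H (F u) (N u) (deriv_along S F e u))"
  by (rule C1_onI[OF S has_derivative_flux[OF F_has_derivative N_has_derivative dF_has_derivative]])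
    (auto simp: flux_def prim_def divide_inverse intro!: continuous_intros continuous_on_components)

text \<open>The first component of \<open>wein_cross_E\<close> is, up to a factor \<open>exp z\<close>, the exterior derivative of
  the conormal flux of \<open>\<partial>\<^sub>x\<close>, because the second derivatives of \<open>F\<close> are symmetric. The mean
  curvature term is cancelled by the derivative of the primitive.\<close>

lemma flux_closed:
  assumes u: "u \<in> S"
  shows "deriv_along S (\<lambda>u. flux c Y R H (F u) (N u) (deriv_along S F E2 u)) E1 u
       = deriv_along S (\<lambda>u. flux c Y R H (F u) (N u) (deriv_along S F E1 u)) E2 u"
proof -
  note d = deriv_along_eq[OF S u has_derivative_flux[OF F_has_derivative[OF u] N_has_derivative[OF u] dF_has_derivative[OF u]]]
  define a where "a = deriv_along S F E1 u"
  define b where "b = deriv_along S F E2 u"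
  define m where "m = deriv_along S N E1 u"
  define n where "n = deriv_along S N E2 u"
  define E where "E = exp (F u $ 3)"
  define E' where "E' = exp (- F u $ 3)"
  have EE: "E * E' = 1" by (simp add: E_def E'_def flip: exp_add)
  have sym: "deriv_along S (deriv_along S F E1) E2 u = deriv_along S (deriv_along S F E2) E1 u"
    by (rule deriv_along_swap[OF S F u])
  have o: "E * E * a$1 * N u$1 + E' * E' * a$2 * N u$2 + a$3 * N u$3 = 0"
      "E * E * b$1 * N u$1 + E' * E' * b$2 * N u$2 + b$3 * N u$3 = 0"
    using tang_normal[OF u, of E1] tang_normal[OF u, of E2]
    by (simp_all add: tang_def frame_def inner_3 a_def b_def E_def E'_def algebra_simps)
  have weq: "E' * ((m$2 - (a$2 * N u$3 + a$3 * N u$2)) * b$3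
        - (m$3 + (E' * E' * a$2 * N u$2 - E * E * a$1 * N u$1)) * b$2
        + a$2 * (n$3 + (E' * E' * b$2 * N u$2 - E * E * b$1 * N u$1))
        - a$3 * (n$2 - (b$2 * N u$3 + b$3 * N u$2))) = E' * (- 2 * H * (a$2 * b$3 - a$3 * b$2))"
    using arg_cong[OF wein_cross_E[OF u], of "\<lambda>x. x $ 1"]
    by (simp add: cross3_def wein_def tang_def frame_def sol_Gamma_def a_def b_def m_def n_def
        E_def E'_def exp_double algebra_simps)
  have nz: "E' \<noteq> 0" using EE by auto
  have w: "(m$2 - (a$2 * N u$3 + a$3 * N u$2)) * b$3
        - (m$3 + (E' * E' * a$2 * N u$2 - E * E * a$1 * N u$1)) * b$2
        + a$2 * (n$3 + (E' * E' * b$2 * N u$2 - E * E * b$1 * N u$1))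
        - a$3 * (n$2 - (b$2 * N u$3 + b$3 * N u$2)) = - 2 * H * (a$2 * b$3 - a$3 * b$2)"
    by (rule mult_left_cancel[OF nz, THEN iffD1, OF weq])
  \<comment> \<open>the Christoffel terms cancel because the field \<open>\<partial>\<^sub>x\<close> is Killing\<close>
  have key: "m$2 * b$3 - m$3 * b$2 - n$2 * a$3 + n$3 * a$2 + 2 * H * (a$2 * b$3 - a$3 * b$2) = 0"
    using w o by algebra
  show ?thesis unfolding d sym a_def[symmetric] b_def[symmetric] m_def[symmetric] n_def[symmetric]
    using key by (simp add: algebra_simps)
qed

end

text \<open>On the circle \<open>horo c Y R\<close> this is \<open>d\<theta>\<close>.\<close>

definition ang :: "real \<Rightarrow> real \<Rightarrow> real \<Rightarrow> real^3 \<Rightarrow> real^3 \<Rightarrow> real" where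
  "ang c Y R p w = ((c - exp (p$3) / R) * w$2 + (p$2 - Y) * (exp (p$3) / R) * w$3) / R"

lemma linear_ang: "linear (ang c Y R p)"
  by (rule linearI) (simp_all add: ang_def divide_inverse algebra_simps)

text \<open>On the circle the conormal flux of \<open>\<partial>\<^sub>x\<close> is at most \<open>R\<close> per unit of angle, while the primitive
  is at least \<open>R / (2 (c + 1))\<close>. If \<open>\<bar>H\<bar> > c + 1\<close> the second term decides the sign.\<close>

lemma sgn_flux:
  assumes c: "c > 1" and R: "R > 0" and H: "\<bar>H\<bar> > c + 1"
    and n: "sol_metric (horo c Y R \<theta>) n n = 1"
    and w: "w$1 = 0" "sin \<theta> * w$2 = R * cos \<theta> * (c - cos \<theta>) * w$3" "w \<noteq> 0"
  shows "ang c Y R (horo c Y R \<theta>) w \<noteq> 0"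
    and "sgn (flux c Y R H (horo c Y R \<theta>) n w) = sgn H * sgn (ang c Y R (horo c Y R \<theta>) w)"
proof -
  let ?p = "horo c Y R \<theta>"
  define k where "k = c - cos \<theta>"
  have k: "k > 0" "k \<le> c + 1" using le_less_trans[OF cos_le_one[of \<theta>] c] cos_ge_minus_one[of \<theta>] unfolding k_def by linarith+
  have p3: "exp (?p$3) = R * k" using R k by (simp add: horo_def k_def)
  have p2: "?p$2 - Y = R * sin \<theta>" by (simp add: horo_def)
  define \<mu> where "\<mu> = cos \<theta> * w$2 / R + sin \<theta> * k * w$3"
  have ang: "ang c Y R ?p w = \<mu>"
    using R unfolding ang_def p3 p2 \<mu>_def by (simp add: field_simps k_def)
  have cs: "cos \<theta> * cos \<theta> + sin \<theta> * sin \<theta> = 1" by (simp flip: power2_eq_square)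
  have w2: "w$2 = \<mu> * R * cos \<theta>"
  proof -
    have "\<mu> * R * cos \<theta> = cos \<theta> * cos \<theta> * w$2 + sin \<theta> * (R * cos \<theta> * k * w$3)"
      using R by (simp add: \<mu>_def field_simps)
    also have "R * cos \<theta> * k * w$3 = sin \<theta> * w$2" using w(2) by (simp add: k_def)
    also have "cos \<theta> * cos \<theta> * w$2 + sin \<theta> * (sin \<theta> * w$2) = (cos \<theta> * cos \<theta> + sin \<theta> * sin \<theta>) * w$2"
      by algebra
    finally show ?thesis by (simp add: cs)
  qed
  have w3: "k * w$3 = \<mu> * sin \<theta>"
  proof -
    have "R * (\<mu> * sin \<theta>) = cos \<theta> * (sin \<theta> * w$2) + sin \<theta> * sin \<theta> * (R * k * w$3)"
      using R by (simp add: \<mu>_def field_simps)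
    also have "sin \<theta> * w$2 = cos \<theta> * (R * k * w$3)" using w(2) by (simp add: k_def)
    also have "cos \<theta> * (cos \<theta> * (R * k * w$3)) + sin \<theta> * sin \<theta> * (R * k * w$3)
        = (cos \<theta> * cos \<theta> + sin \<theta> * sin \<theta>) * (R * k * w$3)" by algebra
    finally show ?thesis using R by (simp add: cs)
  qed
  show "ang c Y R ?p w \<noteq> 0"
  proof
    assume "ang c Y R ?p w = 0"
    then have "w$2 = 0" "w$3 = 0" using w2 w3 k by (simp_all add: ang)
    then show False using w by (simp add: vec_eq_iff forall_3)
  qed
  have w3': "w$3 = \<mu> * sin \<theta> / k" using w3 k by (simp add: field_simps)
  \<comment> \<open>\<open>R m\<close> and \<open>R L\<close> are the conormal flux and the primitive per unit of angle\<close>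
  define m where "m = n$2 / (R * k) * sin \<theta> - n$3 * cos \<theta>"
  have m: "\<bar>m\<bar> \<le> 1"
  proof -
    have "exp (- 2 * ?p$3) = 1 / (R * k)\<^sup>2"
      by (simp add: exp_double exp_minus p3[simplified] power2_eq_square divide_inverse)
    then have "(n$2 / (R * k))\<^sup>2 + (n$3)\<^sup>2 \<le> 1"
      using n by (simp add: sol_metric_def power2_eq_square)
        (smt (verit) exp_ge_zero mult_nonneg_nonneg zero_le_square mult.assoc)
    moreover have "m\<^sup>2 + (n$2 / (R * k) * cos \<theta> + n$3 * sin \<theta>)\<^sup>2 = ((n$2 / (R * k))\<^sup>2 + (n$3)\<^sup>2) * (cos \<theta> * cos \<theta> + sin \<theta> * sin \<theta>)"
      unfolding m_def by algebra
    moreover have "x \<le> 1" if "B \<le> 1" "x + q\<^sup>2 = B * 1" for x q B :: real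
      using that zero_le_power2[of q] by linarith
    ultimately have "m\<^sup>2 \<le> 1" unfolding cs by blast
    then show ?thesis by (simp add: abs_square_le_1)
  qed
  define L where "L = sin \<theta> * sin \<theta> / k + (cos \<theta> * cos \<theta> - sin \<theta> * sin \<theta>) / (2 * (c + 1))"
  have L: "L \<ge> 1 / (2 * (c + 1))"
  proof -
    have "sin \<theta> * sin \<theta> / k \<ge> sin \<theta> * sin \<theta> / (c + 1)"
      using k by (intro divide_left_mono) auto
    also have "sin \<theta> * sin \<theta> / (c + 1) = 2 * (sin \<theta> * sin \<theta>) / (2 * (c + 1))"
      using c by (simp add: divide_simps)
    finally have "L \<ge> (2 * (sin \<theta> * sin \<theta>) + (cos \<theta> * cos \<theta> - sin \<theta> * sin \<theta>)) / (2 * (c + 1))"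
      unfolding L_def add_divide_distrib by simp
    then show ?thesis using cs by (simp add: algebra_simps)
  qed
  have fl: "flux c Y R H ?p n w = \<mu> * R * (m + 2 * H * L)"
  proof -
    have "n$2 * w$3 - n$3 * w$2 = \<mu> * R * m"
      using R k unfolding w2 w3' m_def by (simp add: field_simps)
    moreover have "prim c Y R ?p w = \<mu> * R * L"
      using R k unfolding prim_def p2 p3 w2 w3' L_def by (simp add: k_def[symmetric] field_simps) (simp add: k_def algebra_simps)
    ultimately show ?thesis unfolding flux_def by (simp add: algebra_simps)
  qed
  have "sgn (m + 2 * H * L) = sgn H"
  proof -
    have "\<bar>H\<bar> * (2 * L) > 1"
    proof -
      have "1 = (c + 1) * (2 * (1 / (2 * (c + 1))))" using c by simp
      also have "\<dots> \<le> (c + 1) * (2 * L)" using L c by (intro mult_left_mono) auto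
      also have "\<dots> < \<bar>H\<bar> * (2 * L)"
      proof -
        have "L > 0" using L c by (smt (verit) divide_pos_pos)
        then show ?thesis using H by simp
      qed
      finally show ?thesis .
    qed
    then show ?thesis using m by (cases "H > 0") (auto simp: sgn_if abs_if algebra_simps split: if_splits)
  qed
  then show "sgn (flux c Y R H ?p n w) = sgn H * sgn (ang c Y R ?p w)"
    unfolding fl ang sgn_mult using R by simp
qed

section \<open>Normals and the flux form in overlapping charts\<close>

context cmc_patch
begin

text \<open>The sign of \<open>ori\<close> compares the orientation of the parameter plane with the normal.\<close>

definition ori :: "real^2 \<Rightarrow> real" where
  "ori u = cross3 (tang u E1) (tang u E2) \<bullet> frame (F u) (N u)"

lemma cross_tang_ori:
  "u \<in> S \<Longrightarrow> cross3 (tang u E1) (tang u E2) = ori u *\<^sub>R frame (F u) (N u)"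
  unfolding ori_def by (intro cross_parallel_normal normal_unit tang_normal)

lemma ori_nonzero: "u \<in> S \<Longrightarrow> ori u \<noteq> 0"
  using cross_tang_nonzero cross_tang_ori by fastforce

lemma continuous_on_ori: "continuous_on S ori"
  unfolding ori_def tang_def frame_def cross3_def inner_3
  by (auto intro!: continuous_intros continuous_on_components)

end

lemma sgn_locally_constant:
  fixes h :: "'a::metric_space \<Rightarrow> real"
  assumes h: "continuous_on S h" and u: "u \<in> S" "h u \<noteq> 0"
  shows "\<exists>r>0. \<forall>v\<in>S. dist v u < r \<longrightarrow> sgn (h v) = sgn (h u)"
proof -
  have "\<bar>h u\<bar> > 0" using u by simp
  then obtain r where r: "r > 0" "\<forall>v\<in>S. dist v u < r \<longrightarrow> dist (h v) (h u) < \<bar>h u\<bar>"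
    using h u(1) unfolding continuous_on_iff by blast
  have "sgn (h v) = sgn (h u)" if "v \<in> S" "dist v u < r" for v
  proof -
    have "\<bar>h v - h u\<bar> < \<bar>h u\<bar>" using r(2) that by (auto simp: dist_real_def)
    then show ?thesis by (auto simp: sgn_if abs_if split: if_splits)
  qed
  with r(1) show ?thesis by blast
qed

context cmc_patch
begin

text \<open>The sign factor is locally constant, so it does not affect derivatives.\<close>

lemma
  shows C1_on_signed_flux:
      "C1_on S (\<lambda>u. k * sgn (ori u) * flux c Y R H (F u) (N u) (deriv_along S F e u))" (is "C1_on S ?g")
    and deriv_along_signed_flux: "u \<in> S \<Longrightarrow>
      deriv_along S (\<lambda>u. k * sgn (ori u) * flux c Y R H (F u) (N u) (deriv_along S F e u)) e' u
       = k * sgn (ori u) * deriv_along S (\<lambda>u. flux c Y R H (F u) (N u) (deriv_along S F e u)) e' u"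
proof -
  let ?f = "\<lambda>u. flux c Y R H (F u) (N u) (deriv_along S F e u)"
  have near: "\<exists>r>0. \<forall>v\<in>S \<inter> ball u r. ?g v = (k * sgn (ori u)) * ?f v" if u: "u \<in> S" for u
  proof -
    obtain r where "r > 0" "\<forall>v\<in>S. dist v u < r \<longrightarrow> sgn (ori v) = sgn (ori u)"
      using sgn_locally_constant[OF continuous_on_ori u ori_nonzero[OF u]] by auto
    then show ?thesis by (intro exI[of _ r]) (auto simp: dist_commute)
  qed
  show "C1_on S ?g"
  proof (rule C1_on_local[OF S])
    fix u assume u: "u \<in> S"
    obtain r where r: "r > 0" "\<forall>v\<in>S \<inter> ball u r. ?g v = (k * sgn (ori u)) * ?f v" using near[OF u] by auto
    have T: "openin (top_of_set S) (S \<inter> ball u r)" by (simp add: openin_open_Int)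
    then have T': "relopen (S \<inter> ball u r)" using S openin_trans by blast
    have "C1_on (S \<inter> ball u r) (\<lambda>v. (k * sgn (ori u)) * ?f v)"
      by (intro C1_on_mult[OF T'] C1_on_const[OF T'] C1_on_subset[OF S T C1_on_flux])
    then show "\<exists>T h. openin (top_of_set S) T \<and> u \<in> T \<and> C1_on T h \<and> (\<forall>x\<in>T. ?g x = h x)"
      using T r u by (intro exI[of _ "S \<inter> ball u r"] exI[of _ "\<lambda>v. (k * sgn (ori u)) * ?f v"]) simp
  qed
  show "deriv_along S ?g e' u = k * sgn (ori u) * deriv_along S ?f e' u" if u: "u \<in> S"
  proof -
    obtain r where r: "r > 0" "\<forall>v\<in>S \<inter> ball u r. ?g v = (k * sgn (ori u)) * ?f v" using near[OF u] by auto
    have "deriv_along S ?g e' u = deriv_along S (\<lambda>v. (k * sgn (ori u)) * ?f v) e' u"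
      using r by (intro deriv_along_cong(2)[OF S u open_ball[of u r]]) auto
    also have "\<dots> = k * sgn (ori u) * deriv_along S ?f e' u"
    proof -
      have z: "deriv_along S (\<lambda>_. k * sgn (ori u)) e' u = 0" by (rule deriv_along_eq[OF S u]) auto
      show ?thesis
        using deriv_along_mult[OF S C1_on_const[OF S, of "k * sgn (ori u)"] C1_on_flux u, of c Y R e e'] by (simp add: z)
    qed
    finally show ?thesis .
  qed
qed

end

text \<open>For \<open>H \<noteq> 0\<close> the sign of the mean curvature singles out one of the two unit normals.\<close>

locale cmc_surface = surface X A for X :: "'a topology" and A +
  fixes f :: "'a \<Rightarrow> real^3" and H :: real
  assumes immersion: "immersion A f" and cmc: "constant_mean_curvature A f H" and H: "H \<noteq> 0"
begin

definition surf :: "'a chart \<Rightarrow> real^2 \<Rightarrow> real^3" where "surf a u = f (par a u)"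

definition nrm :: "'a chart \<Rightarrow> real^2 \<Rightarrow> real^3" where
  "nrm a = (SOME N. unit_normal_field (img a) (surf a) N \<and> (\<forall>u\<in>img a. mean_curvature (img a) (surf a) N u = H))"

abbreviation dsurf :: "'a chart \<Rightarrow> real^2 \<Rightarrow> real^2 \<Rightarrow> real^3" where
  "dsurf a u e \<equiv> deriv_along (img a) (surf a) e u"

abbreviation side :: "'a chart \<Rightarrow> real^2 \<Rightarrow> real" where
  "side a \<equiv> cmc_patch.ori (img a) (surf a) (nrm a)"

lemma surf_eq: "surf a = f \<circ> inv_into (fst a) (snd a)"
  by (rule ext) (simp add: surf_def par_def)

lemma patch:
  assumes a: "a \<in> A" shows "cmc_patch (img a) (surf a) (nrm a) H"
proof -
  have "\<exists>N. unit_normal_field (img a) (surf a) N \<and> (\<forall>u\<in>img a. mean_curvature (img a) (surf a) N u = H)"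
    using cmc a unfolding constant_mean_curvature_def surf_eq img_def
    by (auto simp: Let_def case_prod_unfold)
  from someI_ex[OF this] have "unit_normal_field (img a) (surf a) (nrm a)"
    "\<forall>u\<in>img a. mean_curvature (img a) (surf a) (nrm a) u = H" unfolding nrm_def by simp_all
  moreover have "smooth_on (img a) (surf a)" "\<forall>u\<in>img a. inj (\<lambda>e. deriv_along (img a) (surf a) e u)"
    using immersion a unfolding immersion_def surf_eq img_def
    by (auto simp: Let_def case_prod_unfold)
  ultimately show ?thesis using chart(2)[OF a] by (intro cmc_patch.intro) auto
qed

lemma C1_on_surf: "a \<in> A \<Longrightarrow> C1_on (img a) (surf a)"
  using cmc_patch.F[OF patch] smooth_on_imp_C1_on chart(2) by blast

lemma C1_on_nrm: "a \<in> A \<Longrightarrow> C1_on (img a) (nrm a)"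
  using cmc_patch.N[OF patch] smooth_on_imp_C1_on chart(2) by blast

lemma surf_trans: "a \<in> A \<Longrightarrow> b \<in> A \<Longrightarrow> u \<in> overlap a b \<Longrightarrow> surf b (transition a b u) = surf a u"
  by (simp add: surf_def par_trans)

lemma dsurf_trans:
  assumes "a \<in> A" "b \<in> A" "u \<in> overlap a b"
  shows "dsurf a u e = dsurf b (transition a b u) (dtrans a b u e)"
  using deriv_along_par[OF assms, of f e] C1_on_surf[OF assms(2)] unfolding surf_def by simp

lemma tang_trans:
  assumes "a \<in> A" "b \<in> A" "u \<in> overlap a b"
  shows "cmc_patch.tang (img a) (surf a) u e = cmc_patch.tang (img b) (surf b) (transition a b u) (dtrans a b u e)"
  unfolding cmc_patch.tang_def[OF patch[OF assms(1)]] cmc_patch.tang_def[OF patch[OF assms(2)]]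
    dsurf_trans[OF assms] surf_trans[OF assms] ..

text \<open>Two unit normals agree up to sign. If they were opposite at some point, they would be
  opposite nearby, and the mean curvature would be both \<open>H\<close> and \<open>- H\<close> there.\<close>

lemma nrm_trans:
  assumes ab: "a \<in> A" "b \<in> A" and u: "u \<in> overlap a b"
  shows "nrm b (transition a b u) = nrm a u"
proof -
  interpret a: cmc_patch "img a" "surf a" "nrm a" H by (rule patch[OF ab(1)])
  interpret b: cmc_patch "img b" "surf b" "nrm b" H by (rule patch[OF ab(2)])
  have ina: "v \<in> img a" and inb: "transition a b v \<in> img b" if "v \<in> overlap a b" for v
    using that overlap_subset[OF ab(1)] overlap_subset[OF ab(2)] transition_in[OF ab] by blast+
  have pm: "nrm b (transition a b v) = nrm a v \<or> nrm b (transition a b v) = - nrm a v" if v: "v \<in> overlap a b" for v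
  proof -
    let ?p = "surf a v" and ?a = "a.tang v E1" and ?b = "a.tang v E2"
    define n where "n = frame ?p (nrm a v)"
    define m where "m = frame ?p (nrm b (transition a b v))"
    have n: "n \<bullet> n = 1" "?a \<bullet> n = 0" "?b \<bullet> n = 0"
      unfolding n_def by (intro a.normal_unit a.tang_normal ina v)+
    have m: "m \<bullet> m = 1" "?a \<bullet> m = 0" "?b \<bullet> m = 0"
      using b.normal_unit[OF inb[OF v]] b.tang_normal[OF inb[OF v]]
      unfolding m_def tang_trans[OF ab v] surf_trans[OF ab v] by simp_all
    define Y where "Y = cross3 ?a ?b"
    have Yn: "Y = (Y \<bullet> n) *\<^sub>R n" and Ym: "Y = (Y \<bullet> m) *\<^sub>R m"
      unfolding Y_def using cross_parallel_normal[OF n] cross_parallel_normal[OF m] by simp_all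
    have Y0: "Y \<noteq> 0" unfolding Y_def by (rule a.cross_tang_nonzero[OF ina[OF v]])
    have "Y \<bullet> m \<noteq> 0" using Ym Y0 by auto
    then have k: "m = ((Y \<bullet> n) / (Y \<bullet> m)) *\<^sub>R n"
      using Yn Ym by (metis (no_types, lifting) divide_inverse mult.commute scaleR_scaleR scaleR_one left_inverse)
    then have "((Y \<bullet> n) / (Y \<bullet> m))\<^sup>2 = 1" using m(1) n(1) by (metis inner_scaleR_left inner_scaleR_right mult.right_neutral power2_eq_square)
    then have "m = n \<or> m = - n" using k by (auto simp: power2_eq_1_iff)
    then have "frame ?p (nrm b (transition a b v) - nrm a v) = 0 \<or> frame ?p (nrm b (transition a b v) + nrm a v) = 0"
      unfolding m_def n_def by (auto simp: linear_diff[OF linear_frame] linear_add[OF linear_frame])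
    then show ?thesis by (auto simp: eq_neg_iff_add_eq_0)
  qed
  show ?thesis
  proof (rule ccontr)
    assume "nrm b (transition a b u) \<noteq> nrm a u"
    then have opp: "nrm b (transition a b u) = - nrm a u" using pm[OF u] by blast
    let ?h = "\<lambda>v. sol_metric (surf a v) (nrm a v) (nrm b (transition a b v))"
    have unit: "sol_metric (surf a v) (nrm a v) (nrm a v) = 1" if "v \<in> overlap a b" for v
      using a.normal_unit[OF ina[OF that]] by (simp add: sol_metric_frame)
    have "continuous_on (overlap a b) ?h"
    proof -
      have "continuous_on (overlap a b) (surf a)" "continuous_on (overlap a b) (nrm a)"
        using C1_on_imp_continuous_on[OF C1_on_surf[OF ab(1)]] C1_on_imp_continuous_on[OF C1_on_nrm[OF ab(1)]]
          overlap_subset[OF ab(1)] continuous_on_subset by blast+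
      moreover have "continuous_on (overlap a b) (\<lambda>v. nrm b (transition a b v))"
        using inb by (intro continuous_on_compose2[OF C1_on_imp_continuous_on[OF C1_on_nrm[OF ab(2)]]
              C1_on_imp_continuous_on[OF C1_on_trans[OF ab]]]) blast
      ultimately show ?thesis unfolding sol_metric_def
        by (intro continuous_intros continuous_on_component)
    qed
    moreover have hu: "?h u = -1" using opp unit[OF u] by (simp add: sol_metric_def)
    ultimately obtain r where r: "r > 0" "\<forall>v\<in>overlap a b. dist v u < r \<longrightarrow> sgn (?h v) = sgn (?h u)"
      using sgn_locally_constant[of "overlap a b" ?h u] u by auto
    have opp': "nrm b (transition a b v) = - nrm a v" if "v \<in> overlap a b \<inter> ball u r" for v
    proof (rule ccontr)
      assume "nrm b (transition a b v) \<noteq> - nrm a v"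
      then have "?h v = 1" using pm[of v] unit[of v] that by auto
      then show False using r(2) hu that by (auto simp: dist_commute)
    qed
    have dn: "deriv_along (img b) (nrm b) (dtrans a b u e) (transition a b u) = - deriv_along (img a) (nrm a) e u" for e
    proof -
      have "deriv_along (img b) (nrm b) (dtrans a b u e) (transition a b u)
          = deriv_along (overlap a b) (\<lambda>v. nrm b (transition a b v)) e u"
        using inb by (intro deriv_along_compose[OF overlap_open(2)[OF ab] chart(2)[OF ab(2)] C1_on_trans[OF ab] _
              C1_on_nrm[OF ab(2)] u, symmetric]) blast
      also have "\<dots> = deriv_along (overlap a b) (\<lambda>v. - nrm a v) e u"
        using opp' r(1) by (intro deriv_along_cong(2)[OF overlap_open(2)[OF ab] u open_ball[of u r]]) auto
      also have "\<dots> = - deriv_along (img a) (nrm a) e u"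
        using has_derivative_minus[OF a.N_has_derivative[OF ina[OF u]]] at_within_openin[OF overlap_open(1)[OF ab] u]
        by (intro deriv_along_eq[OF overlap_open(2)[OF ab] u]) simp
      finally show ?thesis .
    qed
    let ?v = "transition a b u"
    let ?P = "dtrans a b u E1" and ?Q = "dtrans a b u E2"
    have w: "b.wein ?v (dtrans a b u e) = - a.wein u e" for e
    proof -
      have "b.wein ?v (dtrans a b u e) = frame (surf a u) (- deriv_along (img a) (nrm a) e u + sol_Gamma (surf a u) (dsurf a u e) (- nrm a u))"
        by (simp add: b.wein_def dn surf_trans[OF ab u] opp flip: dsurf_trans[OF ab u])
      also have "\<dots> = - a.wein u e"
        by (simp add: a.wein_def frame_def sol_Gamma_def vec_eq_iff forall_3 algebra_simps)
      finally show ?thesis .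
    qed
    have t: "b.tang ?v (dtrans a b u e) = a.tang u e" for e using tang_trans[OF ab u] by simp
    have "cross3 (b.wein ?v ?P) (b.tang ?v ?Q) + cross3 (b.tang ?v ?P) (b.wein ?v ?Q)
       = (- 2 * H) *\<^sub>R cross3 (b.tang ?v ?P) (b.tang ?v ?Q)"
      unfolding b.wein_cross[OF inb[OF u]] b.cross_tang[OF inb[OF u], of ?P ?Q] by simp
    then have "- (cross3 (a.wein u E1) (a.tang u E2) + cross3 (a.tang u E1) (a.wein u E2))
        = (- 2 * H) *\<^sub>R cross3 (a.tang u E1) (a.tang u E2)"
      unfolding w t by simp
    then have "(4 * H) *\<^sub>R cross3 (a.tang u E1) (a.tang u E2) = 0"
      unfolding a.wein_cross_E[OF ina[OF u]] by (simp add: vec_eq_iff)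
    then show False using H a.cross_tang_nonzero[OF ina[OF u]] by simp
  qed
qed

lemma sgn_side_trans:
  assumes ab: "a \<in> A" "b \<in> A" and u: "u \<in> overlap a b"
  shows "sgn (side a u) = sgn (jac a b u) * sgn (side b (transition a b u))"
proof -
  interpret a: cmc_patch "img a" "surf a" "nrm a" H by (rule patch[OF ab(1)])
  interpret b: cmc_patch "img b" "surf b" "nrm b" H by (rule patch[OF ab(2)])
  have v: "transition a b u \<in> img b" using transition_in[OF ab u] overlap_subset[OF ab(2)] by blast
  have "side a u = jac a b u * side b (transition a b u)"
    unfolding a.ori_def b.ori_def tang_trans[OF ab u] b.cross_tang[OF v, of "dtrans a b u E1"]
      surf_trans[OF ab u] nrm_trans[OF ab u] jac_def by simp
  then show ?thesis by (simp add: sgn_mult)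
qed

text \<open>In charts of opposite orientation the flux form has the same values; the factor \<open>sgn (side a u)\<close>
  makes it change its sign, as a twisted form must.\<close>

definition flux_form :: "real \<Rightarrow> real \<Rightarrow> real \<Rightarrow> real \<Rightarrow> 'a chart \<Rightarrow> real^2 \<Rightarrow> real^2 \<Rightarrow> real" where
  "flux_form k c Y R a u e = k * sgn (side a u) * flux c Y R H (surf a u) (nrm a u) (dsurf a u e)"

lemma twisted_form_flux_form:
  assumes "compact_space X" shows "twisted_form X A (flux_form k c Y R)"
proof (intro twisted_form.intro twisted_form_axioms.intro surface_axioms assms)
  fix a u assume a: "a \<in> A" and u: "u \<in> img a"
  interpret a: cmc_patch "img a" "surf a" "nrm a" H by (rule patch[OF a])
  have "linear (\<lambda>e. flux c Y R H (surf a u) (nrm a u) (dsurf a u e))"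
    using linear_compose[OF a.linear_dF[OF u] linear_flux] by (simp add: o_def)
  then show "linear (flux_form k c Y R a u)"
    unfolding flux_form_def by (simp add: linear_iff algebra_simps)
  show "deriv_along (img a) (\<lambda>u. flux_form k c Y R a u E2) E1 u = deriv_along (img a) (\<lambda>u. flux_form k c Y R a u E1) E2 u"
    unfolding flux_form_def a.deriv_along_signed_flux[OF u] a.flux_closed[OF u] ..
next
  fix a e assume a: "a \<in> A"
  interpret a: cmc_patch "img a" "surf a" "nrm a" H by (rule patch[OF a])
  show "C1_on (img a) (\<lambda>u. flux_form k c Y R a u e)"
    unfolding flux_form_def by (rule a.C1_on_signed_flux)
next
  fix a b u e assume ab: "a \<in> A" "b \<in> A" and u: "u \<in> overlap a b"
  show "flux_form k c Y R a u e = sgn (jac a b u) * flux_form k c Y R b (transition a b u) (dtrans a b u e)"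
    unfolding flux_form_def sgn_side_trans[OF ab u] surf_trans[OF ab u] nrm_trans[OF ab u]
      dsurf_trans[OF ab u, symmetric] by simp
qed

end

section \<open>The boundary circle\<close>

lemma relopen_boundary_line:
  assumes S: "relopen S" and u: "u \<in> S" "u$2 = 0"
  shows "\<exists>\<delta>>0. \<forall>x. \<bar>x\<bar> < \<delta> \<longrightarrow> u + x *\<^sub>R E1 \<in> S \<and> (u + x *\<^sub>R E1)$2 = 0"
proof -
  obtain W where W: "open W" "S = half_plane \<inter> W" using S by (auto simp: openin_open)
  then obtain r where r: "r > 0" "ball u r \<subseteq> W" using u open_contains_ball by blast
  have "u + x *\<^sub>R E1 \<in> S \<and> (u + x *\<^sub>R E1)$2 = 0" if "\<bar>x\<bar> < r" for x
  proof -
    have "u + x *\<^sub>R E1 \<in> ball u r" using that by (simp add: dist_norm)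
    moreover have "(u + x *\<^sub>R E1)$2 = 0" using u(2) by (simp add: axis_def)
    ultimately show ?thesis using W r by (auto simp: half_plane_def)
  qed
  with r(1) show ?thesis by blast
qed

lemma has_vector_derivative_boundary_line:
  assumes S: "relopen S" and u: "u \<in> S" "u$2 = 0" and g: "(g has_derivative g') (at u within S)"
  shows "((\<lambda>x. g (u + x *\<^sub>R E1)) has_vector_derivative g' E1) (at (0::real))"
proof -
  obtain \<delta> where \<delta>: "\<delta> > 0" "\<forall>x. \<bar>x\<bar> < \<delta> \<longrightarrow> u + x *\<^sub>R E1 \<in> S \<and> (u + x *\<^sub>R E1)$2 = 0"
    using relopen_boundary_line[OF S u] by blast
  let ?I = "{-\<delta><..<\<delta>}"
  have sub: "(\<lambda>x. u + x *\<^sub>R E1) ` ?I \<subseteq> S" using \<delta>(2) by auto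
  have "(g has_derivative g') (at (u + 0 *\<^sub>R E1) within (\<lambda>x. u + x *\<^sub>R E1) ` ?I)"
    using has_derivative_subset[OF g sub] by simp
  moreover have "((\<lambda>x. u + x *\<^sub>R E1) has_derivative (\<lambda>x. x *\<^sub>R E1)) (at 0 within ?I)"
    by (auto intro!: derivative_eq_intros)
  ultimately have "((\<lambda>x. g (u + x *\<^sub>R E1)) has_derivative (\<lambda>x. g' (x *\<^sub>R E1))) (at 0 within ?I)"
    using has_derivative_in_compose[of "\<lambda>x. u + x *\<^sub>R E1" "\<lambda>x. x *\<^sub>R E1" 0 ?I g g'] by blast
  moreover have "at 0 within ?I = at (0::real)" using \<delta>(1) by (intro at_within_open) auto
  ultimately show ?thesis
    by (simp add: has_vector_derivative_def linear_scale[OF has_derivative_linear[OF g]])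
qed

locale spanning_surface = cmc_surface X A f H for X :: "'a topology" and A f H +
  fixes c Y R :: real
  assumes c: "c > 1" and R: "R > 0"
    and boundary: "boundary_diffeo A f (range (horo c Y R))"
begin

lemma bij_boundary: "bij_betw f (surface_boundary A) (range (horo c Y R))"
  using boundary by (simp add: boundary_diffeo_def Let_def)

lemma boundary_iff: "p \<in> surface_boundary A \<longleftrightarrow> (\<exists>a\<in>A. p \<in> fst a \<and> snd a p $ 2 = 0)"
  by (auto simp: surface_boundary_def case_prod_unfold)

lemma par_boundary: "a \<in> A \<Longrightarrow> u \<in> img a \<Longrightarrow> u$2 = 0 \<Longrightarrow> par a u \<in> surface_boundary A"
  unfolding boundary_iff by (intro bexI[of _ a]) auto

lemma surf_boundary: "a \<in> A \<Longrightarrow> u \<in> img a \<Longrightarrow> u$2 = 0 \<Longrightarrow> surf a u \<in> range (horo c Y R)"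
  using par_boundary bij_boundary unfolding surf_def bij_betw_def by blast

lemma horo_components:
  "horo c Y R \<theta> $ 1 = 0" "horo c Y R \<theta> $ 2 = Y + R * sin \<theta>" "exp (horo c Y R \<theta> $ 3) = R * (c - cos \<theta>)"
proof -
  have "cos \<theta> < c" using le_less_trans[OF cos_le_one c] .
  then show "exp (horo c Y R \<theta> $ 3) = R * (c - cos \<theta>)" using R by (simp add: horo_def)
qed (simp_all add: horo_def)

lemma surf_line_derivative:
  assumes a: "a \<in> A" and u: "u \<in> img a" "u$2 = 0"
  shows "((\<lambda>x. surf a (u + x *\<^sub>R E1)) has_vector_derivative dsurf a u E1) (at 0)"
  by (rule has_vector_derivative_boundary_line[OF chart(2)[OF a] u C1_onD[OF C1_on_surf[OF a] u(1)]])

text \<open>Differentiate the equation of the circle along the boundary line of the chart.\<close>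

lemma boundary_tangent:
  assumes a: "a \<in> A" and u: "u \<in> img a" "u$2 = 0" and \<theta>: "surf a u = horo c Y R \<theta>"
  shows "dsurf a u E1 $ 1 = 0" "sin \<theta> * dsurf a u E1 $ 2 = R * cos \<theta> * (c - cos \<theta>) * dsurf a u E1 $ 3"
    "dsurf a u E1 \<noteq> 0"
proof -
  let ?w = "dsurf a u E1"
  let ?s = "\<lambda>x. surf a (u + x *\<^sub>R E1)"
  obtain \<delta> where \<delta>: "\<delta> > 0" "\<forall>x. \<bar>x\<bar> < \<delta> \<longrightarrow> u + x *\<^sub>R E1 \<in> img a \<and> (u + x *\<^sub>R E1)$2 = 0"
    using relopen_boundary_line[OF chart(2)[OF a] u] by blast
  have in\<Gamma>: "?s x \<in> range (horo c Y R)" if "x \<in> {-\<delta><..<\<delta>}" for x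
    using surf_boundary[OF a] \<delta>(2) that by auto
  have d: "((\<lambda>x. ?s x $ i) has_real_derivative ?w $ i) (at 0)" for i
    using bounded_linear.has_vector_derivative[OF bounded_linear_vec_nth surf_line_derivative[OF a u]]
    by (simp add: has_real_derivative_iff_has_vector_derivative)
  have const: "h' = 0" if "(h has_real_derivative h') (at 0)" "\<And>x. x \<in> {-\<delta><..<\<delta>} \<Longrightarrow> h x = k" for h h' k
  proof -
    have "((\<lambda>_. k) has_real_derivative h') (at 0)"
      by (rule has_field_derivative_transform_within_open[OF that(1), of "{-\<delta><..<\<delta>}"]) (use that(2) \<delta>(1) in auto)
    then show ?thesis using DERIV_unique[OF _ DERIV_const] by blast
  qed
  show "?w $ 1 = 0" 
  proof (rule const[OF d])
    fix x assume "x \<in> {-\<delta><..<\<delta>}"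
    then obtain t where "?s x = horo c Y R t" using in\<Gamma> by blast
    then show "?s x $ 1 = 0" by (simp add: horo_components)
  qed
  have "2 * (?s 0 $ 2 - Y) * ?w $ 2 + 2 * (exp (?s 0 $ 3) - R * c) * (exp (?s 0 $ 3) * ?w $ 3) = 0"
  proof (rule const)
    show "((\<lambda>x. (?s x $ 2 - Y)\<^sup>2 + (exp (?s x $ 3) - R * c)\<^sup>2) has_real_derivative
      2 * (?s 0 $ 2 - Y) * ?w $ 2 + 2 * (exp (?s 0 $ 3) - R * c) * (exp (?s 0 $ 3) * ?w $ 3)) (at 0)"
      by (auto intro!: derivative_eq_intros d simp: algebra_simps)
    fix x assume "x \<in> {-\<delta><..<\<delta>}"
    then obtain t where "?s x = horo c Y R t" using in\<Gamma> by blast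
    then have "(?s x $ 2 - Y)\<^sup>2 + (exp (?s x $ 3) - R * c)\<^sup>2 = (R * sin t)\<^sup>2 + (R * (c - cos t) - R * c)\<^sup>2"
      by (simp add: horo_components)
    also have "\<dots> = R\<^sup>2 * ((sin t)\<^sup>2 + (cos t)\<^sup>2)" by algebra
    finally show "(?s x $ 2 - Y)\<^sup>2 + (exp (?s x $ 3) - R * c)\<^sup>2 = R\<^sup>2" by simp
  qed
  then have "R * (sin \<theta> * ?w $ 2) = R * (R * cos \<theta> * (c - cos \<theta>) * ?w $ 3)"
    using \<theta> by (simp add: horo_components algebra_simps)
  then show "sin \<theta> * ?w $ 2 = R * cos \<theta> * (c - cos \<theta>) * ?w $ 3" using R by simp
  show "?w \<noteq> 0"
  proof
    assume "?w = 0"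
    then have "dsurf a u E1 = dsurf a u 0"
      using linear_0[OF cmc_patch.linear_dF[OF patch[OF a] u(1)]] by simp
    then have "E1 = 0" using cmc_patch.immersed[OF patch[OF a] u(1)] by (rule injD[rotated])
    then show False by (simp add: axis_eq_0_iff)
  qed
qed

abbreviation turn :: "'a chart \<Rightarrow> real^2 \<Rightarrow> real" where
  "turn a u \<equiv> ang c Y R (surf a u) (dsurf a u E1)"

lemma turn_nonzero:
  assumes a: "a \<in> A" and u: "u \<in> img a" "u$2 = 0"
  shows "turn a u \<noteq> 0"
proof -
  obtain \<theta> where \<theta>: "surf a u = horo c Y R \<theta>" using surf_boundary[OF a u] by blast
  \<comment> \<open>an instance of \<open>sgn_flux\<close> with an arbitrary mean curvature above \<open>c + 1\<close> and an arbitrary unit vector\<close>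
  have H': "\<bar>c + 2\<bar> > c + 1" using c by simp
  have "sol_metric (horo c Y R \<theta>) (axis 3 1) (axis 3 1) = 1" by (simp add: sol_metric_def axis_def)
  from sgn_flux(1)[OF c R H' this boundary_tangent[OF a u \<theta>]] show ?thesis by (simp add: \<theta>)
qed

text \<open>The sense in which the boundary of the surface, oriented by the normal, runs through the
  circle.\<close>

definition sense :: "'a chart \<Rightarrow> real^2 \<Rightarrow> real" where
  "sense a u = sgn (side a u) * sgn (turn a u)"

text \<open>At a boundary point the transition map multiplies the boundary direction by a factor with the
  sign of the Jacobian, so both signs change together.\<close>

lemma sense_trans:
  assumes ab: "a \<in> A" "b \<in> A" and p: "p \<in> fst a" "p \<in> fst b" and z: "snd a p $ 2 = 0" "snd b p $ 2 = 0"
  shows "sense a (snd a p) = sense b (snd b p)"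
proof -
  define u where "u = snd a p"
  have u: "u \<in> overlap a b" using p by (auto simp: u_def overlap_def)
  have v: "transition a b u = snd b p" using p ab by (simp add: u_def transition_def)
  have z': "u$2 = 0" "transition a b u $ 2 = 0" using z v by (auto simp: u_def)
  define P where "P = dtrans a b u E1"
  have P: "P = (P$1) *\<^sub>R E1"
    using dtrans_boundary(1)[OF ab u z'] vec2_decomp[of P] unfolding P_def by simp
  have j: "sgn (jac a b u) = sgn (P$1)" using dtrans_boundary(2)[OF ab u z'] by (simp add: P_def)
  then have P0: "P$1 \<noteq> 0" using jac_nonzero[OF ab u] by (metis sgn_0_0)
  have lin: "linear (dsurf b (transition a b u))"
    using cmc_patch.linear_dF[OF patch[OF ab(2)]] transition_in[OF ab u] overlap_subset[OF ab(2)] by blast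
  have "dsurf a u E1 = dsurf b (transition a b u) P" unfolding P_def by (rule dsurf_trans[OF ab u])
  also have "\<dots> = P$1 *\<^sub>R dsurf b (transition a b u) E1" by (subst P) (simp add: linear_scale[OF lin])
  finally have "turn a u = P$1 * turn b (transition a b u)"
    by (simp add: surf_trans[OF ab u] linear_scale[OF linear_ang])
  then have "sense a u = (sgn (P$1) * sgn (P$1)) * sense b (transition a b u)"
    unfolding sense_def sgn_side_trans[OF ab u] j by (simp add: sgn_mult)
  then show ?thesis using P0 v by (simp add: u_def sgn_if)
qed

lemma sense_locally_constant:
  assumes a: "a \<in> A" and u: "u \<in> img a" "u$2 = 0"
  shows "\<exists>\<delta>>0. \<forall>x. \<bar>x\<bar> < \<delta> \<longrightarrow> u + x *\<^sub>R E1 \<in> img a \<and> (u + x *\<^sub>R E1)$2 = 0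
    \<and> sense a (u + x *\<^sub>R E1) = sense a u"
proof -
  interpret a: cmc_patch "img a" "surf a" "nrm a" H by (rule patch[OF a])
  have "continuous_on (img a) (\<lambda>u. side a u * turn a u)"
    unfolding ang_def divide_inverse
    by (intro continuous_intros a.continuous_on_ori a.continuous_on_components)
  moreover have "side a u * turn a u \<noteq> 0" using a.ori_nonzero[OF u(1)] turn_nonzero[OF a u] by simp
  ultimately obtain r where r: "r > 0" "\<forall>v\<in>img a. dist v u < r \<longrightarrow> sgn (side a v * turn a v) = sgn (side a u * turn a u)"
    using sgn_locally_constant[of "img a" "\<lambda>u. side a u * turn a u" u] u(1) by auto
  obtain \<delta> where \<delta>: "\<delta> > 0" "\<forall>x. \<bar>x\<bar> < \<delta> \<longrightarrow> u + x *\<^sub>R E1 \<in> img a \<and> (u + x *\<^sub>R E1)$2 = 0"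
    using relopen_boundary_line[OF chart(2)[OF a] u] by blast
  have "sense a (u + x *\<^sub>R E1) = sense a u" if "\<bar>x\<bar> < min r \<delta>" for x
  proof -
    have "dist (u + x *\<^sub>R E1) u < r" using that by (simp add: dist_norm)
    then show ?thesis using r(2) \<delta>(2) that by (simp add: sense_def flip: sgn_mult)
  qed
  then show ?thesis using r(1) \<delta> by (intro exI[of _ "min r \<delta>"]) auto
qed

text \<open>The boundary line of a chart covers a neighbourhood of each of its points in the circle,
  because the angle has nonzero derivative along it.\<close>

lemma boundary_line_covers:
  assumes a: "a \<in> A" and u: "u \<in> img a" "u$2 = 0" and \<theta>: "surf a u = horo c Y R \<theta>" and \<delta>: "\<delta> > 0"
  shows "\<exists>\<epsilon>>0. \<forall>\<phi>. \<bar>\<phi> - \<theta>\<bar> < \<epsilon> \<longrightarrow> (\<exists>x. \<bar>x\<bar> < \<delta> \<and> u + x *\<^sub>R E1 \<in> img a \<and> surf a (u + x *\<^sub>R E1) = horo c Y R \<phi>)"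
proof -
  let ?s = "\<lambda>x. surf a (u + x *\<^sub>R E1)"
  \<comment> \<open>sine and cosine of the angle, and then of its difference from \<open>\<theta>\<close>\<close>
  define si where "si = (\<lambda>x. (?s x $ 2 - Y) / R)"
  define co where "co = (\<lambda>x. c - exp (?s x $ 3) / R)"
  define D where "D = (\<lambda>x. si x * cos \<theta> - co x * sin \<theta>)"
  define C where "C = (\<lambda>x. co x * cos \<theta> + si x * sin \<theta>)"
  have sico: "si x = sin t" "co x = cos t" if "?s x = horo c Y R t" for x t
    using R by (simp_all add: si_def co_def that horo_components)
  have s0: "?s 0 = horo c Y R \<theta>" using \<theta> by simp
  have cs: "cos \<theta> * cos \<theta> + sin \<theta> * sin \<theta> = 1" by (simp flip: power2_eq_square)
  have D0: "D 0 = 0" and C0: "C 0 = 1" using sico[OF s0] cs by (simp_all add: D_def C_def)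
  obtain \<delta>1 where \<delta>1: "\<delta>1 > 0" "\<forall>x. \<bar>x\<bar> < \<delta>1 \<longrightarrow> u + x *\<^sub>R E1 \<in> img a \<and> (u + x *\<^sub>R E1)$2 = 0"
    using relopen_boundary_line[OF chart(2)[OF a] u] by blast
  have cont: "isCont (\<lambda>x. ?s x $ i) x" if x: "\<bar>x\<bar> < \<delta>1" for x i
  proof -
    let ?v = "u + x *\<^sub>R E1"
    have v: "?v \<in> img a" "?v $ 2 = 0" using \<delta>1(2) x by auto
    have "((\<lambda>y. surf a (?v + y *\<^sub>R E1)) has_vector_derivative dsurf a ?v E1) (at (x - x))"
      using surf_line_derivative[OF a v] by simp
    then have "isCont (\<lambda>y. surf a (?v + y *\<^sub>R E1)) (x - x)"
      using has_vector_derivative_continuous by blast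
    then have "isCont (\<lambda>y. surf a (?v + (y - x) *\<^sub>R E1)) x"
      by (intro isCont_o2[where f = "\<lambda>y. y - x" and g = "\<lambda>y. surf a (?v + y *\<^sub>R E1)"] continuous_intros)
    then have "isCont ?s x" by (simp add: algebra_simps)
    then show ?thesis by (intro continuous_intros)
  qed
  have contD: "isCont D x" and contC: "isCont C x" if "\<bar>x\<bar> < \<delta>1" for x
    unfolding D_def C_def si_def co_def divide_inverse by (intro continuous_intros cont that)+
  have dD: "(D has_real_derivative turn a u) (at 0)"
  proof -
    have d: "((\<lambda>x. ?s x $ i) has_real_derivative dsurf a u E1 $ i) (at 0)" for i
      using bounded_linear.has_vector_derivative[OF bounded_linear_vec_nth surf_line_derivative[OF a u]]
      by (simp add: has_real_derivative_iff_has_vector_derivative)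
    have "(D has_real_derivative (dsurf a u E1 $ 2 / R * cos \<theta> + exp (?s 0 $ 3) * dsurf a u E1 $ 3 / R * sin \<theta>)) (at 0)"
      unfolding D_def si_def co_def using R by (auto intro!: derivative_eq_intros d)
    moreover have "turn a u = dsurf a u E1 $ 2 / R * cos \<theta> + exp (?s 0 $ 3) * dsurf a u E1 $ 3 / R * sin \<theta>"
      using R unfolding ang_def s0 \<theta> horo_components by (simp add: field_simps)
    ultimately show ?thesis by simp
  qed
  have "C \<midarrow>0\<rightarrow> 1" using contC[of 0] \<delta>1(1) C0 by (simp add: isCont_def)
  then obtain \<delta>2 where \<delta>2: "\<delta>2 > 0" "\<And>x. x \<noteq> 0 \<Longrightarrow> \<bar>x\<bar> < \<delta>2 \<Longrightarrow> C x > 0"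
    using order_tendstoD(1)[of C 1 "at 0" 0] unfolding eventually_at by (auto simp: dist_real_def)
  have Cpos: "C x > 0" if "\<bar>x\<bar> < \<delta>2" for x using \<delta>2(2) C0 that by (cases "x = 0") auto
  define \<delta>3 where "\<delta>3 = min \<delta> (min \<delta>1 \<delta>2)"
  have \<delta>3: "\<delta>3 > 0" using \<delta> \<delta>1 \<delta>2 by (simp add: \<delta>3_def)
  define \<sigma> where "\<sigma> = sgn (turn a u)"
  have \<sigma>: "\<sigma> * \<sigma> = 1" "\<bar>\<sigma>\<bar> = 1" using turn_nonzero[OF a u] by (auto simp: \<sigma>_def sgn_if)
  have "((\<lambda>x. \<sigma> * D x) has_real_derivative \<sigma> * turn a u) (at 0)" by (intro DERIV_cmult dD)
  moreover have "\<sigma> * turn a u > 0" using turn_nonzero[OF a u] by (auto simp: \<sigma>_def sgn_if)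
  ultimately obtain e1 e2 where e: "e1 > 0" "\<And>h. h > 0 \<Longrightarrow> h < e1 \<Longrightarrow> \<sigma> * D 0 < \<sigma> * D (0 + h)"
      "e2 > 0" "\<And>h. h > 0 \<Longrightarrow> h < e2 \<Longrightarrow> \<sigma> * D (0 - h) < \<sigma> * D 0"
    using DERIV_pos_inc_right DERIV_pos_inc_left by metis
  define h where "h = min \<delta>3 (min e1 e2) / 2"
  have h: "h > 0" "h < \<delta>3" "h < e1" "h < e2" using \<delta>3 e by (auto simp: h_def)
  define lo where "lo = min (\<sigma> * D h) (- (\<sigma> * D (- h)))"
  have lo: "lo > 0" using e(2)[of h] e(4)[of h] h D0 by (simp add: lo_def)
  have hit: "\<exists>x. \<bar>x\<bar> \<le> h \<and> D x = y" if y: "\<bar>y\<bar> < lo" for y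
  proof -
    have "\<exists>x\<ge>-h. x \<le> h \<and> \<sigma> * D x = \<sigma> * y"
    proof (rule IVT)
      have "\<bar>\<sigma> * y\<bar> < lo" using y \<sigma>(2) by (simp add: abs_mult)
      then show "\<sigma> * D (- h) \<le> \<sigma> * y" "\<sigma> * y \<le> \<sigma> * D h" unfolding lo_def by linarith+
      show "\<forall>x. - h \<le> x \<and> x \<le> h \<longrightarrow> isCont (\<lambda>x. \<sigma> * D x) x"
        using h(2) by (auto simp: \<delta>3_def intro!: continuous_intros contD)
    qed (use h in simp)
    then obtain x where x: "- h \<le> x" "x \<le> h" "\<sigma> * D x = \<sigma> * y" by blast
    then have "\<sigma> * \<sigma> * D x = \<sigma> * \<sigma> * y" by (simp only: mult.assoc)
    then show ?thesis using x \<sigma>(1) by (intro exI[of _ x]) auto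
  qed
  have "((\<lambda>\<phi>. sin (\<phi> - \<theta>)) \<longlongrightarrow> sin (\<theta> - \<theta>)) (at \<theta>)" "((\<lambda>\<phi>. cos (\<phi> - \<theta>)) \<longlongrightarrow> cos (\<theta> - \<theta>)) (at \<theta>)"
    by (intro tendsto_intros)+
  then have "\<forall>\<^sub>F \<phi> in at \<theta>. dist (sin (\<phi> - \<theta>)) 0 < lo" "\<forall>\<^sub>F \<phi> in at \<theta>. cos (\<phi> - \<theta>) > 0"
    using lo tendstoD order_tendstoD(1)[of "\<lambda>\<phi>. cos (\<phi> - \<theta>)" 1 "at \<theta>" 0] by fastforce+
  then have "\<forall>\<^sub>F \<phi> in at \<theta>. \<bar>sin (\<phi> - \<theta>)\<bar> < lo \<and> cos (\<phi> - \<theta>) > 0"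
    by eventually_elim (simp add: dist_real_def)
  then obtain \<epsilon> where \<epsilon>: "\<epsilon> > 0" "\<And>\<phi>. \<phi> \<noteq> \<theta> \<Longrightarrow> \<bar>\<phi> - \<theta>\<bar> < \<epsilon> \<Longrightarrow> \<bar>sin (\<phi> - \<theta>)\<bar> < lo \<and> cos (\<phi> - \<theta>) > 0"
    unfolding eventually_at by (auto simp: dist_real_def)
  have near: "\<bar>sin (\<phi> - \<theta>)\<bar> < lo \<and> cos (\<phi> - \<theta>) > 0" if "\<bar>\<phi> - \<theta>\<bar> < \<epsilon>" for \<phi>
    using \<epsilon>(2) lo that by (cases "\<phi> = \<theta>") auto
  have "\<exists>x. \<bar>x\<bar> < \<delta> \<and> u + x *\<^sub>R E1 \<in> img a \<and> ?s x = horo c Y R \<phi>" if \<phi>: "\<bar>\<phi> - \<theta>\<bar> < \<epsilon>" for \<phi>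
  proof -
    obtain x where x: "\<bar>x\<bar> \<le> h" "D x = sin (\<phi> - \<theta>)" using hit near[OF \<phi>] by blast
    have x': "\<bar>x\<bar> < \<delta>" "\<bar>x\<bar> < \<delta>1" "\<bar>x\<bar> < \<delta>2" using x(1) h(2) by (auto simp: \<delta>3_def)
    have v: "u + x *\<^sub>R E1 \<in> img a" "(u + x *\<^sub>R E1)$2 = 0" using \<delta>1(2) x'(2) by auto
    obtain t where t: "?s x = horo c Y R t" using surf_boundary[OF a v] by blast
    have "sin (t - \<theta>) = sin (\<phi> - \<theta>)" using x(2) sico[OF t] by (simp add: D_def sin_diff)
    moreover have "cos (t - \<theta>) > 0" using Cpos[OF x'(3)] sico[OF t] by (simp add: C_def cos_diff)
    moreover have "cos (\<phi> - \<theta>) > 0" using near[OF \<phi>] by blast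
    moreover have "(cos (t - \<theta>))\<^sup>2 = (cos (\<phi> - \<theta>))\<^sup>2" unfolding cos_squared_eq calculation(1) ..
    ultimately have sc: "sin (t - \<theta>) = sin (\<phi> - \<theta>)" "cos (t - \<theta>) = cos (\<phi> - \<theta>)"
      by (simp_all add: power2_eq_imp_eq less_imp_le)
    have "sin ((t - \<theta>) + \<theta>) = sin ((\<phi> - \<theta>) + \<theta>)" "cos ((t - \<theta>) + \<theta>) = cos ((\<phi> - \<theta>) + \<theta>)"
      unfolding sin_add cos_add sc by simp_all
    then have "horo c Y R t = horo c Y R \<phi>" by (simp add: horo_def)
    then show ?thesis using x' v t by (intro exI[of _ x]) auto
  qed
  with \<epsilon>(1) show ?thesis by blast
qed

text \<open>The sense is a function on the boundary, hence on the circle. It is locally constant there, and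
  lifted to the angle it is a continuous function on the connected line with values \<open>1\<close> and \<open>- 1\<close>.\<close>

lemma sense_constant:
  "\<exists>k. k * k = 1 \<and> (\<forall>a\<in>A. \<forall>u\<in>img a. u$2 = 0 \<longrightarrow> sense a u = k)"
proof -
  define ch where "ch = (\<lambda>p. SOME a. a \<in> A \<and> p \<in> fst a \<and> snd a p $ 2 = 0)"
  have ch: "ch p \<in> A" "p \<in> fst (ch p)" "snd (ch p) p $ 2 = 0" if "p \<in> surface_boundary A" for p
    using someI_ex[of "\<lambda>a. a \<in> A \<and> p \<in> fst a \<and> snd a p $ 2 = 0"] that unfolding ch_def boundary_iff by blast+
  define sp where "sp = (\<lambda>p. sense (ch p) (snd (ch p) p))"
  have sp: "sense a u = sp (par a u)" if a: "a \<in> A" and u: "u \<in> img a" "u$2 = 0" for a u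
  proof -
    have p: "par a u \<in> surface_boundary A" by (rule par_boundary[OF a u])
    have "sense a (snd a (par a u)) = sense (ch (par a u)) (snd (ch (par a u)) (par a u))"
      using ch[OF p] a u by (intro sense_trans) auto
    then show ?thesis using u by (simp add: sp_def)
  qed
  define pre where "pre = (\<lambda>\<theta>. inv_into (surface_boundary A) f (horo c Y R \<theta>))"
  have pre: "pre \<theta> \<in> surface_boundary A" "f (pre \<theta>) = horo c Y R \<theta>" for \<theta>
    using bij_boundary unfolding pre_def bij_betw_def by (auto intro: inv_into_into f_inv_into_f)
  have pre_eq: "pre \<theta> = p" if "p \<in> surface_boundary A" "f p = horo c Y R \<theta>" for p \<theta>
    using bij_boundary that inv_into_f_f[of f "surface_boundary A" p] unfolding pre_def bij_betw_def by simp
  have sp2: "sp (pre \<theta>) * sp (pre \<theta>) = 1" for \<theta>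
  proof -
    note c = ch[OF pre(1)[of \<theta>]]
    have i: "snd (ch (pre \<theta>)) (pre \<theta>) \<in> img (ch (pre \<theta>))" using c by simp
    then show ?thesis
      using cmc_patch.ori_nonzero[OF patch[OF c(1)] i] turn_nonzero[OF c(1) i c(3)]
      by (simp add: sp_def sense_def sgn_if)
  qed
  have loc: "\<exists>\<epsilon>>0. \<forall>\<phi>. \<bar>\<phi> - \<theta>\<bar> < \<epsilon> \<longrightarrow> sp (pre \<phi>) = sp (pre \<theta>)" for \<theta>
  proof -
    let ?p = "pre \<theta>"
    define a where "a = ch ?p"
    define u where "u = snd a ?p"
    have a: "a \<in> A" and u: "u \<in> img a" "u$2 = 0" and pu: "par a u = ?p"
      using ch[OF pre(1)[of \<theta>]] by (simp_all add: a_def u_def)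
    have su: "surf a u = horo c Y R \<theta>" by (simp add: surf_def pu pre)
    obtain \<delta> where \<delta>: "\<delta> > 0" "\<forall>x. \<bar>x\<bar> < \<delta> \<longrightarrow> u + x *\<^sub>R E1 \<in> img a \<and> (u + x *\<^sub>R E1)$2 = 0
        \<and> sense a (u + x *\<^sub>R E1) = sense a u"
      using sense_locally_constant[OF a u] by blast
    obtain \<epsilon> where \<epsilon>: "\<epsilon> > 0" "\<forall>\<phi>. \<bar>\<phi> - \<theta>\<bar> < \<epsilon> \<longrightarrow>
        (\<exists>x. \<bar>x\<bar> < \<delta> \<and> u + x *\<^sub>R E1 \<in> img a \<and> surf a (u + x *\<^sub>R E1) = horo c Y R \<phi>)"
      using boundary_line_covers[OF a u su \<delta>(1)] by blast
    have "sp (pre \<phi>) = sp (pre \<theta>)" if \<phi>: "\<bar>\<phi> - \<theta>\<bar> < \<epsilon>" for \<phi>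
    proof -
      obtain x where x: "\<bar>x\<bar> < \<delta>" "surf a (u + x *\<^sub>R E1) = horo c Y R \<phi>" using \<epsilon>(2) \<phi> by blast
      let ?v = "u + x *\<^sub>R E1"
      have v: "?v \<in> img a" "?v $ 2 = 0" "sense a ?v = sense a u" using \<delta>(2) x(1) by blast+
      have "pre \<phi> = par a ?v"
        using x(2) by (intro pre_eq par_boundary[OF a v(1,2)]) (simp add: surf_def)
      then have "sp (pre \<phi>) = sense a ?v" using sp[OF a v(1,2)] by simp
      also have "\<dots> = sp (pre \<theta>)" using v(3) sp[OF a u] pu by simp
      finally show ?thesis .
    qed
    with \<epsilon>(1) show ?thesis by blast
  qed
  have "continuous_on UNIV (\<lambda>\<theta>. sp (pre \<theta>))"
    unfolding continuous_on_iff
  proof (intro ballI allI impI)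
    fix \<theta> e :: real assume e: "e > 0"
    obtain \<epsilon> where \<epsilon>: "\<epsilon> > 0" "\<forall>\<phi>. \<bar>\<phi> - \<theta>\<bar> < \<epsilon> \<longrightarrow> sp (pre \<phi>) = sp (pre \<theta>)" using loc[of \<theta>] by blast
    have "dist (sp (pre \<phi>)) (sp (pre \<theta>)) < e" if \<phi>: "dist \<phi> \<theta> < \<epsilon>" for \<phi>
    proof -
      have eq: "sp (pre \<phi>) = sp (pre \<theta>)" using \<epsilon>(2) \<phi> unfolding dist_real_def by blast
      show ?thesis unfolding eq using e by simp
    qed
    then show "\<exists>d>0. \<forall>\<phi>\<in>UNIV. dist \<phi> \<theta> < d \<longrightarrow> dist (sp (pre \<phi>)) (sp (pre \<theta>)) < e"
      using \<epsilon>(1) by blast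
  qed
  moreover have "finite (range (\<lambda>\<theta>. sp (pre \<theta>)))"
  proof (rule finite_subset)
    have "sp (pre \<theta>) = 1 \<or> sp (pre \<theta>) = -1" for \<theta> using sp2[of \<theta>] square_eq_1_iff by blast
    then show "range (\<lambda>\<theta>. sp (pre \<theta>)) \<subseteq> {1, -1}" by blast
  qed simp
  ultimately have "(\<lambda>\<theta>. sp (pre \<theta>)) constant_on UNIV"
    using continuous_finite_range_constant[of UNIV "\<lambda>\<theta>. sp (pre \<theta>)"] by simp
  then obtain k where k: "\<And>\<theta>. sp (pre \<theta>) = k" by (auto simp: constant_on_def)
  have "sense a u = k" if a: "a \<in> A" and u: "u \<in> img a" "u$2 = 0" for a u
  proof -
    obtain \<theta> where "surf a u = horo c Y R \<theta>" using surf_boundary[OF a u] by blast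
    then have "pre \<theta> = par a u" by (intro pre_eq par_boundary[OF a u]) (simp add: surf_def)
    then show ?thesis using sp[OF a u] k[of \<theta>] by simp
  qed
  moreover have "k * k = 1" using sp2[of 0] k by simp
  ultimately show ?thesis by blast
qed

text \<open>Otherwise the flux form, multiplied by the sense and by the sign of \<open>H\<close>, is closed and positive
  along the boundary.\<close>

theorem mean_curvature_le:
  assumes X: "compact_space X" and B: "surface_boundary A \<noteq> {}"
  shows "\<bar>H\<bar> \<le> c + 1"
proof (rule ccontr)
  assume "\<not> \<bar>H\<bar> \<le> c + 1"
  then have Hc: "\<bar>H\<bar> > c + 1" by simp
  obtain k where k: "k * k = 1" "\<forall>a\<in>A. \<forall>u\<in>img a. u$2 = 0 \<longrightarrow> sense a u = k" using sense_constant by blast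
  let ?\<omega> = "flux_form (k * sgn H) c Y R"
  interpret twisted_form X A ?\<omega> by (rule twisted_form_flux_form[OF X])
  have pos: "?\<omega> a u E1 > 0" if a: "a \<in> A" and u: "u \<in> img a" "u$2 = 0" for a u
  proof -
    let ?f = "flux c Y R H (surf a u) (nrm a u) (dsurf a u E1)"
    obtain \<theta> where \<theta>: "surf a u = horo c Y R \<theta>" using surf_boundary[OF a u] by blast
    have n: "sol_metric (horo c Y R \<theta>) (nrm a u) (nrm a u) = 1"
      using cmc_patch.normal_unit[OF patch[OF a] u(1)] by (simp add: sol_metric_frame \<theta>)
    have "sgn ?f = sgn H * sgn (turn a u)"
      using sgn_flux(2)[OF c R Hc n boundary_tangent[OF a u \<theta>]] by (simp add: \<theta>)
    then have "sgn (?\<omega> a u E1) = sgn (k * sgn H) * (sgn H * sense a u)"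
      by (simp add: flux_form_def sgn_mult sense_def)
    also have "\<dots> = 1"
      using k a u H by (auto simp: sgn_mult square_eq_1_iff sgn_if)
    finally show ?thesis by (simp add: sgn_1_pos)
  qed
  obtain p where "p \<in> surface_boundary A" using B by blast
  then obtain a where a: "a \<in> A" "p \<in> fst a" "snd a p $ 2 = 0" unfolding boundary_iff by blast
  have "?\<omega> a (snd a p) E1 = 0"
    by (rule nonneg_on_boundary_imp_zero[OF less_imp_le[OF pos] a(1) chart_in[OF a(2)] a(3)])
  then show False using pos[OF a(1) chart_in[OF a(2)] a(3)] by simp
qed

end

section \<open>The bound\<close>

lemma add_one_le_bound:
  fixes c :: real assumes c: "c > 1"
  shows "c + 1 \<le> (c + 1) / (c - 1) * ((c + sqrt (c\<^sup>2 - 1)) / 2)"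
proof -
  have "c - 2 \<le> sqrt (c\<^sup>2 - 1)"
  proof (cases "c \<ge> 2")
    case True
    have "(c - 2)\<^sup>2 \<le> c\<^sup>2 - 1" using True by (simp add: power2_eq_square algebra_simps)
    then show ?thesis by (rule real_le_rsqrt)
  next
    case False
    have "0 \<le> sqrt (c\<^sup>2 - 1)" using c by (simp add: power2_eq_square) (metis less_imp_le mult_mono' mult_1 zero_le_one)
    then show ?thesis using False by linarith
  qed
  then have "c - 1 \<le> (c + sqrt (c\<^sup>2 - 1)) / 2" by simp
  then have "(c + 1) / (c - 1) * (c - 1) \<le> (c + 1) / (c - 1) * ((c + sqrt (c\<^sup>2 - 1)) / 2)"
    using c by (intro mult_left_mono) auto
  then show ?thesis using c by simp
qed

theorem corollary2p3:
  fixes M :: "'a topology" and A :: "'a chart set" and f :: "'a \<Rightarrow> real^3"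
    and \<Gamma> :: "(real^3) set" and c H :: real
  assumes "c > 1"
    and "circle_of_curvature c \<Gamma>"
    and "compact_surface M A"
    and "spans_by A f \<Gamma>"
    and "constant_mean_curvature A f H"
  shows "\<bar>H\<bar> \<le> (c + 1) / (c - 1) * ((c + sqrt (c\<^sup>2 - 1)) / 2)"
proof -
  have "\<bar>H\<bar> \<le> c + 1"
  proof (cases "H = 0")
    case True
    then show ?thesis using \<open>c > 1\<close> by simp
  next
    case False
    obtain Y R where YR: "R > 0" "\<Gamma> = range (horo c Y R)"
      using circle_of_curvature_param[OF assms(1,2)] by blast
    have "smooth_surface M A" "compact_space M" "surface_boundary A \<noteq> {}" "immersion A f" "boundary_diffeo A f \<Gamma>"
      using assms(3,4) by (simp_all add: compact_surface_def spans_by_def)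
    then interpret spanning_surface M A f H c Y R
      using assms(1,5) False YR
      by (intro spanning_surface.intro cmc_surface.intro surface.intro cmc_surface_axioms.intro
          spanning_surface_axioms.intro) auto
    show ?thesis by (rule mean_curvature_le) fact+
  qed
  then show ?thesis using add_one_le_bound[OF assms(1)] by linarith
qed

end
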